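(* Let $(M,\omega)$ be a Kähler manifold such that there exists an everywhere positive real-analytic function $\rho$ on $M$ satisfying $\omega=i\partial\overline{\partial}\log\rho$. Let $U$ be an open connected (nonempty) subset of $M$, let $1\leq N\leq\infty$, and let $\{h_j\}_{j=1}^N$ be holomorphic functions on $U$ such that $$\sum_{j=1}^N |h_j|^2=\rho \quad\text{on }U,$$ where, when $N=\infty$, the series converges locally uniformly on $U$. Set $H=(h_1,\ldots,h_N)\colon U\to\mathbb C^N$ if $N<\infty$ and $H=(h_1,h_2,\ldots)\colon U\to\ell^2$ if $N=\infty$. Assume that there exists a constant $\mu>0$ such that $\rho^\mu$ admits a sesqui-holomorphic extension to $M\times M$; that is, there exists a function $K$ on $M\times M$, holomorphic in the first variable and anti-holomorphic in the second variable, such that $K(z,z)=\rho(z)^\mu$ on $M$. Then the following statements hold. (1) $H$ admits a semi-single-valued holomorphic extension to $M$. (2) Each $h_j$ admits a semi-single-valued holomorphic extension to $M$, and $|h_j|^2$ admits a single-valued real-analytic extension to $M$. These extensions still satisfy $\sum_{j=1}^N |h_j|^2=\rho$ on $M$. (3) Assume $N\geq 2$. Then the map $[H]\colon(M,\omega)\to(\mathbb P^{N-1},\omega_{FS})$ defined as follows is a well-defined holomorphic isometric immersion: for $q\in M$, choose any analytic continuation $\widetilde H$ of $H$ to a neighborhood of $q$ and set $[H](q)=[\widetilde H(q)]$.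
   Context: All complex manifolds are assumed connected. $\ell^2$ is the space of square-summable complex sequences. For $2\le N\le\infty$, $\mathbb P^{N-1}$ is the quotient of $\mathbb C^N\setminus\{0\}$ (if $N<\infty$) or $\ell^2\setminus\{0\}$ (if $N=\infty$; then $\mathbb P^{N-1}$ means $\mathbb P^\infty$) by multiplication by $\mathbb C^*$, and $\omega_{FS}=i\partial\overline{\partial}\log\sum_{j}|z_j|^2$ in homogeneous coordinates (understood formally if $N=\infty$). A map $F$ from a complex manifold to $\ell^2$ is holomorphic if near every point it is $F=(f_1,f_2,\ldots)$ with $f_k$ holomorphic and $\sum|f_k|^2$ uniformly convergent on compact sets. Let $U\subseteq M$ be open and connected, and $H=(h_j)$ a holomorphic map from $U$ to $\mathcal T=\mathbb C^N$ or $\ell^2$ (a single holomorphic function is the case $\mathcal T=\mathbb C$). $H$ admits a (possibly multi-valued) holomorphic extension to $M$ if, for every continuous curve $\gamma\colon[0,1]\to M$ with $\gamma(0)\in U$ and every $t\in[0,1]$, there exists a neighborhood $U_t$ of $\gamma(t)$ such that every component $h_j$ admits an analytic continuation along $\gamma|_{[0,t]}$ to a holomorphic function $(h_j)_t$ on $U_t$; if $\mathcal T=\ell^2$ it is further required that $\sum_j|(h_j)_t|^2$ converges locally uniformly on $U_t$. $H$ admits a semi-single-valued holomorphic extension to $M$ if in addition, for any two continuous curves $\gamma_1,\gamma_2$ in $M$ connecting a point $p\in U$ to a point $q\in M$, the corresponding analytic continuations $H_1,H_2$ satisfy $H_1=e^{i\theta}H_2$ in a neighborhood of $q$, for some $\theta\in\mathbb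 R$. It admits a single-valued extension if the continuation to every $q\in M$ is independent of the curve. A holomorphic isometric immersion $\mathcal F\colon(M,\omega)\to(\mathbb P^{N-1},\omega_{FS})$ is a map such that every $p\in M$ has a neighborhood $W$ and holomorphic functions $\{f_k\}_{k=1}^N$ on $W$ without common zeros (with $\sum|f_k|^2$ uniformly convergent on $W$ if $N=\infty$) such that $i\partial\overline\partial\log\sum_k|f_k|^2=\omega$ and $\mathcal F=[f_1,f_2,\ldots]$ on $W$. *)

theory Defs
  imports "HOL-Analysis.Analysis"
begin

section \<open>Functions on open subsets of \<open>\<complex>\<^sup>n\<close>\<close>

definition sv_holomorphic_on :: "(complex^'n \<Rightarrow> complex) \<Rightarrow> (complex^'n) set \<Rightarrow> bool" where
  "sv_holomorphic_on g S \<longleftrightarrow>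
     (\<forall>x\<in>S. \<exists>L. (g has_derivative L) (at x) \<and> (\<forall>c v. L (c *s v) = c * L v))"

text \<open>Multi-indices are functions \<open>\<alpha>\<close> supported on \<^term>\<open>Basis\<close>; the power series converges
  unconditionally, which for real series is absolute convergence.\<close>

definition real_analytic_at :: "('e::euclidean_space \<Rightarrow> real) \<Rightarrow> 'e \<Rightarrow> bool" where
  "real_analytic_at g x \<longleftrightarrow>
     (\<exists>r>0. \<exists>a :: ('e \<Rightarrow> nat) \<Rightarrow> real. \<forall>y\<in>ball x r.
        ((\<lambda>\<alpha>. a \<alpha> * (\<Prod>b\<in>Basis. ((y - x) \<bullet> b) ^ \<alpha> b)) has_sum g y)
          {\<alpha>. \<forall>b. b \<notin> Basis \<longrightarrow> \<alpha> b = 0})"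

fun ck_on :: "nat \<Rightarrow> ('e::euclidean_space \<Rightarrow> real) \<Rightarrow> 'e set \<Rightarrow> bool" where
  "ck_on 0 g S \<longleftrightarrow> continuous_on S g"
| "ck_on (Suc k) g S \<longleftrightarrow>
     (\<forall>x\<in>S. g differentiable (at x)) \<and>
     (\<forall>v. ck_on k (\<lambda>x. frechet_derivative g (at x) v) S)"

definition smooth_on :: "('e::euclidean_space \<Rightarrow> real) \<Rightarrow> 'e set \<Rightarrow> bool" where
  "smooth_on g S \<longleftrightarrow> (\<forall>k. ck_on k g S)"

definition wirtinger :: "'n::finite \<Rightarrow> (complex^'n \<Rightarrow> complex) \<Rightarrow> complex^'n \<Rightarrow> complex" where
  "wirtinger j g x =
     (frechet_derivative g (at x) (axis j 1) - \<i> * frechet_derivative g (at x) (axis j \<i>)) / 2"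

definition wirtinger_bar :: "'n::finite \<Rightarrow> (complex^'n \<Rightarrow> complex) \<Rightarrow> complex^'n \<Rightarrow> complex" where
  "wirtinger_bar j g x =
     (frechet_derivative g (at x) (axis j 1) + \<i> * frechet_derivative g (at x) (axis j \<i>)) / 2"


section \<open>Complex manifolds\<close>

text \<open>The underlying space is the whole type \<open>'m\<close>; a complex structure of dimension \<open>CARD('n)\<close> is
  given by a holomorphic atlas, not required to be maximal.\<close>

type_synonym ('m, 'n) chart = "'m set \<times> ('m \<Rightarrow> complex^'n)"

abbreviation chart_inv :: "('m, 'n) chart \<Rightarrow> complex^'n \<Rightarrow> 'm" where
  "chart_inv \<kappa> \<equiv> inv_into (fst \<kappa>) (snd \<kappa>)"

definition is_chart :: "('m::topological_space, 'n::finite) chart \<Rightarrow> bool" where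
  "is_chart \<kappa> \<longleftrightarrow> open (fst \<kappa>) \<and> open (snd \<kappa> ` fst \<kappa>) \<and>
     homeomorphism (fst \<kappa>) (snd \<kappa> ` fst \<kappa>) (snd \<kappa>) (chart_inv \<kappa>)"

definition complex_manifold ::
    "('m::{t2_space, second_countable_topology}, 'n::finite) chart set \<Rightarrow> bool" where
  "complex_manifold A \<longleftrightarrow>
     connected (UNIV :: 'm set) \<and>
     (\<forall>\<kappa>\<in>A. is_chart \<kappa>) \<and> (\<Union>\<kappa>\<in>A. fst \<kappa>) = UNIV \<and>
     (\<forall>\<kappa>\<in>A. \<forall>\<kappa>'\<in>A. \<forall>i.
        sv_holomorphic_on (\<lambda>x. snd \<kappa>' (chart_inv \<kappa> x) $ i) (snd \<kappa> ` (fst \<kappa> \<inter> fst \<kappa>')))"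

definition mf_holomorphic_on ::
    "('m, 'n::finite) chart set \<Rightarrow> ('m \<Rightarrow> complex) \<Rightarrow> 'm set \<Rightarrow> bool" where
  "mf_holomorphic_on A f S \<longleftrightarrow>
     (\<forall>\<kappa>\<in>A. sv_holomorphic_on (f \<circ> chart_inv \<kappa>) (snd \<kappa> ` (fst \<kappa> \<inter> S)))"

definition mf_real_analytic_on ::
    "('m, 'n::finite) chart set \<Rightarrow> ('m \<Rightarrow> real) \<Rightarrow> 'm set \<Rightarrow> bool" where
  "mf_real_analytic_on A f S \<longleftrightarrow>
     (\<forall>\<kappa>\<in>A. \<forall>x\<in>snd \<kappa> ` (fst \<kappa> \<inter> S). real_analytic_at (f \<circ> chart_inv \<kappa>) x)"

definition sesqui_holomorphic ::
    "('m, 'n::finite) chart set \<Rightarrow> ('m \<Rightarrow> 'm \<Rightarrow> complex) \<Rightarrow> bool" where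
  "sesqui_holomorphic A K \<longleftrightarrow>
     (\<forall>w. mf_holomorphic_on A (\<lambda>z. K z w) UNIV) \<and>
     (\<forall>z. mf_holomorphic_on A (\<lambda>w. cnj (K z w)) UNIV)"


section \<open>Kaehler forms\<close>

text \<open>A real 2-form is given by its coordinate expressions: \<open>\<omega> \<kappa> p u v\<close> is the value at \<open>p\<close> on the
  tangent vectors with coordinates \<open>u\<close> and \<open>v\<close> in the chart \<open>\<kappa>\<close>.\<close>

type_synonym ('m, 'n) form2 =
  "('m, 'n) chart \<Rightarrow> 'm \<Rightarrow> complex^'n \<Rightarrow> complex^'n \<Rightarrow> real"

definition is_form2 :: "('m, 'n::finite) chart set \<Rightarrow> ('m, 'n) form2 \<Rightarrow> bool" where
  "is_form2 A \<omega> \<longleftrightarrow>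
     (\<forall>\<kappa>\<in>A. \<forall>p\<in>fst \<kappa>. bilinear (\<omega> \<kappa> p) \<and> (\<forall>u v. \<omega> \<kappa> p u v = - \<omega> \<kappa> p v u)) \<and>
     (\<forall>\<kappa>\<in>A. \<forall>\<kappa>'\<in>A. \<forall>p\<in>fst \<kappa> \<inter> fst \<kappa>'. \<forall>u v.
        \<omega> \<kappa> p u v =
        \<omega> \<kappa>' p (frechet_derivative (snd \<kappa>' \<circ> chart_inv \<kappa>) (at (snd \<kappa> p)) u)
               (frechet_derivative (snd \<kappa>' \<circ> chart_inv \<kappa>) (at (snd \<kappa> p)) v)) \<and>
     (\<forall>\<kappa>\<in>A. \<forall>u v. smooth_on (\<lambda>x. \<omega> \<kappa> (chart_inv \<kappa> x) u v) (snd \<kappa> ` fst \<kappa>))"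

definition form2_closed :: "('m, 'n::finite) chart set \<Rightarrow> ('m, 'n) form2 \<Rightarrow> bool" where
  "form2_closed A \<omega> \<longleftrightarrow>
     (\<forall>\<kappa>\<in>A. \<forall>x\<in>snd \<kappa> ` fst \<kappa>. \<forall>u v w.
        frechet_derivative (\<lambda>y. \<omega> \<kappa> (chart_inv \<kappa> y) v w) (at x) u
      - frechet_derivative (\<lambda>y. \<omega> \<kappa> (chart_inv \<kappa> y) u w) (at x) v
      + frechet_derivative (\<lambda>y. \<omega> \<kappa> (chart_inv \<kappa> y) u v) (at x) w = 0)"

text \<open>The second conjunct says that \<open>\<omega>\<close> has type (1,1), the third that it is positive.\<close>

definition kaehler_form :: "('m, 'n::finite) chart set \<Rightarrow> ('m, 'n) form2 \<Rightarrow> bool" where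
  "kaehler_form A \<omega> \<longleftrightarrow>
     is_form2 A \<omega> \<and>
     (\<forall>\<kappa>\<in>A. \<forall>p\<in>fst \<kappa>. \<forall>u v. \<omega> \<kappa> p (\<i> *s u) (\<i> *s v) = \<omega> \<kappa> p u v) \<and>
     (\<forall>\<kappa>\<in>A. \<forall>p\<in>fst \<kappa>. \<forall>u. u \<noteq> 0 \<longrightarrow> \<omega> \<kappa> p u (\<i> *s u) > 0) \<and>
     form2_closed A \<omega>"

text \<open>The coordinate expression at \<open>p\<close> of i del delbar \<open>f\<close>, the sum over \<open>j, k\<close> of
  \<open>\<i> f\<^sub>j\<^sub>k dz\<^sub>j \<and> dz\<^sub>k\<close>, where \<open>f\<^sub>j\<^sub>k\<close> is the mixed Wirtinger derivative and the second
  differential is conjugated; \<open>(\<alpha> \<and> \<beta>)(u, v) = \<alpha>(u) \<beta>(v) - \<alpha>(v) \<beta>(u)\<close>.\<close>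

definition i_ddbar ::
    "('m \<Rightarrow> real) \<Rightarrow> ('m, 'n::finite) chart \<Rightarrow> 'm \<Rightarrow> complex^'n \<Rightarrow> complex^'n \<Rightarrow> complex" where
  "i_ddbar f \<kappa> p u v =
     \<i> * (\<Sum>j\<in>UNIV. \<Sum>k\<in>UNIV.
           wirtinger j (wirtinger_bar k (\<lambda>x. complex_of_real (f (chart_inv \<kappa> x)))) (snd \<kappa> p)
           * (u $ j * cnj (v $ k) - v $ j * cnj (u $ k)))"

definition form2_is_i_ddbar_on ::
    "('m, 'n::finite) chart set \<Rightarrow> ('m, 'n) form2 \<Rightarrow> ('m \<Rightarrow> real) \<Rightarrow> 'm set \<Rightarrow> bool" where
  "form2_is_i_ddbar_on A \<omega> f S \<longleftrightarrow>
     (\<forall>\<kappa>\<in>A. \<forall>p\<in>fst \<kappa> \<inter> S. \<forall>u v. complex_of_real (\<omega> \<kappa> p u v) = i_ddbar f \<kappa> p u v)"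


section \<open>Tuples of functions, \<open>\<complex>\<^sup>N\<close>, \<open>\<ell>\<^sup>2\<close> and projective spaces\<close>

text \<open>The value at \<open>p\<close> of an \<open>N\<close>-tuple of functions, with \<open>N = \<infinity>\<close> allowed. Indices start at 0, and
  finite tuples are padded with zeros.\<close>

definition tuple :: "enat \<Rightarrow> (nat \<Rightarrow> 'm \<Rightarrow> complex) \<Rightarrow> 'm \<Rightarrow> nat \<Rightarrow> complex" where
  "tuple N h p = (\<lambda>j. if enat j < N then h j p else 0)"

text \<open>This is \<open>\<complex>\<^sup>N\<close> if \<open>N\<close> is finite (summability is then automatic) and \<open>\<ell>\<^sup>2\<close> if \<open>N = \<infinity>\<close>.\<close>

definition cspace :: "enat \<Rightarrow> (nat \<Rightarrow> complex) set" where
  "cspace N = {z. (\<forall>j. enat j \<ge> N \<longrightarrow> z j = 0) \<and> summable (\<lambda>j. (cmod (z j))\<^sup>2)}"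

definition proj_rel :: "enat \<Rightarrow> ((nat \<Rightarrow> complex) \<times> (nat \<Rightarrow> complex)) set" where
  "proj_rel N = {(z, w). z \<in> cspace N - {\<lambda>_. 0} \<and> w \<in> cspace N - {\<lambda>_. 0} \<and>
                         (\<exists>c. c \<noteq> 0 \<and> w = (\<lambda>j. c * z j))}"

definition proj_space :: "enat \<Rightarrow> (nat \<Rightarrow> complex) set set" where
  "proj_space N = (cspace N - {\<lambda>_. 0}) // proj_rel N"

definition proj_class :: "enat \<Rightarrow> (nat \<Rightarrow> complex) \<Rightarrow> (nat \<Rightarrow> complex) set" where
  "proj_class N z = proj_rel N `` {z}"

definition sq_partial_sum :: "(nat \<Rightarrow> 'm \<Rightarrow> complex) \<Rightarrow> nat \<Rightarrow> 'm \<Rightarrow> real" where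
  "sq_partial_sum h n p = (\<Sum>j<n. (cmod (h j p))\<^sup>2)"

definition locally_uniformly_convergent_on ::
    "'m::topological_space set \<Rightarrow> (nat \<Rightarrow> 'm \<Rightarrow> real) \<Rightarrow> bool" where
  "locally_uniformly_convergent_on S s \<longleftrightarrow>
     (\<forall>p\<in>S. \<exists>W. open W \<and> p \<in> W \<and> uniformly_convergent_on (W \<inter> S) s)"


section \<open>Analytic continuation along curves\<close>

text \<open>The function \<open>g\<close> on the neighbourhood \<open>W\<close> of \<open>\<gamma> t\<close> is an analytic continuation, along
  \<open>\<gamma>\<close> restricted to \<open>[0, t]\<close>, of the germ of \<open>f\<close> at \<open>\<gamma> 0\<close>.\<close>

definition continuation_along ::
    "('m::topological_space, 'n::finite) chart set \<Rightarrow> ('m \<Rightarrow> complex) \<Rightarrow> (real \<Rightarrow> 'm) \<Rightarrow> real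
     \<Rightarrow> 'm set \<Rightarrow> ('m \<Rightarrow> complex) \<Rightarrow> bool" where
  "continuation_along A f \<gamma> t W g \<longleftrightarrow>
     (\<exists>V F. (\<forall>s\<in>{0..t}. open (V s) \<and> \<gamma> s \<in> V s \<and> mf_holomorphic_on A (F s) (V s)) \<and>
            (\<forall>\<^sub>F x in nhds (\<gamma> 0). F 0 x = f x) \<and>
            (\<forall>s\<in>{0..t}. \<forall>\<^sub>F s' in at s within {0..t}. \<forall>\<^sub>F x in nhds (\<gamma> s'). F s' x = F s x) \<and>
            V t = W \<and> F t = g)"

definition tuple_continuation_along ::
    "('m::topological_space, 'n::finite) chart set \<Rightarrow> enat \<Rightarrow> (nat \<Rightarrow> 'm \<Rightarrow> complex)
     \<Rightarrow> (real \<Rightarrow> 'm) \<Rightarrow> real \<Rightarrow> 'm set \<Rightarrow> (nat \<Rightarrow> 'm \<Rightarrow> complex) \<Rightarrow> bool" where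
  "tuple_continuation_along A N h \<gamma> t W g \<longleftrightarrow>
     open W \<and> \<gamma> t \<in> W \<and>
     (\<forall>j. enat j < N \<longrightarrow> continuation_along A (h j) \<gamma> t W (g j)) \<and>
     (N = \<infinity> \<longrightarrow> locally_uniformly_convergent_on W (sq_partial_sum g))"

definition admits_extension ::
    "('m::topological_space, 'n::finite) chart set \<Rightarrow> 'm set \<Rightarrow> enat \<Rightarrow> (nat \<Rightarrow> 'm \<Rightarrow> complex)
     \<Rightarrow> bool" where
  "admits_extension A U N h \<longleftrightarrow>
     (\<forall>\<gamma>. path \<gamma> \<and> pathstart \<gamma> \<in> U \<longrightarrow>
        (\<forall>t\<in>{0..1}. \<exists>W g. tuple_continuation_along A N h \<gamma> t W g))"

definition admits_semi_single_valued_extension ::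
    "('m::topological_space, 'n::finite) chart set \<Rightarrow> 'm set \<Rightarrow> enat \<Rightarrow> (nat \<Rightarrow> 'm \<Rightarrow> complex)
     \<Rightarrow> bool" where
  "admits_semi_single_valued_extension A U N h \<longleftrightarrow>
     admits_extension A U N h \<and>
     (\<forall>\<gamma>1 \<gamma>2 W1 W2 g1 g2.
        path \<gamma>1 \<and> path \<gamma>2 \<and> pathstart \<gamma>1 \<in> U \<and>
        pathstart \<gamma>1 = pathstart \<gamma>2 \<and> pathfinish \<gamma>1 = pathfinish \<gamma>2 \<and>
        tuple_continuation_along A N h \<gamma>1 1 W1 g1 \<and>
        tuple_continuation_along A N h \<gamma>2 1 W2 g2 \<longrightarrow>
        (\<exists>\<theta>::real. \<forall>\<^sub>F x in nhds (pathfinish \<gamma>1). \<forall>j. enat j < N \<longrightarrow> g1 j x = cis \<theta> * g2 j x))"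

definition continuation_values ::
    "('m::topological_space, 'n::finite) chart set \<Rightarrow> 'm set \<Rightarrow> enat \<Rightarrow> (nat \<Rightarrow> 'm \<Rightarrow> complex)
     \<Rightarrow> 'm \<Rightarrow> (nat \<Rightarrow> complex) set" where
  "continuation_values A U N h q =
     {tuple N g q | \<gamma> W g. path \<gamma> \<and> pathstart \<gamma> \<in> U \<and> pathfinish \<gamma> = q \<and>
                           tuple_continuation_along A N h \<gamma> 1 W g}"

definition bracket ::
    "('m::topological_space, 'n::finite) chart set \<Rightarrow> 'm set \<Rightarrow> enat \<Rightarrow> (nat \<Rightarrow> 'm \<Rightarrow> complex)
     \<Rightarrow> 'm \<Rightarrow> (nat \<Rightarrow> complex) set" where
  "bracket A U N h q = proj_class N (SOME z. z \<in> continuation_values A U N h q)"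

definition bracket_well_defined ::
    "('m::topological_space, 'n::finite) chart set \<Rightarrow> 'm set \<Rightarrow> enat \<Rightarrow> (nat \<Rightarrow> 'm \<Rightarrow> complex)
     \<Rightarrow> bool" where
  "bracket_well_defined A U N h \<longleftrightarrow>
     (\<forall>q. continuation_values A U N h q \<noteq> {} \<and>
          continuation_values A U N h q \<subseteq> cspace N - {\<lambda>_. 0} \<and>
          (\<forall>z\<in>continuation_values A U N h q. \<forall>w\<in>continuation_values A U N h q.
             proj_class N z = proj_class N w))"


section \<open>Holomorphic isometric immersions into projective space\<close>

definition isometric_immersion ::
    "('m::topological_space, 'n::finite) chart set \<Rightarrow> ('m, 'n) form2 \<Rightarrow> enat
     \<Rightarrow> ('m \<Rightarrow> (nat \<Rightarrow> complex) set) \<Rightarrow> bool" where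
  "isometric_immersion A \<omega> N \<Phi> \<longleftrightarrow>
     range \<Phi> \<subseteq> proj_space N \<and>
     (\<forall>p. \<exists>W f. open W \<and> p \<in> W \<and>
        (\<forall>k. enat k < N \<longrightarrow> mf_holomorphic_on A (f k) W) \<and>
        (\<forall>x\<in>W. \<exists>k. enat k < N \<and> f k x \<noteq> 0) \<and>
        (N = \<infinity> \<longrightarrow> uniformly_convergent_on W (sq_partial_sum f)) \<and>
        form2_is_i_ddbar_on A \<omega> (\<lambda>x. ln (\<Sum>k. (cmod (tuple N f x k))\<^sup>2)) W \<and>
        (\<forall>x\<in>W. \<Phi> x = proj_class N (tuple N f x)))"

end

theory Submission
  imports Defs "HOL-Complex_Analysis.Complex_Analysis"
begin

text \<open>
The polarization of \<open>\<rho>\<close> is locally the kernel \<open>\<Sum> h\<^sub>j(z) cnj (h\<^sub>j(w))\<close>, so the \<open>k\<close>-th Taylor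
coefficients of all the \<open>h\<^sub>j\<close> along a complex line are square summable with sum the \<open>(k, k)\<close>-th
coefficient of the kernel (Calabi). Cauchy's estimate for the latter shows that \<open>H\<close> extends from any
small ball to a ball whose radius depends only on \<open>\<rho>\<close>, with \<open>\<Sum> |h\<^sub>j|\<^sup>2 = \<rho>\<close> preserved. Hence \<open>H\<close>
continues along every curve.

For the monodromy, fix \<open>w\<close> near a point of \<open>U\<close>. The function \<open>f = \<langle>H(z), H(w)\<rangle>\<close> satisfies
\<open>|f|\<^sup>\<mu> = |K(z, w)|\<close> near the diagonal, and this persists under continuation in \<open>z\<close>. As \<open>K\<close> is
single-valued, two continuations \<open>f\<^sub>1\<close>, \<open>f\<^sub>2\<close> to the same point have the same modulus, so
\<open>f\<^sub>1 = c f\<^sub>2\<close> with \<open>|c| = 1\<close>, where \<open>c\<close> is also independent of \<open>w\<close>. Finally \<open>H\<^sub>1 - c H\<^sub>2\<close> is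
orthogonal to all \<open>H(w)\<close>, hence to \<open>H\<^sub>1\<close> and \<open>H\<^sub>2\<close> themselves, and therefore vanishes.
\<close>


section \<open>Taylor coefficients and polarization in one variable\<close>

text \<open>Two kernels with different virtues are combined. Real analyticity polarizes \<rho>
  itself, but only near each point; since this local kernel is the pairing and not a power of it, it
  controls Taylor coefficients. K is global, but it polarizes only the \<mu>-th power of \<rho>, and
  a branch of the \<mu>-th power of the pairing need not survive continuation around zeros.
  Therefore only moduli are compared with K, and a unimodular constant remains undetermined.

  A second obstacle is that K is holomorphic in each variable separately, with no joint continuity
  or local bound given. Function theory is therefore done on complex lines, and a bounded separately
  holomorphic function is handled through its Taylor coefficients in one variable.

  The radius of extension around a point is fixed before the germ to be extended is known. This
  uniformity makes the existence of a continuation up to time t locally constant in t, so that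
  connectedness of the parameter interval finishes the argument.\<close>

definition taylor_coeff :: "(complex \<Rightarrow> complex) \<Rightarrow> nat \<Rightarrow> complex" where
  "taylor_coeff g k = (deriv ^^ k) g 0 / fact k"

lemma taylor_coeff_sums:
  assumes "g holomorphic_on ball 0 R" "\<zeta> \<in> ball 0 R"
  shows "(\<lambda>k. taylor_coeff g k * \<zeta> ^ k) sums g \<zeta>"
  using holomorphic_power_series[OF assms] by (simp add: taylor_coeff_def)

lemma taylor_coeff_bound:
  assumes "g holomorphic_on ball 0 R" "0 < R" "\<And>\<zeta>. \<zeta> \<in> ball 0 R \<Longrightarrow> cmod (g \<zeta>) \<le> C"
  shows "cmod (taylor_coeff g k) \<le> C / R ^ k"
proof -
  have *: "cmod (taylor_coeff g k) \<le> C / r ^ k" if r: "0 < r" "r < R" for r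
  proof -
    have sub: "cball 0 r \<subseteq> ball (0::complex) R" using r by auto
    have "norm ((deriv ^^ k) g 0) \<le> fact k * C / r ^ k"
    proof (rule Cauchy_inequality[OF _ _ r(1)])
      show "g holomorphic_on ball 0 r"
        using assms(1) r by (elim holomorphic_on_subset) auto
      show "continuous_on (cball 0 r) g"
        using assms(1) sub holomorphic_on_imp_continuous_on holomorphic_on_subset by blast
    qed (use assms(3) r in auto)
    then show ?thesis
      by (simp add: taylor_coeff_def norm_divide field_simps)
  qed
  \<comment> \<open>Cauchy's inequality is available only on closed discs of radius r < R; letting r
    tend to R recovers the constant of the open disc.\<close>
  have lim: "((\<lambda>r. C / r ^ k) \<longlongrightarrow> C / R ^ k) (at_left R)"
    using assms(2) by (intro tendsto_intros) auto
  have "eventually (\<lambda>r. r \<in> {0<..<R}) (at_left R)"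
    using assms(2) by (rule eventually_at_leftI[rotated]) auto
  then have "eventually (\<lambda>r. cmod (taylor_coeff g k) \<le> C / r ^ k) (at_left R)"
    by eventually_elim (use * in auto)
  with lim show ?thesis
    using tendsto_lowerbound by (metis trivial_limit_at_left_real)
qed

text \<open>Cauchy's bounds turn the remainder into a geometric series. The bound depends on g only
  through \<open>C\<close> and \<open>R\<close>, so it is uniform over families of
  functions.\<close>

lemma taylor_tail_bound:
  assumes "g holomorphic_on ball 0 R" "0 < R" "\<And>\<zeta>. \<zeta> \<in> ball 0 R \<Longrightarrow> cmod (g \<zeta>) \<le> C"
    and "\<zeta> \<in> ball 0 R"
  shows "cmod (g \<zeta> - (\<Sum>i<n. taylor_coeff g i * \<zeta> ^ i)) \<le> C * (cmod \<zeta> / R) ^ n / (1 - cmod \<zeta> / R)"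
proof -
  define q where "q = cmod \<zeta> / R"
  have q: "0 \<le> q" "q < 1" using assms by (auto simp: q_def)
  have s: "(\<lambda>k. taylor_coeff g k * \<zeta> ^ k) sums g \<zeta>"
    by (rule taylor_coeff_sums) fact+
  have "(\<lambda>k. taylor_coeff g (k + n) * \<zeta> ^ (k + n)) sums (g \<zeta> - (\<Sum>i<n. taylor_coeff g i * \<zeta> ^ i))"
    using s by (rule sums_split_initial_segment)
  then have eq: "g \<zeta> - (\<Sum>i<n. taylor_coeff g i * \<zeta> ^ i) = (\<Sum>k. taylor_coeff g (k + n) * \<zeta> ^ (k + n))"
    by (simp add: sums_iff)
  have gs: "(\<lambda>k. C * q ^ n * q ^ k) sums (C * q ^ n * (1 / (1 - q)))"
    using q by (intro sums_mult geometric_sums) auto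
  have "cmod (\<Sum>k. taylor_coeff g (k + n) * \<zeta> ^ (k + n)) \<le> (\<Sum>k. C * q ^ n * q ^ k)"
  proof (rule norm_suminf_le)
    fix k
    have "cmod (taylor_coeff g (k + n) * \<zeta> ^ (k + n)) \<le> C / R ^ (k + n) * cmod \<zeta> ^ (k + n)"
      unfolding norm_mult norm_power
      by (intro mult_right_mono taylor_coeff_bound assms) auto
    also have "\<dots> = C * q ^ n * q ^ k"
      by (simp add: q_def power_divide power_add mult_ac)
    finally show "cmod (taylor_coeff g (k + n) * \<zeta> ^ (k + n)) \<le> C * q ^ n * q ^ k" .
  qed (use gs in \<open>simp add: sums_iff\<close>)
  also have "\<dots> = C * q ^ n / (1 - q)"
    using gs by (simp add: sums_iff)
  finally show ?thesis by (simp add: eq q_def)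
qed

text \<open>The k-th coefficient is the limit, as z tends to 0, of the function minus its Taylor
  polynomial of degree below k, divided by the k-th power of z. The tail bound makes this limit
  uniform in the parameter s, so a property closed under differences, constant multiples and uniform
  limits passes from the values of \<open>\<Phi>\<close> to its Taylor coefficients.
  \<open>P\<close> is abstract because it stands for holomorphy both in one and in several
  variables; a uniform bound takes the place of joint continuity.\<close>

lemma taylor_coeff_closed:
  fixes \<Phi> :: "'a \<Rightarrow> complex \<Rightarrow> complex" and P :: "('a \<Rightarrow> complex) \<Rightarrow> bool"
  assumes R: "0 < R"
    and hol: "\<And>s. s \<in> S \<Longrightarrow> \<Phi> s holomorphic_on ball 0 R"
    and bd: "\<And>s \<zeta>. s \<in> S \<Longrightarrow> \<zeta> \<in> ball 0 R \<Longrightarrow> cmod (\<Phi> s \<zeta>) \<le> C"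
    and val: "\<And>\<zeta>. \<zeta> \<in> ball 0 R \<Longrightarrow> P (\<lambda>s. \<Phi> s \<zeta>)"
    and diff: "\<And>f g. P f \<Longrightarrow> P g \<Longrightarrow> P (\<lambda>s. f s - g s)"
    and scale: "\<And>c f. P f \<Longrightarrow> P (\<lambda>s. c * f s)"
    and lim: "\<And>f g. (\<And>n. P (f n)) \<Longrightarrow> uniform_limit S f g sequentially \<Longrightarrow> P g"
  shows "P (\<lambda>s. taylor_coeff (\<Phi> s) k)"
proof (induction k rule: less_induct)
  case (less k)
  \<comment> \<open>Nonzero points tending to 0. The shift by 2 keeps \<open>cmod (z n)\<close> at
    most R / 2, and it makes the factor q / (1 - q) from the tail bound equal to 1 / (n + 1), where
    q = \<open>cmod (z n) / R\<close>.\<close>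
  define z where "z n = complex_of_real (R / real (n + 2))" for n
  have z: "z n \<in> ball 0 R" "z n \<noteq> 0" "cmod (z n) / R = 1 / real (n + 2)" for n
  proof -
    have "R / real (n + 2) < R" using R by (auto simp: field_simps add_pos_nonneg)
    then show "z n \<in> ball 0 R" "z n \<noteq> 0" "cmod (z n) / R = 1 / real (n + 2)"
      using R by (auto simp: z_def simp del: of_real_divide)
  qed
  define f where "f n s = (1 / z n ^ k) * (\<Phi> s (z n) - (\<Sum>i<k. taylor_coeff (\<Phi> s) i * z n ^ i))" for n s
  show ?case
  proof (rule lim[of f])
    fix n
    \<comment> \<open>The terms are removed one at a time, using only differences and constant
      multiples; the lower coefficients satisfy \<open>P\<close> by the outer induction.\<close>
    have "P (\<lambda>s. \<Phi> s (z n) - (\<Sum>i<j. taylor_coeff (\<Phi> s) i * z n ^ i))" if "j \<le> k" for j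
      using that
    proof (induction j)
      case 0 then show ?case using val[OF z(1)] by simp
    next
      case (Suc j)
      have "P (\<lambda>s. (\<Phi> s (z n) - (\<Sum>i<j. taylor_coeff (\<Phi> s) i * z n ^ i)) - z n ^ j * taylor_coeff (\<Phi> s) j)"
        using Suc.IH Suc.prems less[of j] by (intro diff[OF _ scale]) auto
      then show ?case by (simp add: algebra_simps)
    qed
    then show "P (f n)"
      unfolding f_def by (rule scale[OF _]) simp
  next
    have bound: "dist (f n s) (taylor_coeff (\<Phi> s) k) \<le> \<bar>C\<bar> / R ^ k / real (n + 1)" if s: "s \<in> S" for n s
    proof -
      have zk: "cmod (z n) = R / real (n + 2)"
        using R by (simp add: z_def del: of_real_divide)
      have "f n s - taylor_coeff (\<Phi> s) k = (1 / z n ^ k) * (\<Phi> s (z n) - (\<Sum>i<Suc k. taylor_coeff (\<Phi> s) i * z n ^ i))"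
        using z(2)[of n] by (simp add: f_def diff_divide_distrib add_divide_distrib)
      then have "dist (f n s) (taylor_coeff (\<Phi> s) k)
          = (1 / cmod (z n) ^ k) * cmod (\<Phi> s (z n) - (\<Sum>i<Suc k. taylor_coeff (\<Phi> s) i * z n ^ i))"
        by (simp add: dist_norm norm_mult norm_divide norm_power)
      also have "\<dots> \<le> (1 / cmod (z n) ^ k) * (C * (cmod (z n) / R) ^ Suc k / (1 - cmod (z n) / R))"
        using s z(1) by (intro mult_left_mono taylor_tail_bound hol bd R) auto
      also have "\<dots> = C / R ^ k * ((cmod (z n) / R) / (1 - cmod (z n) / R))"
        using z(2)[of n] by (simp add: field_simps power_divide)
      also have "\<dots> = C / R ^ k * (1 / real (n + 1))"
        unfolding z(3) by (simp add: field_simps)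
      also have "\<dots> \<le> \<bar>C\<bar> / R ^ k * (1 / real (n + 1))"
        using R by (intro mult_right_mono divide_right_mono) auto
      finally show ?thesis by simp
    qed
    show "uniform_limit S f (\<lambda>s. taylor_coeff (\<Phi> s) k) sequentially"
    proof (rule uniform_limitI)
      fix e :: real assume "e > 0"
      have "(\<lambda>n. \<bar>C\<bar> / R ^ k / real (n + 1)) \<longlonglongrightarrow> 0"
        using tendsto_mult[OF tendsto_const LIMSEQ_inverse_real_of_nat, of "\<bar>C\<bar> / R ^ k"]
        by (simp add: field_simps)
      then have "eventually (\<lambda>n. \<bar>C\<bar> / R ^ k / real (n + 1) < e) sequentially"
        using \<open>e > 0\<close> by (rule order_tendstoD)
      then show "eventually (\<lambda>n. \<forall>s\<in>S. dist (f n s) (taylor_coeff (\<Phi> s) k) < e) sequentially"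
        by eventually_elim (use bound in \<open>auto intro: le_less_trans\<close>)
    qed
  qed
qed

lemma holomorphic_on_uniform_limit_open:
  assumes "open S" "\<And>n. f n holomorphic_on S" "uniform_limit S f g sequentially"
  shows "g holomorphic_on S"
proof (rule holomorphic_uniform_sequence[OF assms(1,2)])
  fix x assume "x \<in> S"
  then obtain d where "d > 0" "cball x d \<subseteq> S"
    using assms(1) open_contains_cball by blast
  then show "\<exists>d>0. cball x d \<subseteq> S \<and> uniform_limit (cball x d) f g sequentially"
    using uniform_limit_on_subset[OF assms(3)] by blast
qed

lemma holomorphic_taylor_coeff:
  assumes "0 < R"
    and "\<And>\<xi>. \<xi> \<in> S \<Longrightarrow> (\<lambda>\<zeta>. G \<zeta> \<xi>) holomorphic_on ball 0 R"
    and "\<And>\<zeta>. \<zeta> \<in> ball 0 R \<Longrightarrow> (\<lambda>\<xi>. G \<zeta> \<xi>) holomorphic_on S"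
    and "\<And>\<zeta> \<xi>. \<zeta> \<in> ball 0 R \<Longrightarrow> \<xi> \<in> S \<Longrightarrow> cmod (G \<zeta> \<xi>) \<le> C"
    and "open S"
  shows "(\<lambda>\<xi>. taylor_coeff (\<lambda>\<zeta>. G \<zeta> \<xi>) k) holomorphic_on S"
  by (rule taylor_coeff_closed[where S = S and C = C and R = R and P = "\<lambda>f. f holomorphic_on S"])
     (use assms in \<open>auto intro!: holomorphic_intros intro: holomorphic_on_uniform_limit_open\<close>)

text \<open>Expand G in its first variable: the coefficients are holomorphic in the second one, so
  each partial sum is holomorphic after substituting p and q. Restricting p to half the radius makes
  the expansion converge uniformly, with ratio at most 1/2.\<close>

lemma holomorphic_compose_separately:
  assumes R: "0 < R"
    and h1: "\<And>\<xi>. \<xi> \<in> S \<Longrightarrow> (\<lambda>\<zeta>. G \<zeta> \<xi>) holomorphic_on ball 0 R"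
    and h2: "\<And>\<zeta>. \<zeta> \<in> ball 0 R \<Longrightarrow> (\<lambda>\<xi>. G \<zeta> \<xi>) holomorphic_on S"
    and bd: "\<And>\<zeta> \<xi>. \<zeta> \<in> ball 0 R \<Longrightarrow> \<xi> \<in> S \<Longrightarrow> cmod (G \<zeta> \<xi>) \<le> C"
    and S: "open S"
    and p: "p holomorphic_on T" "\<And>s. s \<in> T \<Longrightarrow> p s \<in> ball 0 (R / 2)"
    and q: "q holomorphic_on T" "\<And>s. s \<in> T \<Longrightarrow> q s \<in> S" and T: "open T"
  shows "(\<lambda>s. G (p s) (q s)) holomorphic_on T"
proof (rule holomorphic_on_uniform_limit_open[OF T])
  let ?f = "\<lambda>n s. \<Sum>k<n. taylor_coeff (\<lambda>\<zeta>. G \<zeta> (q s)) k * p s ^ k"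
  have "(\<lambda>s. taylor_coeff (\<lambda>\<zeta>. G \<zeta> (q s)) k) holomorphic_on T" for k
    using holomorphic_on_compose_gen[OF q(1) holomorphic_taylor_coeff[OF R h1 h2 bd S, of k]] q(2)
    by (auto simp: o_def)
  then show "?f n holomorphic_on T" for n
    using p(1) by (intro holomorphic_intros) auto
  have bound: "dist (?f n s) (G (p s) (q s)) \<le> \<bar>C\<bar> * (1/2) ^ n * 2" if s: "s \<in> T" for n s
  proof -
    define r where "r = cmod (p s) / R"
    have ps: "p s \<in> ball 0 R" using p(2)[OF s] R by auto
    have r: "0 \<le> r" "r \<le> 1/2" using p(2)[OF s] R by (auto simp: r_def field_simps)
    have "dist (?f n s) (G (p s) (q s)) = cmod (G (p s) (q s) - ?f n s)"
      by (simp add: dist_norm norm_minus_commute)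
    also have "\<dots> \<le> C * r ^ n / (1 - r)"
      unfolding r_def by (rule taylor_tail_bound) (use R ps q s h1 bd in auto)
    also have "\<dots> \<le> \<bar>C\<bar> * r ^ n / (1 - r)"
      using r by (intro divide_right_mono mult_right_mono) auto
    also have "\<dots> \<le> \<bar>C\<bar> * (1/2) ^ n / (1/2)"
      using r by (intro frac_le mult_left_mono power_mono) auto
    finally show ?thesis by simp
  qed
  show "uniform_limit T ?f (\<lambda>s. G (p s) (q s)) sequentially"
  proof (rule uniform_limitI)
    fix e :: real assume "e > 0"
    have "(\<lambda>n. \<bar>C\<bar> * (1/2) ^ n * 2) \<longlonglongrightarrow> 0"
      by (intro tendsto_eq_intros LIMSEQ_power_zero) auto
    then have "eventually (\<lambda>n. \<bar>C\<bar> * (1/2) ^ n * 2 < e) sequentially"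
      using \<open>e > 0\<close> by (rule order_tendstoD)
    then show "eventually (\<lambda>n. \<forall>s\<in>T. dist (?f n s) (G (p s) (q s)) < e) sequentially"
      by eventually_elim (use bound in \<open>auto intro: le_less_trans\<close>)
  qed
qed

lemma holomorphic_zero_on_reals:
  assumes "g holomorphic_on ball 0 r" "\<And>x::real. \<bar>x\<bar> < r \<Longrightarrow> g (of_real x) = 0" "s \<in> ball 0 r"
  shows "g s = 0"
proof (rule analytic_continuation[of g "ball 0 r" "of_real ` {x. \<bar>x\<bar> < r}" 0])
  have r: "0 < r" using assms(3) by (metis centre_in_ball ball_empty empty_iff not_less)
  show "0 islimpt complex_of_real ` {x. \<bar>x\<bar> < r}"
    unfolding islimpt_approachable
  proof (intro allI impI)
    fix e :: real assume "e > 0"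
    then show "\<exists>x'\<in>complex_of_real ` {x. \<bar>x\<bar> < r}. x' \<noteq> 0 \<and> dist x' 0 < e"
      using r by (intro bexI[of _ "of_real (min e r / 2)"]) (auto simp del: of_real_divide)
  qed
  show "(0::complex) \<in> ball 0 r" using r by simp
qed (use assms in auto)

text \<open>In the coordinates \<open>s = (\<zeta> + \<xi>) / 2\<close>, \<open>t = (\<zeta> - \<xi>) / 2\<i>\<close> the antidiagonal is the set of real
  points.\<close>

lemma antidiagonal_zero:
  assumes R: "0 < R"
    and h1: "\<And>\<xi>. \<xi> \<in> ball 0 R \<Longrightarrow> (\<lambda>\<zeta>. G \<zeta> \<xi>) holomorphic_on ball 0 R"
    and h2: "\<And>\<zeta>. \<zeta> \<in> ball 0 R \<Longrightarrow> (\<lambda>\<xi>. G \<zeta> \<xi>) holomorphic_on ball 0 R"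
    and bd: "\<And>\<zeta> \<xi>. \<zeta> \<in> ball 0 R \<Longrightarrow> \<xi> \<in> ball 0 R \<Longrightarrow> cmod (G \<zeta> \<xi>) \<le> C"
    and e: "0 < e" "e \<le> R" and 0: "\<And>\<zeta>. \<zeta> \<in> ball 0 e \<Longrightarrow> G \<zeta> (cnj \<zeta>) = 0"
    and z: "\<zeta> \<in> ball 0 R" "\<xi> \<in> ball 0 R"
  shows "G \<zeta> \<xi> = 0"
proof -
  \<comment> \<open>For s and t of modulus below d, the arguments of G have modulus below 2d = e /
    2. This is at most R / 2, as the composition lemma requires, and it stays inside the disc on
    which the antidiagonal values are known.\<close>
  define d where "d = e / 4"
  have d: "0 < d" "4 * d \<le> R" using e by (auto simp: d_def)
  define E where "E s t = G (s + \<i> * t) (s - \<i> * t)" for s t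
  have st: "cmod (s + \<i> * t) < 2 * d" "cmod (s - \<i> * t) < 2 * d" if "s \<in> ball 0 d" "t \<in> ball 0 d" for s t
    using that norm_triangle_ineq[of s "\<i> * t"] norm_triangle_ineq4[of s "\<i> * t"]
    by (auto simp: norm_mult)
  have Es: "(\<lambda>s. E s t) holomorphic_on ball 0 d" if "t \<in> ball 0 d" for t
    unfolding E_def
    by (rule holomorphic_compose_separately[OF R h1 h2 bd])
       (use that st d in \<open>fastforce intro!: holomorphic_intros\<close>)+
  have Et: "(\<lambda>t. E s t) holomorphic_on ball 0 d" if "s \<in> ball 0 d" for s
    unfolding E_def
    by (rule holomorphic_compose_separately[OF R h1 h2 bd])
       (use that st d in \<open>fastforce intro!: holomorphic_intros\<close>)+
  have real0: "E (of_real x) (of_real y) = 0" if "\<bar>x\<bar> < d" "\<bar>y\<bar> < d" for x y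
  proof -
    have "cmod (of_real x + \<i> * of_real y) < 2 * d"
      using that by (intro st) auto
    then have "of_real x + \<i> * of_real y \<in> ball 0 e"
      using d by (auto simp: d_def)
    from 0[OF this] show ?thesis by (simp add: E_def)
  qed
  \<comment> \<open>One variable is freed from the real axis at a time, since each application of
    the identity theorem is one-dimensional.\<close>
  have E0: "E s (of_real y) = 0" if "s \<in> ball 0 d" "\<bar>y\<bar> < d" for s y
    using holomorphic_zero_on_reals[OF Es real0 that(1)] that(2) by auto
  have E1: "E s t = 0" if "s \<in> ball 0 d" "t \<in> ball 0 d" for s t
    using holomorphic_zero_on_reals[OF Et[OF that(1)] E0[OF that(1)] that(2)] by auto
  have small: "G \<zeta> \<xi> = 0" if "\<zeta> \<in> ball 0 d" "\<xi> \<in> ball 0 d" for \<zeta> \<xi>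
  proof -
    have "E ((\<zeta> + \<xi>) / 2) ((\<zeta> - \<xi>) / (2 * \<i>)) = 0"
      using that norm_triangle_ineq[of \<zeta> \<xi>] norm_triangle_ineq4[of \<zeta> \<xi>]
      by (intro E1) (auto simp: norm_divide norm_mult)
    moreover have "(\<zeta> + \<xi>) / 2 + \<i> * ((\<zeta> - \<xi>) / (2 * \<i>)) = \<zeta>" "(\<zeta> + \<xi>) / 2 - \<i> * ((\<zeta> - \<xi>) / (2 * \<i>)) = \<xi>"
      by (auto simp: field_simps)
    ultimately show ?thesis by (simp add: E_def)
  qed
  have sub: "ball 0 d \<subseteq> ball (0::complex) R" "ball (0::complex) d \<noteq> {}" using d by auto
  \<comment> \<open>From the bidisc of radius d to the one of radius R by the identity theorem,
    again in one variable after the other.\<close>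
  have mid: "G \<zeta> \<xi> = 0" if "\<zeta> \<in> ball 0 R" "\<xi> \<in> ball 0 d" for \<zeta> \<xi>
    by (rule analytic_continuation_open[of "ball 0 d" "ball 0 R" "\<lambda>\<zeta>. G \<zeta> \<xi>" "\<lambda>_. 0"])
       (use that sub small h1 in auto)
  show ?thesis
    by (rule analytic_continuation_open[of "ball 0 d" "ball 0 R" "\<lambda>\<xi>. G \<zeta> \<xi>" "\<lambda>_. 0"])
       (use z sub mid h2 in auto)
qed

section \<open>Square-summable families of holomorphic functions\<close>

lemma taylor_coeff_eqI:
  assumes R: "0 < R" and g: "g holomorphic_on ball 0 R"
    and s: "\<And>\<zeta>. \<zeta> \<in> ball 0 R \<Longrightarrow> (\<lambda>k. a k * \<zeta> ^ k) sums g \<zeta>"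
  shows "taylor_coeff g k = a k"
proof (rule ccontr)
  define d where "d k = taylor_coeff g k - a k" for k
  assume "taylor_coeff g k \<noteq> a k"
  then have dk: "d k \<noteq> 0" by (simp add: d_def)
  have sm: "(\<lambda>n. d n * (x - 0) ^ n) sums 0" if "cmod (x - 0) < R" for x
    using sums_diff[OF taylor_coeff_sums[OF g, of x] s[of x]] that
    by (simp add: d_def algebra_simps)
  \<comment> \<open>Isolation of zeros is used below for a nonzero coefficient of positive index, so
    the constant coefficient is settled separately.\<close>
  have "(\<lambda>n. d n * 0 ^ n) sums 0" using sm[of 0] R by simp
  then have "d 0 = 0" using powser_sums_zero[of d] sums_unique2 by blast
  with dk have "k > 0" by (cases k) auto
  show False
  proof (rule powser_0_nonzero[where f = "\<lambda>_. 0" and \<xi> = 0 and a = d and m = k, OF R sm refl dk \<open>k > 0\<close>])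
    fix r :: real
    assume "0 < r" and r: "\<And>z::complex. z \<in> cball 0 r - {0} \<Longrightarrow> (0::complex) \<noteq> 0"
    have "complex_of_real r \<in> cball 0 r - {0}" using \<open>0 < r\<close> by auto
    from r[OF this] show False by simp
  qed
qed

lemma taylor_coeff_cong:
  assumes "0 < R" "f holomorphic_on ball 0 R" "\<And>\<zeta>. \<zeta> \<in> ball 0 R \<Longrightarrow> f \<zeta> = g \<zeta>"
  shows "taylor_coeff f k = taylor_coeff g k"
proof -
  have "g holomorphic_on ball 0 R"
    using assms by (metis holomorphic_transform)
  then show ?thesis
    using assms taylor_coeff_sums[of g R] by (intro taylor_coeff_eqI) auto
qed

lemma taylor_coeff_cnj:
  assumes R: "0 < R" and g: "g holomorphic_on ball 0 R"
  shows "(\<lambda>\<zeta>. cnj (g (cnj \<zeta>))) holomorphic_on ball 0 R"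
    and "taylor_coeff (\<lambda>\<zeta>. cnj (g (cnj \<zeta>))) k = cnj (taylor_coeff g k)"
proof -
  have "cnj ` ball 0 R = ball 0 R"
    by (auto simp: image_iff) (metis complex_cnj_cnj complex_mod_cnj dist_0_norm mem_ball)
  then show h: "(\<lambda>\<zeta>. cnj (g (cnj \<zeta>))) holomorphic_on ball 0 R"
    using holomorphic_on_compose_cnj_cnj[of g "ball 0 R"] g by (simp add: o_def)
  show "taylor_coeff (\<lambda>\<zeta>. cnj (g (cnj \<zeta>))) k = cnj (taylor_coeff g k)"
  proof (rule taylor_coeff_eqI[OF R h])
    fix \<zeta> :: complex assume "\<zeta> \<in> ball 0 R"
    then have "(\<lambda>k. cnj (taylor_coeff g k * cnj \<zeta> ^ k)) sums cnj (g (cnj \<zeta>))"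
      by (intro sums_cnj[THEN iffD2] taylor_coeff_sums[OF g]) auto
    then show "(\<lambda>k. cnj (taylor_coeff g k) * \<zeta> ^ k) sums cnj (g (cnj \<zeta>))" by simp
  qed
qed

lemma taylor_coeff_scaled_sum:
  assumes "0 < R" "\<And>j. j < n \<Longrightarrow> g j holomorphic_on ball 0 R"
  shows "taylor_coeff (\<lambda>\<zeta>. \<Sum>j<n. g j \<zeta> * c j) k = (\<Sum>j<n. taylor_coeff (g j) k * c j)"
proof (rule taylor_coeff_eqI[OF assms(1)])
  fix \<zeta> :: complex assume "\<zeta> \<in> ball 0 R"
  then have "(\<lambda>k. \<Sum>j<n. (taylor_coeff (g j) k * \<zeta> ^ k) * c j) sums (\<Sum>j<n. g j \<zeta> * c j)"
    using assms by (intro sums_sum sums_mult2 taylor_coeff_sums) auto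
  then show "(\<lambda>k. (\<Sum>j<n. taylor_coeff (g j) k * c j) * \<zeta> ^ k) sums (\<Sum>j<n. g j \<zeta> * c j)"
    by (simp add: sum_distrib_left sum_distrib_right mult_ac)
qed (use assms in \<open>auto intro!: holomorphic_intros\<close>)

lemma taylor_coeff_uniform_limit:
  assumes "0 < R" "uniform_limit (ball 0 R) f g sequentially" "\<And>n. f n holomorphic_on ball 0 R"
  shows "(\<lambda>n. taylor_coeff (f n) k) \<longlonglongrightarrow> taylor_coeff g k"
  unfolding taylor_coeff_def
  using assms by (intro tendsto_divide tendsto_const higher_deriv_complex_uniform_limit[where A = "ball 0 R"]) auto

section \<open>Square-summable sequences and their inner product\<close>

definition l2 :: "(nat \<Rightarrow> complex) \<Rightarrow> bool" where
  "l2 a \<longleftrightarrow> summable (\<lambda>j. (cmod (a j))\<^sup>2)"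

definition l2sq :: "(nat \<Rightarrow> complex) \<Rightarrow> real" where
  "l2sq a = (\<Sum>j. (cmod (a j))\<^sup>2)"

text \<open>The inner product of the sequence space, linear in the first and conjugate-linear in the
  second argument. The infinite sum is meaningful once both arguments satisfy
  \<open>l2\<close>.\<close>

definition pairing :: "(nat \<Rightarrow> complex) \<Rightarrow> (nat \<Rightarrow> complex) \<Rightarrow> complex" where
  "pairing a b = (\<Sum>j. a j * cnj (b j))"

lemma l2_iff_sums: "l2 a \<and> l2sq a = c \<longleftrightarrow> (\<lambda>j. (cmod (a j))\<^sup>2) sums c"
  by (auto simp: l2_def l2sq_def sums_iff)

lemma partial_l2sq_le: "l2 a \<Longrightarrow> (\<Sum>j<n. (cmod (a j))\<^sup>2) \<le> l2sq a"
  unfolding l2_def l2sq_def by (intro sum_le_suminf) auto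

lemma l2sq_nonneg: "l2 a \<Longrightarrow> 0 \<le> l2sq a"
  unfolding l2_def l2sq_def by (intro suminf_nonneg) auto

lemma l2I:
  assumes "\<And>n. (\<Sum>j<n. (cmod (a j))\<^sup>2) \<le> C"
  shows "l2 a" and "l2sq a \<le> C"
proof -
  show "l2 a"
    unfolding l2_def using assms by (intro summableI_nonneg_bounded) auto
  then show "l2sq a \<le> C"
    unfolding l2_def l2sq_def using assms by (intro suminf_le_const) auto
qed

lemma finite_Cauchy_Schwarz:
  "(cmod (\<Sum>j<n. a j * cnj (b j)))\<^sup>2 \<le> (\<Sum>j<n. (cmod (a j))\<^sup>2) * (\<Sum>j<n. (cmod (b j))\<^sup>2)"
proof -
  have "cmod (\<Sum>j<n. a j * cnj (b j)) \<le> (\<Sum>j<n. cmod (a j) * cmod (b j))"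
    by (rule sum_norm_le) (simp add: norm_mult)
  then have "(cmod (\<Sum>j<n. a j * cnj (b j)))\<^sup>2 \<le> (\<Sum>j<n. cmod (a j) * cmod (b j))\<^sup>2"
    by (intro power_mono) auto
  also have "\<dots> \<le> (\<Sum>j<n. (cmod (a j))\<^sup>2) * (\<Sum>j<n. (cmod (b j))\<^sup>2)"
    by (rule Cauchy_Schwarz_ineq_sum)
  finally show ?thesis .
qed

lemma summable_pairing:
  assumes "l2 a" "l2 b"
  shows "summable (\<lambda>j. a j * cnj (b j))"
proof (rule summable_comparison_test')
  show "summable (\<lambda>j. (cmod (a j))\<^sup>2 + (cmod (b j))\<^sup>2)"
    using assms by (simp add: l2_def summable_add)
  fix j :: nat
  have "cmod (a j) * cmod (b j) \<le> 2 * (cmod (a j) * cmod (b j))" by simp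
  also have "\<dots> \<le> (cmod (a j))\<^sup>2 + (cmod (b j))\<^sup>2"
    using sum_squares_bound[of "cmod (a j)" "cmod (b j)"] by (simp add: mult.assoc)
  finally have "cmod (a j) * cmod (b j) \<le> (cmod (a j))\<^sup>2 + (cmod (b j))\<^sup>2" .
  then show "norm (a j * cnj (b j)) \<le> (cmod (a j))\<^sup>2 + (cmod (b j))\<^sup>2"
    by (simp add: norm_mult)
qed

lemma Cauchy_Schwarz_pairing:
  assumes "l2 a" "l2 b"
  shows "(cmod (pairing a b))\<^sup>2 \<le> l2sq a * l2sq b"
proof (rule LIMSEQ_le)
  show "(\<lambda>n. (cmod (\<Sum>j<n. a j * cnj (b j)))\<^sup>2) \<longlonglongrightarrow> (cmod (pairing a b))\<^sup>2"
    unfolding pairing_def using summable_pairing[OF assms]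
    by (intro tendsto_power tendsto_norm summable_LIMSEQ)
  show "(\<lambda>n. (\<Sum>j<n. (cmod (a j))\<^sup>2) * (\<Sum>j<n. (cmod (b j))\<^sup>2)) \<longlonglongrightarrow> l2sq a * l2sq b"
    unfolding l2sq_def using assms by (intro tendsto_mult summable_LIMSEQ) (auto simp: l2_def)
qed (use finite_Cauchy_Schwarz in blast)

text \<open>Cauchy-Schwarz for the shifted sequences. On the right only the tail of b appears, while
  a enters through its full norm; this is what makes the convergence uniform when a varies in a
  bounded set.\<close>

lemma pairing_tail_bound:
  assumes "l2 a" "l2 b"
  shows "(cmod (pairing a b - (\<Sum>j<n. a j * cnj (b j))))\<^sup>2 \<le> l2sq a * (l2sq b - (\<Sum>j<n. (cmod (b j))\<^sup>2))"
proof -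
  have l: "l2 (\<lambda>j. a (j + n))" "l2 (\<lambda>j. b (j + n))"
    using assms by (auto simp: l2_def summable_iff_shift[of "\<lambda>j. (cmod (_ j))\<^sup>2"])
  have sa: "l2sq (\<lambda>j. a (j + n)) = l2sq a - (\<Sum>j<n. (cmod (a j))\<^sup>2)"
    and sb: "l2sq (\<lambda>j. b (j + n)) = l2sq b - (\<Sum>j<n. (cmod (b j))\<^sup>2)"
    using assms suminf_minus_initial_segment[of "\<lambda>j. (cmod (a j))\<^sup>2" n]
      suminf_minus_initial_segment[of "\<lambda>j. (cmod (b j))\<^sup>2" n]
    by (auto simp: l2_def l2sq_def)
  have "pairing a b - (\<Sum>j<n. a j * cnj (b j)) = pairing (\<lambda>j. a (j + n)) (\<lambda>j. b (j + n))"
    using suminf_minus_initial_segment[OF summable_pairing[OF assms], of n] by (simp add: pairing_def)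
  then have "(cmod (pairing a b - (\<Sum>j<n. a j * cnj (b j))))\<^sup>2 \<le> l2sq (\<lambda>j. a (j + n)) * l2sq (\<lambda>j. b (j + n))"
    using Cauchy_Schwarz_pairing[OF l] by simp
  also have "\<dots> \<le> l2sq a * l2sq (\<lambda>j. b (j + n))"
    using l2sq_nonneg[OF l(2)] by (intro mult_right_mono) (auto simp: sa sum_nonneg)
  finally show ?thesis by (simp add: sb)
qed

text \<open>The error is at most C times the tail of the fixed vector d, hence independent of x; no
  uniformity of the convergence of the squares of \<open>g j\<close> enters.\<close>

lemma uniform_limit_pairing:
  assumes g: "\<And>x. x \<in> S \<Longrightarrow> l2 (\<lambda>j. g j x) \<and> l2sq (\<lambda>j. g j x) \<le> C" and d: "l2 d"
  shows "uniform_limit S (\<lambda>n x. \<Sum>j<n. g j x * cnj (d j)) (\<lambda>x. pairing (\<lambda>j. g j x) d) sequentially"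
proof (rule uniform_limitI)
  fix e :: real assume "e > 0"
  have "(\<lambda>n. \<bar>C\<bar> * (l2sq d - (\<Sum>j<n. (cmod (d j))\<^sup>2))) \<longlonglongrightarrow> \<bar>C\<bar> * (l2sq d - l2sq d)"
    unfolding l2sq_def using d by (intro tendsto_intros summable_LIMSEQ) (auto simp: l2_def)
  then have "eventually (\<lambda>n. \<bar>C\<bar> * (l2sq d - (\<Sum>j<n. (cmod (d j))\<^sup>2)) < e\<^sup>2) sequentially"
    using \<open>e > 0\<close> by (intro order_tendstoD) auto
  then show "eventually (\<lambda>n. \<forall>x\<in>S. dist (\<Sum>j<n. g j x * cnj (d j)) (pairing (\<lambda>j. g j x) d) < e) sequentially"
  proof (eventually_elim, intro ballI)
    fix n x
    assume n: "\<bar>C\<bar> * (l2sq d - (\<Sum>j<n. (cmod (d j))\<^sup>2)) < e\<^sup>2" and x: "x \<in> S"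
    have "(dist (\<Sum>j<n. g j x * cnj (d j)) (pairing (\<lambda>j. g j x) d))\<^sup>2
        \<le> l2sq (\<lambda>j. g j x) * (l2sq d - (\<Sum>j<n. (cmod (d j))\<^sup>2))"
      using pairing_tail_bound[of "\<lambda>j. g j x" d n] g[OF x] d
      by (simp add: dist_norm norm_minus_commute)
    also have "\<dots> \<le> \<bar>C\<bar> * (l2sq d - (\<Sum>j<n. (cmod (d j))\<^sup>2))"
      using g[OF x] partial_l2sq_le[OF d] by (intro mult_right_mono) auto
    also note n
    finally show "dist (\<Sum>j<n. g j x * cnj (d j)) (pairing (\<lambda>j. g j x) d) < e"
      using \<open>e > 0\<close> by (metis less_eq_real_def power2_less_imp_less)
  qed
qed

lemma pairing_cnj: "l2 a \<Longrightarrow> l2 b \<Longrightarrow> cnj (pairing a b) = pairing b a"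
  using sums_cnj[THEN iffD2, OF summable_sums[OF summable_pairing[of a b]]]
  by (simp add: pairing_def sums_iff mult.commute)

lemma pairing_diff_scale_left:
  assumes "l2 a" "l2 b" "l2 d"
  shows "pairing (\<lambda>j. a j - c * b j) d = pairing a d - c * pairing b d"
proof -
  have "(\<lambda>j. a j * cnj (d j) - c * (b j * cnj (d j))) sums (pairing a d - c * pairing b d)"
    unfolding pairing_def using assms
    by (intro sums_diff sums_mult summable_sums summable_pairing)
  then show ?thesis
    by (simp add: pairing_def sums_iff algebra_simps)
qed

lemma pairing_self: "l2 a \<Longrightarrow> pairing a a = of_real (l2sq a)"
  unfolding pairing_def l2sq_def l2_def complex_norm_square[symmetric]
  by (rule suminf_of_real[symmetric])

lemma l2_diff_scale:
  assumes "l2 a" "l2 b"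
  shows "l2 (\<lambda>j. a j - c * b j)"
  unfolding l2_def
proof (rule summable_comparison_test')
  show "summable (\<lambda>j. 2 * ((cmod (a j))\<^sup>2 + (cmod c)\<^sup>2 * (cmod (b j))\<^sup>2))"
    using assms unfolding l2_def by (intro summable_mult summable_add)
  fix j :: nat
  have "(cmod (a j - c * b j))\<^sup>2 \<le> (cmod (a j) + cmod (c * b j))\<^sup>2"
    by (intro power_mono norm_triangle_ineq4) auto
  also have "\<dots> \<le> 2 * ((cmod (a j))\<^sup>2 + (cmod (c * b j))\<^sup>2)"
    using sum_squares_bound[of "cmod (a j)" "cmod (c * b j)"] by (simp add: power2_sum)
  finally show "norm ((cmod (a j - c * b j))\<^sup>2) \<le> 2 * ((cmod (a j))\<^sup>2 + (cmod c)\<^sup>2 * (cmod (b j))\<^sup>2)"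
    by (simp add: norm_mult power_mult_distrib)
qed

lemma l2_eq_0:
  assumes "l2 a" "l2sq a = 0"
  shows "a j = 0"
proof -
  have "(cmod (a j))\<^sup>2 \<le> (\<Sum>i<Suc j. (cmod (a i))\<^sup>2)"
    by (rule member_le_sum) auto
  also have "\<dots> \<le> 0" using partial_l2sq_le[OF assms(1), of "Suc j"] assms(2) by simp
  finally show ?thesis by simp
qed

lemma holomorphic_pairing:
  assumes "open S" "\<And>j. g j holomorphic_on S"
    and "\<And>x. x \<in> S \<Longrightarrow> l2 (\<lambda>j. g j x) \<and> l2sq (\<lambda>j. g j x) \<le> C" and "l2 d"
  shows "(\<lambda>x. pairing (\<lambda>j. g j x) d) holomorphic_on S"
  by (rule holomorphic_on_uniform_limit_open[OF assms(1) _ uniform_limit_pairing[OF assms(3,4)]])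
     (auto intro!: holomorphic_intros assms)

text \<open>A duality argument: pair the first n functions with the vector of their own k-th
  coefficients. The k-th coefficient of the resulting function is the partial sum S of squares,
  while its modulus is at most sqrt (C S) by Cauchy-Schwarz. Cauchy's estimate and cancellation of S
  bound S by a constant that does not depend on n.\<close>

lemma taylor_coeff_l2:
  assumes R: "0 < R" and hol: "\<And>j. g j holomorphic_on ball 0 R"
    and bd: "\<And>x. x \<in> ball 0 R \<Longrightarrow> l2 (\<lambda>j. g j x) \<and> l2sq (\<lambda>j. g j x) \<le> C"
  shows "l2 (\<lambda>j. taylor_coeff (g j) k)"
proof (rule l2I)
  fix n
  define S where "S = (\<Sum>j<n. (cmod (taylor_coeff (g j) k))\<^sup>2)"
  define \<phi> where "\<phi> \<zeta> = (\<Sum>j<n. g j \<zeta> * cnj (taylor_coeff (g j) k))" for \<zeta>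
  have S: "S \<ge> 0" by (simp add: S_def sum_nonneg)
  have C: "C \<ge> 0" using bd[of 0] R l2sq_nonneg[of "\<lambda>j. g j 0"] by force
  have "taylor_coeff \<phi> k = (\<Sum>j<n. taylor_coeff (g j) k * cnj (taylor_coeff (g j) k))"
    unfolding \<phi>_def by (rule taylor_coeff_scaled_sum[OF R hol])
  also have "\<dots> = of_real S"
    by (simp add: S_def complex_norm_square[symmetric])
  finally have tS: "taylor_coeff \<phi> k = of_real S" .
  have "cmod (taylor_coeff \<phi> k) \<le> sqrt (C * S) / R ^ k"
  proof (rule taylor_coeff_bound[OF _ R])
    show "\<phi> holomorphic_on ball 0 R"
      unfolding \<phi>_def by (intro holomorphic_intros hol)
    fix \<zeta> assume z: "\<zeta> \<in> ball (0::complex) R"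
    have "(cmod (\<phi> \<zeta>))\<^sup>2 \<le> (\<Sum>j<n. (cmod (g j \<zeta>))\<^sup>2) * S"
      unfolding \<phi>_def S_def by (rule finite_Cauchy_Schwarz)
    also have "\<dots> \<le> C * S"
      using bd[OF z] partial_l2sq_le[of "\<lambda>j. g j \<zeta>" n] S by (intro mult_right_mono) auto
    finally show "cmod (\<phi> \<zeta>) \<le> sqrt (C * S)"
      by (rule real_le_rsqrt)
  qed
  then have "S \<le> sqrt (C * S) / R ^ k"
    using S by (simp add: tS)
  then have "S\<^sup>2 \<le> (sqrt (C * S) / R ^ k)\<^sup>2"
    using S by (intro power_mono) auto
  also have "\<dots> = C / (R ^ k)\<^sup>2 * S"
    using S C by (simp add: power_divide)
  finally have "S * S \<le> C / (R ^ k)\<^sup>2 * S"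
    by (simp add: power2_eq_square)
  then show "(\<Sum>j<n. (cmod (taylor_coeff (g j) k))\<^sup>2) \<le> C / (R ^ k)\<^sup>2"
    unfolding S_def[symmetric] using S C
    by (cases "S = 0") (auto dest: mult_right_le_imp_le simp del: times_divide_eq_left)
qed

text \<open>The pairing is a uniform limit of finite combinations, and Taylor coefficients are
  continuous under uniform limits.\<close>

lemma taylor_coeff_pairing:
  assumes R: "0 < R" and hol: "\<And>j. g j holomorphic_on ball 0 R"
    and bd: "\<And>x. x \<in> ball 0 R \<Longrightarrow> l2 (\<lambda>j. g j x) \<and> l2sq (\<lambda>j. g j x) \<le> C" and d: "l2 d"
  shows "taylor_coeff (\<lambda>x. pairing (\<lambda>j. g j x) d) k = pairing (\<lambda>j. taylor_coeff (g j) k) d"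
proof -
  have "(\<lambda>n. taylor_coeff (\<lambda>x. \<Sum>j<n. g j x * cnj (d j)) k) \<longlonglongrightarrow> taylor_coeff (\<lambda>x. pairing (\<lambda>j. g j x) d) k"
    by (rule taylor_coeff_uniform_limit[OF R uniform_limit_pairing[OF bd d]])
       (auto intro!: holomorphic_intros hol)
  moreover have "(\<lambda>n. taylor_coeff (\<lambda>x. \<Sum>j<n. g j x * cnj (d j)) k) \<longlonglongrightarrow> pairing (\<lambda>j. taylor_coeff (g j) k) d"
    unfolding taylor_coeff_scaled_sum[OF R hol] pairing_def
    by (intro summable_LIMSEQ summable_pairing taylor_coeff_l2[OF R hol bd] d)
  ultimately show ?thesis
    by (rule LIMSEQ_unique)
qed

text \<open>A sesqui-holomorphic kernel is written as \<open>F \<zeta> \<xi>\<close> with \<open>\<xi>\<close> in place of the conjugate of the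
  second variable, so that the diagonal is \<open>\<xi> = cnj \<zeta>\<close>.\<close>

lemma kernel_eq_pairing:
  assumes R: "0 < R"
    and h1: "\<And>\<xi>. \<xi> \<in> ball 0 R \<Longrightarrow> (\<lambda>\<zeta>. F \<zeta> \<xi>) holomorphic_on ball 0 R"
    and h2: "\<And>\<zeta>. \<zeta> \<in> ball 0 R \<Longrightarrow> (\<lambda>\<xi>. F \<zeta> \<xi>) holomorphic_on ball 0 R"
    and bd: "\<And>\<zeta> \<xi>. \<zeta> \<in> ball 0 R \<Longrightarrow> \<xi> \<in> ball 0 R \<Longrightarrow> cmod (F \<zeta> \<xi>) \<le> C"
    and g: "\<And>j. g j holomorphic_on ball 0 R"
    and gb: "\<And>\<zeta>. \<zeta> \<in> ball 0 R \<Longrightarrow> l2 (\<lambda>j. g j \<zeta>) \<and> l2sq (\<lambda>j. g j \<zeta>) \<le> B"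
    and e: "0 < e" "e \<le> R"
    and eq: "\<And>\<zeta>. \<zeta> \<in> ball 0 e \<Longrightarrow> F \<zeta> (cnj \<zeta>) = of_real (l2sq (\<lambda>j. g j \<zeta>))"
    and z: "\<zeta> \<in> ball 0 R" "\<xi> \<in> ball 0 R"
  shows "F \<zeta> \<xi> = pairing (\<lambda>j. g j \<zeta>) (\<lambda>j. g j (cnj \<xi>))"
proof -
  define D where "D \<zeta> \<xi> = F \<zeta> \<xi> - pairing (\<lambda>j. g j \<zeta>) (\<lambda>j. g j (cnj \<xi>))" for \<zeta> \<xi>
  have B: "0 \<le> B" using gb[of 0] R l2sq_nonneg[of "\<lambda>j. g j 0"] by force
  have Db: "cmod (D \<zeta> \<xi>) \<le> C + B" if z: "\<zeta> \<in> ball 0 R" "\<xi> \<in> ball 0 R" for \<zeta> \<xi>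
  proof -
    have z': "cnj \<xi> \<in> ball 0 R" using z by simp
    have "(cmod (pairing (\<lambda>j. g j \<zeta>) (\<lambda>j. g j (cnj \<xi>))))\<^sup>2
        \<le> l2sq (\<lambda>j. g j \<zeta>) * l2sq (\<lambda>j. g j (cnj \<xi>))"
      using gb z z' by (intro Cauchy_Schwarz_pairing) auto
    also have "\<dots> \<le> B * B"
      using gb z z' B l2sq_nonneg by (intro mult_mono) auto
    finally have "cmod (pairing (\<lambda>j. g j \<zeta>) (\<lambda>j. g j (cnj \<xi>))) \<le> B"
      using B by (simp add: power2_eq_square[symmetric] power2_le_iff_abs_le)
    moreover have "cmod (F \<zeta> \<xi>) \<le> C" using bd z by auto
    ultimately show ?thesis
      unfolding D_def by (meson add_mono norm_triangle_ineq4 order_trans)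
  qed
  have "D \<zeta> \<xi> = 0"
  proof (rule antidiagonal_zero[OF R _ _ Db e _ z])
    fix \<xi> :: complex assume z: "\<xi> \<in> ball 0 R"
    then show "(\<lambda>\<zeta>. D \<zeta> \<xi>) holomorphic_on ball 0 R"
      unfolding D_def using gb
      by (intro holomorphic_on_diff h1 holomorphic_pairing[where C = B] g) auto
  next
    fix \<zeta> :: complex assume z: "\<zeta> \<in> ball 0 R"
    \<comment> \<open>The pairing is unchanged when its arguments are swapped and conjugated. This
      moves the dependence on \<xi> into the linear slot and turns it into a holomorphic
      one.\<close>
    have "(\<lambda>\<xi>. pairing (\<lambda>j. cnj (g j (cnj \<xi>))) (\<lambda>j. cnj (g j \<zeta>))) holomorphic_on ball 0 R"
      using gb z by (intro holomorphic_pairing[where C = B] taylor_coeff_cnj(1) g R)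
        (auto simp: l2_def l2sq_def)
    moreover have "pairing (\<lambda>j. cnj (g j (cnj \<xi>))) (\<lambda>j. cnj (g j \<zeta>)) = pairing (\<lambda>j. g j \<zeta>) (\<lambda>j. g j (cnj \<xi>))" for \<xi>
      by (simp add: pairing_def mult.commute)
    ultimately show "(\<lambda>\<xi>. D \<zeta> \<xi>) holomorphic_on ball 0 R"
      unfolding D_def using z by (intro holomorphic_on_diff h2) auto
  next
    fix \<zeta> :: complex assume z: "\<zeta> \<in> ball 0 e"
    then show "D \<zeta> (cnj \<zeta>) = 0"
      using eq[OF z] gb[of \<zeta>] e by (simp add: D_def pairing_self)
  qed
  then show ?thesis by (simp add: D_def)
qed

text \<open>Calabi's estimate: the \<open>k\<close>-th Taylor coefficients of the components are controlled by the
  \<open>(k, k)\<close>-th coefficient of the kernel, whose size is dictated by the domain of the kernel and not by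
  that of the components.\<close>

lemma l2_taylor_coeff_bound:
  assumes R: "0 < R"
    and h1: "\<And>\<xi>. \<xi> \<in> ball 0 R \<Longrightarrow> (\<lambda>\<zeta>. F \<zeta> \<xi>) holomorphic_on ball 0 R"
    and h2: "\<And>\<zeta>. \<zeta> \<in> ball 0 R \<Longrightarrow> (\<lambda>\<xi>. F \<zeta> \<xi>) holomorphic_on ball 0 R"
    and bd: "\<And>\<zeta> \<xi>. \<zeta> \<in> ball 0 R \<Longrightarrow> \<xi> \<in> ball 0 R \<Longrightarrow> cmod (F \<zeta> \<xi>) \<le> C"
    and e: "0 < e" "e \<le> R"
    and g: "\<And>j. g j holomorphic_on ball 0 e"
    and gl: "\<And>\<zeta>. \<zeta> \<in> ball 0 e \<Longrightarrow> l2 (\<lambda>j. g j \<zeta>)"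
    and eq: "\<And>\<zeta>. \<zeta> \<in> ball 0 e \<Longrightarrow> F \<zeta> (cnj \<zeta>) = of_real (l2sq (\<lambda>j. g j \<zeta>))"
  shows "l2 (\<lambda>j. taylor_coeff (g j) k)" and "l2sq (\<lambda>j. taylor_coeff (g j) k) \<le> C / R ^ k / R ^ k"
proof -
  have sub: "ball 0 e \<subseteq> ball (0::complex) R" using e by auto
  have gb: "l2 (\<lambda>j. g j \<zeta>) \<and> l2sq (\<lambda>j. g j \<zeta>) \<le> C" if "\<zeta> \<in> ball 0 e" for \<zeta>
  proof -
    have "cmod (F \<zeta> (cnj \<zeta>)) \<le> C" using that e by (intro bd) auto
    then show ?thesis using eq[OF that] gl[OF that] by simp
  qed
  define P where "P j = taylor_coeff (g j) k" for j
  show l: "l2 (\<lambda>j. taylor_coeff (g j) k)"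
    by (rule taylor_coeff_l2[OF e(1) g gb])
  then have lP: "l2 (\<lambda>j. cnj (P j))" by (simp add: l2_def P_def)
  \<comment> \<open>The (k, k)-th coefficient is extracted one variable at a time. Cauchy's estimate
    is applied on the disc of radius R, where the kernel lives, and costs one factor
    \<open>R ^ k\<close> each time; the identification with the pairing uses only the disc of radius
    e.\<close>
  define f where "f \<xi> = taylor_coeff (\<lambda>\<zeta>. F \<zeta> \<xi>) k" for \<xi>
  have f: "f holomorphic_on ball 0 R"
    unfolding f_def by (rule holomorphic_taylor_coeff[OF R h1 h2 bd]) auto
  have fb: "cmod (f \<xi>) \<le> C / R ^ k" if "\<xi> \<in> ball 0 R" for \<xi>
    unfolding f_def using that by (intro taylor_coeff_bound h1 R bd)
  have fe: "f \<xi> = pairing (\<lambda>j. cnj (g j (cnj \<xi>))) (\<lambda>j. cnj (P j))" if x: "\<xi> \<in> ball 0 e" for \<xi>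
  proof -
    have "f \<xi> = taylor_coeff (\<lambda>\<zeta>. pairing (\<lambda>j. g j \<zeta>) (\<lambda>j. g j (cnj \<xi>))) k"
      unfolding f_def
    proof (rule taylor_coeff_cong[OF e(1)])
      show "(\<lambda>\<zeta>. F \<zeta> \<xi>) holomorphic_on ball 0 e"
        using h1 x sub by (meson holomorphic_on_subset subsetD)
      fix \<zeta> :: complex assume z: "\<zeta> \<in> ball 0 e"
      show "F \<zeta> \<xi> = pairing (\<lambda>j. g j \<zeta>) (\<lambda>j. g j (cnj \<xi>))"
      proof (rule kernel_eq_pairing[where R = e and e = e and F = F and C = C and B = C])
        show "(\<lambda>\<zeta>. F \<zeta> \<xi>) holomorphic_on ball 0 e" if "\<xi> \<in> ball 0 e" for \<xi>
          using h1 that sub by (meson holomorphic_on_subset subsetD)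
        show "F \<zeta> holomorphic_on ball 0 e" if "\<zeta> \<in> ball 0 e" for \<zeta>
          using h2 that sub by (meson holomorphic_on_subset subsetD)
        show "cmod (F \<zeta> \<xi>) \<le> C" if "\<zeta> \<in> ball 0 e" "\<xi> \<in> ball 0 e" for \<zeta> \<xi>
          using bd that e by auto
      qed (use e g gb eq z x in auto)
    qed
    also have "\<dots> = pairing P (\<lambda>j. g j (cnj \<xi>))"
      unfolding P_def using x gb by (intro taylor_coeff_pairing[OF e(1) g gb]) auto
    also have "\<dots> = pairing (\<lambda>j. cnj (g j (cnj \<xi>))) (\<lambda>j. cnj (P j))"
      by (simp add: pairing_def mult.commute)
    finally show ?thesis .
  qed
  have "taylor_coeff f k = taylor_coeff (\<lambda>\<xi>. pairing (\<lambda>j. cnj (g j (cnj \<xi>))) (\<lambda>j. cnj (P j))) k"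
    using f sub by (intro taylor_coeff_cong[OF e(1)] fe) (auto elim: holomorphic_on_subset)
  also have "\<dots> = pairing (\<lambda>j. taylor_coeff (\<lambda>\<xi>. cnj (g j (cnj \<xi>))) k) (\<lambda>j. cnj (P j))"
    using gb lP
    by (intro taylor_coeff_pairing[OF e(1) taylor_coeff_cnj(1)[OF e(1) g], where C = C])
       (auto simp: l2_def l2sq_def)
  also have "\<dots> = of_real (l2sq (\<lambda>j. cnj (P j)))"
    unfolding taylor_coeff_cnj(2)[OF e(1) g] P_def[symmetric] by (rule pairing_self[OF lP])
  finally have "taylor_coeff f k = of_real (l2sq P)" by (simp add: l2sq_def)
  moreover have "cmod (taylor_coeff f k) \<le> C / R ^ k / R ^ k"
    by (rule taylor_coeff_bound[OF f R fb])
  ultimately show "l2sq (\<lambda>j. taylor_coeff (g j) k) \<le> C / R ^ k / R ^ k"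
    by (simp add: P_def[abs_def])
qed

section \<open>Square summability beyond the initial disc\<close>

lemma L2_set_sum_le: "L2_set (\<lambda>j. cmod (\<Sum>k<(m::nat). f k j)) A \<le> (\<Sum>k<m. L2_set (\<lambda>j. cmod (f k j)) A)"
proof (induction m)
  case (Suc m)
  have "L2_set (\<lambda>j. cmod (\<Sum>k<Suc m. f k j)) A \<le> L2_set (\<lambda>j. cmod (\<Sum>k<m. f k j) + cmod (f m j)) A"
    by (intro L2_set_mono) (auto simp: norm_triangle_ineq)
  also have "\<dots> \<le> L2_set (\<lambda>j. cmod (\<Sum>k<m. f k j)) A + L2_set (\<lambda>j. cmod (f m j)) A"
    by (rule L2_set_triangle_ineq)
  finally show ?case using Suc by simp
qed (simp add: L2_set_def)

lemma L2_set_power2: "(L2_set f A)\<^sup>2 = (\<Sum>j\<in>A. (f j)\<^sup>2)"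
  by (simp add: L2_set_def sum_nonneg)

text \<open>Each \<open>g j\<close> is holomorphic on the large disc, but the sum of squares is
  known to converge only on the small one. Minkowski's inequality applied to the Taylor series and
  Calabi's bounds limits the norm by a geometric series on every disc of radius r < R. With this
  bound the kernel can be identified with the pairing there.\<close>

lemma kernel_eq_l2sq_of_extension:
  assumes R: "0 < R"
    and h1: "\<And>\<xi>. \<xi> \<in> ball 0 R \<Longrightarrow> (\<lambda>\<zeta>. F \<zeta> \<xi>) holomorphic_on ball 0 R"
    and h2: "\<And>\<zeta>. \<zeta> \<in> ball 0 R \<Longrightarrow> (\<lambda>\<xi>. F \<zeta> \<xi>) holomorphic_on ball 0 R"
    and bd: "\<And>\<zeta> \<xi>. \<zeta> \<in> ball 0 R \<Longrightarrow> \<xi> \<in> ball 0 R \<Longrightarrow> cmod (F \<zeta> \<xi>) \<le> C"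
    and e: "0 < e" "e \<le> R"
    and g: "\<And>j. g j holomorphic_on ball 0 R"
    and gl: "\<And>\<zeta>. \<zeta> \<in> ball 0 e \<Longrightarrow> l2 (\<lambda>j. g j \<zeta>)"
    and eq: "\<And>\<zeta>. \<zeta> \<in> ball 0 e \<Longrightarrow> F \<zeta> (cnj \<zeta>) = of_real (l2sq (\<lambda>j. g j \<zeta>))"
    and z: "\<zeta> \<in> ball 0 R"
  shows "l2 (\<lambda>j. g j \<zeta>)" and "F \<zeta> (cnj \<zeta>) = of_real (l2sq (\<lambda>j. g j \<zeta>))"
proof -
  have sub: "ball 0 e \<subseteq> ball (0::complex) R" using e by auto
  have ge: "g j holomorphic_on ball 0 e" for j
    using g sub by (rule holomorphic_on_subset)
  have C: "0 \<le> C" using bd[of 0 0] R by (force intro: order_trans[OF norm_ge_zero])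
  note P = l2_taylor_coeff_bound[OF R h1 h2 bd e ge gl eq]
  have bound: "l2 (\<lambda>j. g j \<zeta>) \<and> l2sq (\<lambda>j. g j \<zeta>) \<le> (sqrt C / (1 - r / R))\<^sup>2"
    if z: "cmod \<zeta> \<le> r" and r: "r < R" for \<zeta> r
  proof -
    define q where "q = r / R"
    have "0 \<le> r" using z norm_ge_zero order_trans by blast
    then have q: "0 \<le> q" "q < 1" using r R by (auto simp: q_def)
    have "(\<Sum>j<n. (cmod (g j \<zeta>))\<^sup>2) \<le> (sqrt C / (1 - q))\<^sup>2" for n
    proof -
      have fin: "L2_set (\<lambda>j. cmod (\<Sum>k<m. taylor_coeff (g j) k * \<zeta> ^ k)) {..<n} \<le> sqrt C / (1 - q)" for m
      proof -
        have "L2_set (\<lambda>j. cmod (\<Sum>k<m. taylor_coeff (g j) k * \<zeta> ^ k)) {..<n}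
            \<le> (\<Sum>k<m. L2_set (\<lambda>j. cmod (taylor_coeff (g j) k * \<zeta> ^ k)) {..<n})"
          by (rule L2_set_sum_le)
        also have "\<dots> \<le> (\<Sum>k<m. sqrt C * q ^ k)"
        proof (rule sum_mono)
          fix k
          have "L2_set (\<lambda>j. cmod (taylor_coeff (g j) k)) {..<n} \<le> sqrt (C / R ^ k / R ^ k)"
            unfolding L2_set_def using partial_l2sq_le[OF P(1), of k n] P(2)[of k]
            by (intro real_sqrt_le_mono) auto
          also have "sqrt (C / R ^ k / R ^ k) = sqrt C / R ^ k"
            using R by (simp add: real_sqrt_divide real_sqrt_mult divide_divide_eq_left flip: power2_eq_square)
          finally have "L2_set (\<lambda>j. cmod (taylor_coeff (g j) k)) {..<n} * cmod \<zeta> ^ k \<le> sqrt C / R ^ k * r ^ k"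
            using z R C by (intro mult_mono power_mono) auto
          then show "L2_set (\<lambda>j. cmod (taylor_coeff (g j) k * \<zeta> ^ k)) {..<n} \<le> sqrt C * q ^ k"
            by (simp add: norm_mult norm_power L2_set_left_distrib q_def power_divide)
        qed
        also have "\<dots> \<le> (\<Sum>k. sqrt C * q ^ k)"
          using q C by (intro sum_le_suminf summable_mult summable_geometric) auto
        also have "\<dots> = sqrt C / (1 - q)"
          using q by (simp add: suminf_mult suminf_geometric)
        finally show ?thesis .
      qed
      have "(\<lambda>m. L2_set (\<lambda>j. cmod (\<Sum>k<m. taylor_coeff (g j) k * \<zeta> ^ k)) {..<n}) \<longlonglongrightarrow> L2_set (\<lambda>j. cmod (g j \<zeta>)) {..<n}"
        unfolding L2_set_def using z r taylor_coeff_sums[OF g, of \<zeta>]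
        by (intro tendsto_intros) (auto simp: sums_def)
      then have "L2_set (\<lambda>j. cmod (g j \<zeta>)) {..<n} \<le> sqrt C / (1 - q)"
        using fin by (intro LIMSEQ_le_const2) auto
      then have "(L2_set (\<lambda>j. cmod (g j \<zeta>)) {..<n})\<^sup>2 \<le> (sqrt C / (1 - q))\<^sup>2"
        by (intro power_mono) auto
      then show ?thesis by (simp add: L2_set_power2)
    qed
    from l2I[OF this] show ?thesis by (simp add: q_def)
  qed
  \<comment> \<open>The norm bound degenerates as r approaches R, so for each \<zeta> a radius
    strictly between \<open>cmod \<zeta>\<close> and R is used.\<close>
  define r where "r = max ((cmod \<zeta> + R) / 2) (R / 2)"
  have r: "cmod \<zeta> < r" "0 < r" "r < R" using z R by (auto simp: r_def max_def add_nonneg_pos)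
  show "l2 (\<lambda>j. g j \<zeta>)" using bound[of \<zeta> r] r by auto
  have "F \<zeta> (cnj \<zeta>) = pairing (\<lambda>j. g j \<zeta>) (\<lambda>j. g j (cnj (cnj \<zeta>)))"
  proof (rule kernel_eq_pairing[where R = r and e = "min e r"])
    show "l2 (\<lambda>j. g j \<zeta>) \<and> l2sq (\<lambda>j. g j \<zeta>) \<le> (sqrt C / (1 - r / R))\<^sup>2" if "\<zeta> \<in> ball 0 r" for \<zeta>
      using bound[of \<zeta> r] r that by auto
    have sr: "ball 0 r \<subseteq> ball (0::complex) R" using r by auto
    show "(\<lambda>\<zeta>. F \<zeta> \<xi>) holomorphic_on ball 0 r" if "\<xi> \<in> ball 0 r" for \<xi>
      using h1 that sr by (meson holomorphic_on_subset subsetD)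
    show "F \<zeta> holomorphic_on ball 0 r" if "\<zeta> \<in> ball 0 r" for \<zeta>
      using h2 that sr by (meson holomorphic_on_subset subsetD)
    show "cmod (F \<zeta> \<xi>) \<le> C" if "\<zeta> \<in> ball 0 r" "\<xi> \<in> ball 0 r" for \<zeta> \<xi>
      using bd that r by auto
    show "g j holomorphic_on ball 0 r" for j
      using g sr by (rule holomorphic_on_subset)
  qed (use r e eq in auto)
  then show "F \<zeta> (cnj \<zeta>) = of_real (l2sq (\<lambda>j. g j \<zeta>))"
    using bound[of \<zeta> r] r by (simp add: pairing_self)
qed

section \<open>Identities between the modulus of one holomorphic function and a power of the modulus
  of another\<close>

lemma has_derivative_ln_cmod:
  assumes "(g has_field_derivative g') (at z)" "g z \<noteq> 0"
  shows "((\<lambda>z. ln (cmod (g z))) has_derivative (\<lambda>h. Re (g' / g z * h))) (at z)"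
proof -
  have "((\<lambda>z. ln (norm (g z))) has_derivative (\<lambda>h. (sgn (g z) \<bullet> (g' * h)) * inverse (norm (g z)))) (at z)"
    using assms(2)
    by (auto intro!: derivative_eq_intros assms(1)[THEN has_field_derivative_imp_has_derivative]
      has_derivative_compose[OF _ has_derivative_norm] simp: divide_inverse inner_commute)
  moreover have "(sgn (g z) \<bullet> (g' * h)) * inverse (norm (g z)) = Re (g' / g z * h)" for h
  proof -
    have "(sgn (g z) \<bullet> (g' * h)) * inverse (norm (g z)) = Re (cnj (g z) * (g' * h)) / (norm (g z))\<^sup>2"
      by (simp add: sgn_div_norm inner_complex_def power2_eq_square divide_inverse algebra_simps)
    also have "\<dots> = Re (cnj (g z) * (g' * h) / of_real ((norm (g z))\<^sup>2))"
      by simp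
    also have "cnj (g z) * (g' * h) / of_real ((norm (g z))\<^sup>2) = g' / g z * h"
      unfolding complex_norm_square using assms(2) by simp
    finally show ?thesis .
  qed
  ultimately show ?thesis by simp
qed

text \<open>Zeros of g obstruct a global branch of its \<mu>-th power, but logarithmic derivatives
  are single-valued. Away from the zeros, \<open>w\<close> is locally the real part of a holomorphic
  function with derivative \<open>E\<close>. As \<open>w\<close> vanishes on a nonempty open set, so
  does \<open>E\<close> there, and then on all of the connected set S - Z. Hence \<open>w\<close> is
  constant and equal to 0, and the zeros themselves are reached by continuity.\<close>

lemma modulus_powr_identity:
  assumes S: "open S" "connected S" and g: "g holomorphic_on S" and k: "k holomorphic_on S"
    and \<mu>: "0 < \<mu>" and Q: "open Q" "Q \<noteq> {}" "Q \<subseteq> S"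
    and eq: "\<And>z. z \<in> Q \<Longrightarrow> cmod (g z) powr \<mu> = cmod (k z)" and z: "z \<in> S"
  shows "cmod (g z) powr \<mu> = cmod (k z)"
proof (cases "\<exists>z\<in>Q. g z \<noteq> 0")
  case False
  then have g0: "g z = 0" if "z \<in> Q" for z using that by auto
  have "k z = 0" if "z \<in> Q" for z using eq[OF that] g0[OF that] by simp
  then have "k z = 0"
    using analytic_continuation_open[OF Q(1) S(1) Q(2) S(2) Q(3) k, of "\<lambda>_. 0" z] z by auto
  moreover have "g z = 0"
    using analytic_continuation_open[OF Q(1) S(1) Q(2) S(2) Q(3) g, of "\<lambda>_. 0" z] z g0 by auto
  ultimately show ?thesis by simp
next
  case True
  then obtain z0 where z0: "z0 \<in> Q" "g z0 \<noteq> 0" by auto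
  then have k0: "k z0 \<noteq> 0" using eq[of z0] by auto
  define Z where "Z = {z\<in>S. g z = 0} \<union> {z\<in>S. k z = 0}"
  have cnt: "countable {z\<in>S. f z = 0}" if f: "f holomorphic_on S" "f z0 \<noteq> 0" for f
  proof (cases "f constant_on S")
    case True
    then have "{z\<in>S. f z = 0} = {}" using f z0 Q by (force simp: constant_on_def)
    then show ?thesis by (simp only: countable_empty)
  next
    case False
    moreover have "fsigma S"
      by (rule open_Union_compact_subsets[OF S(1)]) (use fsigma.intros compact_imp_closed in metis)
    ultimately show ?thesis
      using holomorphic_countable_zeros[OF f(1) S] by blast
  qed
  have "countable Z" unfolding Z_def using cnt g k z0 k0 by auto
  \<comment> \<open>Removing a countable set does not disconnect a plane domain, so the identity
    theorem for \<open>E\<close> is available on S - Z.\<close>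
  then have conn: "connected (S - Z)"
    using S by (intro connected_open_diff_countable) auto
  have SZ: "S - Z = S \<inter> (g -` (-{0}) \<inter> k -` (-{0})) "
    by (auto simp: Z_def)
  have op: "open (S - Z)"
  proof -
    have "open (S \<inter> g -` (-{0}))" "open (S \<inter> k -` (-{0}))"
      using g k S by (auto intro!: continuous_open_preimage holomorphic_on_imp_continuous_on)
    moreover have "S - Z = (S \<inter> g -` (-{0})) \<inter> (S \<inter> k -` (-{0}))" by (auto simp: Z_def)
    ultimately show ?thesis by auto
  qed
  define E where "E z = of_real \<mu> * (deriv g z / g z) - deriv k z / k z" for z
  define w where "w z = \<mu> * ln (cmod (g z)) - ln (cmod (k z))" for z
  have w: "(w has_derivative (\<lambda>h. Re (E z * h))) (at z)" if z: "z \<in> S - Z" for z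
  proof -
    have dg: "(g has_field_derivative deriv g z) (at z)" and dk: "(k has_field_derivative deriv k z) (at z)"
      using g k z S by (auto intro: holomorphic_derivI)
    have "g z \<noteq> 0" "k z \<noteq> 0" using z by (auto simp: Z_def)
    then have "(w has_derivative (\<lambda>h. \<mu> * Re (deriv g z / g z * h) - Re (deriv k z / k z * h))) (at z)"
      unfolding w_def by (intro derivative_intros has_derivative_ln_cmod dg dk)
    moreover have "E z * h = of_real \<mu> * (deriv g z / g z * h) - deriv k z / k z * h" for h
      by (simp add: E_def algebra_simps)
    then have "Re (E z * h) = \<mu> * Re (deriv g z / g z * h) - Re (deriv k z / k z * h)" for h
      by (metis Re_complex_of_real Re_divide_of_real minus_complex.sel(1) scaleR_complex.sel(1) scaleR_conv_of_real)
    ultimately show ?thesis by simp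
  qed
  have w0: "w z = 0" if z: "z \<in> Q - Z" for z
  proof -
    have nz: "g z \<noteq> 0" "k z \<noteq> 0" using z Q by (auto simp: Z_def)
    have "ln (cmod (k z)) = ln (cmod (g z) powr \<mu>)" using eq[of z] z by simp
    then show ?thesis using nz by (simp add: w_def ln_powr)
  qed
  have QZ1: "Q - Z = Q \<inter> (S - Z)" using Q by blast
  then have QZ: "Q - Z = Q \<inter> (S - Z)" "open (Q - Z)" "Q - Z \<noteq> {}"
    using open_Int[OF Q(1) op] z0 k0 by (simp_all only:) (auto simp: Z_def)
  have E0: "E z = 0" if z: "z \<in> Q - Z" for z
  proof -
    have "(w has_derivative (\<lambda>h. 0)) (at z)"
      by (rule has_derivative_transform_within_open[OF has_derivative_const[of 0] QZ(2) z])
         (simp add: w0)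
    then have "(\<lambda>h. Re (E z * h)) = (\<lambda>h. 0)"
      using w[of z] z QZ(1) has_derivative_unique by blast
    \<comment> \<open>Evaluated at the conjugate of \<open>E z\<close>, the vanishing real-linear
      form equals the squared modulus of \<open>E z\<close>.\<close>
    from fun_cong[OF this, of "cnj (E z)"] show ?thesis
      by (simp add: complex_mult_cnj complex_eq_iff sum_power2_eq_zero_iff)
  qed
  have EH: "E holomorphic_on (S - Z)"
  proof -
    have "g holomorphic_on (S - Z)" "k holomorphic_on (S - Z)"
      using g k by (auto elim: holomorphic_on_subset)
    then show ?thesis
      unfolding E_def using op by (intro holomorphic_intros) (auto simp: Z_def)
  qed
  have E: "E z = 0" if "z \<in> S - Z" for z
    by (rule analytic_continuation_open[OF QZ(2) op QZ(3) conn _ EH, of "\<lambda>_. 0"])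
       (use that E0 Q in auto)
  have z0': "z0 \<in> S - Z" using z0 k0 Q by (auto simp: Z_def)
  have wz: "w z = 0" if z: "z \<in> S - Z" for z
  proof -
    have "w z = w z0"
      by (rule has_derivative_zero_unique_connected[OF op conn _ z0' z, symmetric])
         (use w E in auto)
    then show ?thesis using w0[of z0] z0 z0' by auto
  qed
  have off: "cmod (g z) powr \<mu> = cmod (k z)" if z: "z \<in> S - Z" for z
  proof -
    have "ln (cmod (g z) powr \<mu>) = ln (cmod (k z))"
      using wz[OF z] z by (simp add: w_def ln_powr Z_def)
    then show ?thesis using z by (subst (asm) ln_inj_iff) (auto simp: Z_def)
  qed
  \<comment> \<open>Since \<mu> > 0, the real power is continuous also at the zeros of g. The set
    where \<open>u\<close> is nonzero is therefore open; being contained in the countable set Z, it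
    is empty.\<close>
  define u where "u z = cmod (g z) powr \<mu> - cmod (k z)" for z
  have cu: "continuous_on S u"
    unfolding u_def using \<mu> g k
    by (intro continuous_on_diff continuous_on_powr' continuous_on_norm continuous_on_const
        holomorphic_on_imp_continuous_on) auto
  have "open (S \<inter> u -` (-{0}))"
    using cu S by (auto intro!: continuous_open_preimage)
  moreover have "S \<inter> u -` (-{0}) \<subseteq> Z" using off by (auto simp: u_def)
  ultimately have "S \<inter> u -` (-{0}) = {}"
    using \<open>countable Z\<close> countable_subset uncountable_ball open_contains_ball
    by (metis equals0I)
  then show ?thesis using z by (auto simp: u_def)
qed

section \<open>Positivity of the inner product near a fixed vector\<close>

lemma pairing_expand_right:
  assumes "l2 a" "l2 b" "l2 d"
  shows "pairing d (\<lambda>j. a j - b j) = pairing d a - pairing d b"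
proof -
  have l: "l2 (\<lambda>j. a j - b j)" using l2_diff_scale[OF assms(1,2), of 1] by simp
  have "cnj (pairing (\<lambda>j. a j - b j) d) = cnj (pairing a d - pairing b d)"
    using pairing_diff_scale_left[OF assms, of 1] by simp
  then show ?thesis using assms l by (simp add: pairing_cnj)
qed

lemma l2sq_diff:
  assumes "l2 a" "l2 b"
  shows "l2sq (\<lambda>j. a j - b j) = l2sq a + l2sq b - 2 * Re (pairing a b)"
proof -
  define D where "D j = a j - b j" for j
  have l: "l2 D" using l2_diff_scale[OF assms, of 1] by (simp add: D_def[abs_def])
  have "of_real (l2sq D) = pairing D D" using pairing_self[OF l] by simp
  also have "\<dots> = pairing a D - pairing b D"
    using pairing_diff_scale_left[OF assms l, of 1] by (simp add: D_def[abs_def])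
  also have "\<dots> = (pairing a a - pairing a b) - (pairing b a - pairing b b)"
    using pairing_expand_right[OF assms assms(1)] pairing_expand_right[OF assms assms(2)]
    by (simp add: D_def[abs_def])
  finally have "Re (of_real (l2sq D)) = Re ((pairing a a - pairing a b) - (pairing b a - pairing b b))"
    by simp
  moreover have "Re (pairing b a) = Re (pairing a b)"
    by (metis complex_cnj(1) pairing_cnj[OF assms] cnj.sel(1))
  ultimately show ?thesis
    using assms by (simp add: pairing_self D_def[abs_def])
qed

text \<open>Both vectors lie within a sixth of the norm of a from a, and y has at most twice that
  norm. In the decomposition \<langle>x, y\<rangle> = |a|^2 + \<langle>x - a, y\<rangle> +
  \<langle>a, y - a\<rangle> the error terms are at most |a|^2 / 3 and |a|^2 / 6. The pairing thus
  stays in the right half-plane, where the principal logarithm is holomorphic.\<close>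

lemma Re_pairing_near:
  assumes a: "l2 a" and x: "l2 x" "l2sq (\<lambda>j. x j - a j) \<le> l2sq a / 36"
    and y: "l2 y" "l2sq (\<lambda>j. y j - a j) \<le> l2sq a / 36" "l2sq y \<le> 4 * l2sq a" and pos: "0 < l2sq a"
  shows "0 < Re (pairing x y)"
proof -
  define X Y where "X j = x j - a j" and "Y j = y j - a j" for j
  have X: "l2 X" "l2sq X \<le> l2sq a / 36" and Y: "l2 Y" "l2sq Y \<le> l2sq a / 36"
    using l2_diff_scale[OF x(1) a, of 1] l2_diff_scale[OF y(1) a, of 1] x y
    by (simp_all add: X_def[abs_def] Y_def[abs_def])
  have "pairing x y = pairing X y + pairing a y"
    using pairing_diff_scale_left[OF x(1) a y(1), of 1] by (simp add: X_def[abs_def])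
  moreover have "pairing a y = pairing a Y + of_real (l2sq a)"
    using pairing_expand_right[OF y(1) a a] pairing_self[OF a] by (simp add: Y_def[abs_def])
  ultimately have eq: "pairing x y = of_real (l2sq a) + pairing X y + pairing a Y" by simp
  have "(cmod (pairing X y))\<^sup>2 \<le> l2sq X * l2sq y" by (rule Cauchy_Schwarz_pairing[OF X(1) y(1)])
  also have "\<dots> \<le> (l2sq a / 36) * (4 * l2sq a)"
    using X y l2sq_nonneg[OF X(1)] l2sq_nonneg[OF y(1)] by (intro mult_mono) auto
  also have "\<dots> = (l2sq a / 3)\<^sup>2" by (simp add: power2_eq_square)
  finally have 1: "cmod (pairing X y) \<le> l2sq a / 3" by (rule power2_le_imp_le) (use pos in simp)
  have "(cmod (pairing a Y))\<^sup>2 \<le> l2sq a * l2sq Y" by (rule Cauchy_Schwarz_pairing[OF a Y(1)])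
  also have "\<dots> \<le> l2sq a * (l2sq a / 36)" using Y pos by (intro mult_left_mono) auto
  also have "\<dots> = (l2sq a / 6)\<^sup>2" by (simp add: power2_eq_square)
  finally have 2: "cmod (pairing a Y) \<le> l2sq a / 6" by (rule power2_le_imp_le) (use pos in simp)
  have "- Re (pairing X y) \<le> cmod (pairing X y)" "- Re (pairing a Y) \<le> cmod (pairing a Y)"
    using abs_Re_le_cmod[of "pairing X y"] abs_Re_le_cmod[of "pairing a Y"] by linarith+
  then show ?thesis using 1 2 pos by (simp add: eq)
qed

section \<open>Holomorphic and real-analytic functions on \<open>\<complex>\<^sup>n\<close>\<close>

lemma norm_smult_cvec: "norm (c *s (v :: complex^'n)) = cmod c * norm v"
  by (simp add: norm_vec_def norm_mult L2_set_right_distrib)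

lemma smult_cvec_scaleR: "complex_of_real c *s (v :: complex^'n) = c *\<^sub>R v"
  by (simp add: vec_eq_iff scaleR_conv_of_real[where 'a = complex])

lemma bounded_linear_smult_left: "bounded_linear (\<lambda>\<zeta>. \<zeta> *s (v :: complex^'n))"
  by (rule bounded_linear_intro[where K = "norm v"])
     (auto simp: norm_smult_cvec vector_sadd_rdistrib vec_eq_iff algebra_simps)

lemma bounded_linear_smult_right: "bounded_linear (\<lambda>v :: complex^'n. c *s v)"
  by (rule bounded_linear_intro[where K = "cmod c"])
     (auto simp: norm_smult_cvec vec_eq_iff algebra_simps)

lemma has_derivative_complex_line: "((\<lambda>\<zeta>. x + \<zeta> *s (v :: complex^'n)) has_derivative (\<lambda>h. h *s v)) (at \<zeta>)"
  using has_derivative_add[OF has_derivative_const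
      bounded_linear_imp_has_derivative[OF bounded_linear_smult_left]] by simp

lemma has_derivative_smult_right: "((\<lambda>v :: complex^'n. x + c *s v) has_derivative (\<lambda>h. c *s h)) (at v)"
  using has_derivative_add[OF has_derivative_const
      bounded_linear_imp_has_derivative[OF bounded_linear_smult_right]] by simp

lemma sv_holomorphic_on_imp_continuous_on: "sv_holomorphic_on f S \<Longrightarrow> continuous_on S f"
  unfolding sv_holomorphic_on_def
  by (intro continuous_at_imp_continuous_on ballI) (metis has_derivative_continuous)

lemma sv_holomorphic_on_subset: "sv_holomorphic_on f S \<Longrightarrow> T \<subseteq> S \<Longrightarrow> sv_holomorphic_on f T"
  by (auto simp: sv_holomorphic_on_def)

lemma sv_holomorphic_on_cong_open:
  assumes "open S" "sv_holomorphic_on f S" "\<And>x. x \<in> S \<Longrightarrow> f x = g x"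
  shows "sv_holomorphic_on g S"
  using assms has_derivative_transform_within_open[OF _ assms(1)] unfolding sv_holomorphic_on_def
  by metis

lemma sv_holomorphic_on_const: "sv_holomorphic_on (\<lambda>_. c) S"
  unfolding sv_holomorphic_on_def by (intro ballI exI[of _ "\<lambda>_. 0"]) auto

lemma sv_holomorphic_on_diff:
  assumes "sv_holomorphic_on f S" "sv_holomorphic_on g S"
  shows "sv_holomorphic_on (\<lambda>x. f x - g x) S"
  unfolding sv_holomorphic_on_def
proof
  fix x assume "x \<in> S"
  then obtain L M where "(f has_derivative L) (at x)" "\<forall>c v. L (c *s v) = c * L v"
      "(g has_derivative M) (at x)" "\<forall>c v. M (c *s v) = c * M v"
    using assms unfolding sv_holomorphic_on_def by metis
  then show "\<exists>L. ((\<lambda>x. f x - g x) has_derivative L) (at x) \<and> (\<forall>c v. L (c *s v) = c * L v)"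
    by (intro exI[of _ "\<lambda>v. L v - M v"]) (auto intro: has_derivative_diff simp: algebra_simps)
qed

lemma sv_holomorphic_on_mult:
  assumes "sv_holomorphic_on f S" "sv_holomorphic_on g S"
  shows "sv_holomorphic_on (\<lambda>x. f x * g x) S"
  unfolding sv_holomorphic_on_def
proof
  fix x assume "x \<in> S"
  then obtain L M where "(f has_derivative L) (at x)" "\<forall>c v. L (c *s v) = c * L v"
      "(g has_derivative M) (at x)" "\<forall>c v. M (c *s v) = c * M v"
    using assms unfolding sv_holomorphic_on_def by metis
  then show "\<exists>L. ((\<lambda>x. f x * g x) has_derivative L) (at x) \<and> (\<forall>c v. L (c *s v) = c * L v)"
    by (intro exI[of _ "\<lambda>v. f x * M v + L v * g x"] conjI has_derivative_mult) (auto simp: algebra_simps)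
qed

lemma sv_holomorphic_on_cmult: "sv_holomorphic_on f S \<Longrightarrow> sv_holomorphic_on (\<lambda>x. c * f x) S"
  by (intro sv_holomorphic_on_mult sv_holomorphic_on_const)

lemma sv_holomorphic_on_sum:
  assumes "\<And>i. i < n \<Longrightarrow> sv_holomorphic_on (f i) S"
  shows "sv_holomorphic_on (\<lambda>x. \<Sum>i<(n::nat). f i x) S"
  using assms
proof (induction n)
  case (Suc n)
  have "sv_holomorphic_on (\<lambda>x. (\<Sum>i<n. f i x) - (- 1) * f n x) S"
    using Suc by (intro sv_holomorphic_on_diff sv_holomorphic_on_cmult) auto
  then show ?case by simp
qed (simp add: sv_holomorphic_on_const)

lemma holomorphic_on_complex_line:
  assumes "sv_holomorphic_on f S" "\<And>\<zeta>. \<zeta> \<in> T \<Longrightarrow> x + \<zeta> *s v \<in> S"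
  shows "(\<lambda>\<zeta>. f (x + \<zeta> *s v)) holomorphic_on T"
  unfolding holomorphic_on_def
proof
  fix \<zeta> assume "\<zeta> \<in> T"
  then obtain L where L: "(f has_derivative L) (at (x + \<zeta> *s v))" "\<And>c v. L (c *s v) = c * L v"
    using assms unfolding sv_holomorphic_on_def by metis
  from has_derivative_compose[OF has_derivative_complex_line L(1)]
  have "((\<lambda>\<zeta>. f (x + \<zeta> *s v)) has_derivative (*) (L v)) (at \<zeta>)"
    by (simp add: L(2) mult.commute[of _ "L v"])
  then show "(\<lambda>\<zeta>. f (x + \<zeta> *s v)) field_differentiable at \<zeta> within T"
    unfolding field_differentiable_def has_field_derivative_def
    using has_derivative_at_withinI by blast
qed

lemma sv_holomorphic_on_compose_scale:
  assumes "sv_holomorphic_on f S" "\<And>v. v \<in> T \<Longrightarrow> x + c *s v \<in> S"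
  shows "sv_holomorphic_on (\<lambda>v. f (x + c *s v)) T"
  unfolding sv_holomorphic_on_def
proof
  fix v assume "v \<in> T"
  then obtain L where L: "(f has_derivative L) (at (x + c *s v))" "\<And>c v. L (c *s v) = c * L v"
    using assms unfolding sv_holomorphic_on_def by metis
  from has_derivative_compose[OF has_derivative_smult_right L(1)]
  show "\<exists>L. ((\<lambda>v. f (x + c *s v)) has_derivative L) (at v) \<and> (\<forall>c v. L (c *s v) = c * L v)"
    by (intro exI[of _ "\<lambda>h. L (c *s h)"]) (auto simp: L(2))
qed

text \<open>The second-order Taylor remainder on each complex line through x is controlled by C and
  r alone, hence uniformly in the direction. For distances below r / 2 it is at most 2 C / r^2 times
  the squared distance, so a linear map with the right directional derivatives is the Frechet
  derivative.\<close>

lemma has_derivative_of_complex_lines: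
  fixes f :: "complex^'n \<Rightarrow> complex"
  assumes r: "0 < r" and bd: "\<And>y. y \<in> ball x r \<Longrightarrow> cmod (f y) \<le> C"
    and hol: "\<And>v. norm v = 1 \<Longrightarrow> (\<lambda>\<zeta>. f (x + \<zeta> *s v)) holomorphic_on ball 0 r"
    and L: "\<And>v w. L (v + w) = L v + L w" "\<And>c v. L (c *s v) = c * L v"
    and deriv: "\<And>v. norm v = 1 \<Longrightarrow> L v = deriv (\<lambda>\<zeta>. f (x + \<zeta> *s v)) 0"
  shows "(f has_derivative L) (at x)"
proof -
  have lin: "linear L"
    by (intro linearI L) (metis L(2) scaleR_conv_of_real smult_cvec_scaleR)
  have C: "0 \<le> C" using bd[of x] r by (auto intro: order_trans[OF norm_ge_zero])
  have bound: "norm (f y - f x - L (y - x)) / norm (y - x) \<le> 2 * C / r\<^sup>2 * norm (y - x)"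
    if y: "y \<noteq> x" "dist y x < r / 2" for y
  proof -
    define t where "t = norm (y - x)"
    define u where "u = (1 / complex_of_real t) *s (y - x)"
    have t: "0 < t" "t < r / 2" using y by (auto simp: t_def dist_norm)
    have u: "norm u = 1"
      using t unfolding u_def norm_smult_cvec by (simp add: norm_divide t_def[symmetric])
    have yx: "y - x = of_real t *s u" using t by (simp add: u_def vector_smult_assoc)
    define g where "g \<zeta> = f (x + \<zeta> *s u)" for \<zeta>
    have g: "g holomorphic_on ball 0 r" unfolding g_def by (rule hol[OF u])
    have "cmod (g (of_real t) - (\<Sum>i<2. taylor_coeff g i * of_real t ^ i))
        \<le> C * (cmod (of_real t) / r) ^ 2 / (1 - cmod (of_real t) / r)"
    proof (rule taylor_tail_bound[OF g r])
      show "cmod (g \<zeta>) \<le> C" if "\<zeta> \<in> ball 0 r" for \<zeta>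
        unfolding g_def using that u by (intro bd) (simp add: dist_norm norm_smult_cvec)
    qed (use t r in auto)
    also have "(\<Sum>i<2. taylor_coeff g i * of_real t ^ i) = f x + L (y - x)"
      using deriv[OF u] by (simp add: numeral_2_eq_2 taylor_coeff_def g_def[abs_def] yx L(2) mult.commute)
    also have "g (of_real t) = f y" using yx by (simp add: g_def algebra_simps)
    also have "C * (cmod (of_real t) / r) ^ 2 / (1 - cmod (of_real t) / r) \<le> C * (t / r) ^ 2 / (1 / 2)"
    proof -
      have "1 / 2 \<le> 1 - t / r" using t r by (simp add: field_simps)
      then show ?thesis
        using t C by (simp only: norm_of_real abs_of_pos) (intro divide_left_mono, auto)
    qed
    finally have "norm (f y - f x - L (y - x)) \<le> 2 * C / r\<^sup>2 * t * t"
      by (simp add: algebra_simps power2_eq_square)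
    then show ?thesis using t r by (simp add: t_def[symmetric] field_simps)
  qed
  have "((\<lambda>y. norm (f y - f x - L (y - x)) / norm (y - x)) \<longlongrightarrow> 0) (at x)"
  proof (rule Lim_null_comparison)
    show "eventually (\<lambda>y. norm (norm (f y - f x - L (y - x)) / norm (y - x)) \<le> 2 * C / r\<^sup>2 * norm (y - x)) (at x)"
      unfolding eventually_at using r bound by (intro exI[of _ "r / 2"]) auto
    show "((\<lambda>y. 2 * C / r\<^sup>2 * norm (y - x)) \<longlongrightarrow> 0) (at x)"
    proof -
      have "((\<lambda>y. 2 * C / r\<^sup>2 * norm (y - x)) \<longlongrightarrow> 2 * C / r\<^sup>2 * norm (x - x)) (at x)"
        by (rule tendsto_mult[OF tendsto_const tendsto_norm[OF tendsto_diff[OF tendsto_ident_at tendsto_const]]])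
      then show ?thesis by simp
    qed
  qed
  then show ?thesis
    using lin by (simp add: has_derivative_iff_norm linear_conv_bounded_linear)
qed

text \<open>Weierstrass's theorem on each complex line gives holomorphy there and convergence of the
  directional derivatives. Their limit is complex linear, being a pointwise limit of complex linear
  maps, and the preceding estimate upgrades it to a Frechet derivative.\<close>

lemma sv_holomorphic_on_uniform_limit:
  assumes S: "open S" and f: "\<And>n. sv_holomorphic_on (f n) S" and lim: "uniform_limit S f g sequentially"
  shows "sv_holomorphic_on g S"
  unfolding sv_holomorphic_on_def
proof
  fix x assume x: "x \<in> S"
  \<comment> \<open>A single member of the sequence that is uniformly close to g and continuous at x
    already bounds g near x.\<close>
  obtain n where n: "\<And>y. y \<in> S \<Longrightarrow> dist (f n y) (g y) < 1"
    using uniform_limitD[OF lim, of 1] by (auto simp: eventually_sequentially)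
  have "isCont (f n) x"
    using sv_holomorphic_on_imp_continuous_on[OF f] S x continuous_on_eq_continuous_at by blast
  then obtain d where d: "d > 0" "\<And>y. dist y x < d \<Longrightarrow> dist (f n y) (f n x) < 1"
    unfolding continuous_at_eps_delta by (metis zero_less_one)
  obtain e where e: "e > 0" "ball x e \<subseteq> S" using S x open_contains_ball by blast
  define r where "r = min d e"
  have r: "0 < r" "ball x r \<subseteq> S" using d e by (auto simp: r_def)
  have bd: "cmod (g y) \<le> cmod (f n x) + 2" if "y \<in> ball x r" for y
  proof -
    have "cmod (g y - f n y) < 1" "cmod (f n y - f n x) < 1"
      using n[of y] d(2)[of y] that r by (auto simp: dist_norm norm_minus_commute r_def)
    then show ?thesis
      using norm_triangle_ineq[of "g y - f n y" "f n y"] norm_triangle_sub[of "f n y" "f n x"] by simp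
  qed
  have "\<exists>L. ((f n) has_derivative L) (at x) \<and> (\<forall>c v. L (c *s v) = c * L v)" for n
    using f x unfolding sv_holomorphic_on_def by auto
  then obtain L where L: "\<And>n. ((f n) has_derivative L n) (at x)" "\<And>n c v. L n (c *s v) = c * L n v"
    by metis
  define M where "M v = deriv (\<lambda>\<zeta>. g (x + \<zeta> *s v)) 0" for v
  have line: "(\<lambda>\<zeta>. g (x + \<zeta> *s v)) holomorphic_on ball 0 s \<and> (\<lambda>n. L n v) \<longlonglongrightarrow> M v"
    if s: "0 < s" "s * norm v \<le> r" for v s
  proof -
    have inS: "x + \<zeta> *s v \<in> S" if "\<zeta> \<in> ball 0 s" for \<zeta>
    proof -
      have "cmod \<zeta> * norm v < r"
      proof (cases "v = 0")
        case False
        then have "cmod \<zeta> * norm v < s * norm v" using that by auto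
        then show ?thesis using s by linarith
      qed (use r in auto)
      then show ?thesis using r by (auto simp: dist_norm norm_smult_cvec)
    qed
    have ul: "uniform_limit (ball 0 s) (\<lambda>n \<zeta>. f n (x + \<zeta> *s v)) (\<lambda>\<zeta>. g (x + \<zeta> *s v)) sequentially"
      using uniform_limit_compose'[OF lim, of "\<lambda>\<zeta>. x + \<zeta> *s v" "ball 0 s"] inS by auto
    have fh: "(\<lambda>\<zeta>. f n (x + \<zeta> *s v)) holomorphic_on ball 0 s" for n
      by (rule holomorphic_on_complex_line[OF f inS])
    have "(\<lambda>n. (deriv ^^ 1) (\<lambda>\<zeta>. f n (x + \<zeta> *s v)) 0) \<longlonglongrightarrow> (deriv ^^ 1) (\<lambda>\<zeta>. g (x + \<zeta> *s v)) 0"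
      by (rule higher_deriv_complex_uniform_limit[OF ul]) (use fh s in auto)
    moreover have "deriv (\<lambda>\<zeta>. f n (x + \<zeta> *s v)) 0 = L n v" for n
    proof (rule DERIV_imp_deriv)
      from has_derivative_compose[OF has_derivative_complex_line[of x v 0], of "f n" "L n"] L(1)[of n]
      show "((\<lambda>\<zeta>. f n (x + \<zeta> *s v)) has_field_derivative L n v) (at 0)"
        by (simp add: L(2) has_field_derivative_def mult.commute[of _ "L n v"])
    qed
    ultimately have "(\<lambda>n. L n v) \<longlonglongrightarrow> M v" by (simp add: M_def)
    then show ?thesis
      using holomorphic_on_uniform_limit_open[OF _ fh ul] by auto
  qed
  \<comment> \<open>For long vectors v the disc has to shrink so that the line stays in the ball;
    the summand 1 in the denominator covers v = 0.\<close>
  have M: "(\<lambda>n. L n v) \<longlonglongrightarrow> M v" for v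
  proof -
    have "norm v / (norm v + 1) \<le> 1" by (simp add: divide_le_eq add_nonneg_pos)
    then have "r / (norm v + 1) * norm v \<le> r"
      using r mult_left_mono[of "norm v / (norm v + 1)" 1 r] by simp
    then show ?thesis
      using line[of "r / (norm v + 1)" v] r by (auto simp: add_nonneg_pos)
  qed
  have "(g has_derivative M) (at x)"
  proof (rule has_derivative_of_complex_lines[OF r(1) bd])
    show "M (v + w) = M v + M w" for v w
      using tendsto_add[OF M[of v] M[of w]] M[of "v + w"]
      by (simp add: linear_add[OF has_derivative_linear[OF L(1)], symmetric] LIMSEQ_unique)
    show "M (c *s v) = c * M v" for c v
      using tendsto_mult_left[OF M[of v], of c] M[of "c *s v"] by (simp add: L(2) LIMSEQ_unique)
    show "(\<lambda>\<zeta>. g (x + \<zeta> *s v)) holomorphic_on ball 0 r" if "norm v = 1" for v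
      using line[of r v] that r by auto
  qed (auto simp: M_def)
  moreover have "M (c *s v) = c * M v" for c v
    using tendsto_mult_left[OF M[of v], of c] M[of "c *s v"] by (simp add: L(2) LIMSEQ_unique)
  ultimately show "\<exists>L. (g has_derivative L) (at x) \<and> (\<forall>c v. L (c *s v) = c * L v)" by blast
qed

lemma sv_holomorphic_on_locally:
  assumes "\<And>x. x \<in> S \<Longrightarrow> \<exists>T. x \<in> T \<and> sv_holomorphic_on f T"
  shows "sv_holomorphic_on f S"
  using assms unfolding sv_holomorphic_on_def by blast

lemma sv_holomorphic_taylor_coeff:
  assumes "0 < R" "open S"
    and "\<And>v. v \<in> S \<Longrightarrow> \<Phi> v holomorphic_on ball 0 R"
    and "\<And>v \<zeta>. v \<in> S \<Longrightarrow> \<zeta> \<in> ball 0 R \<Longrightarrow> cmod (\<Phi> v \<zeta>) \<le> C"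
    and "\<And>\<zeta>. \<zeta> \<in> ball 0 R \<Longrightarrow> sv_holomorphic_on (\<lambda>v. \<Phi> v \<zeta>) S"
  shows "sv_holomorphic_on (\<lambda>v. taylor_coeff (\<Phi> v) k) S"
  by (rule taylor_coeff_closed[where S = S and C = C and R = R and P = "\<lambda>f. sv_holomorphic_on f S"])
     (use assms in \<open>auto intro: sv_holomorphic_on_diff sv_holomorphic_on_cmult sv_holomorphic_on_uniform_limit\<close>)

text \<open>The index set of \<open>real_analytic_at\<close> with an arbitrary set in place of
  \<open>Basis\<close>, so that induction over the variables is possible.\<close>

abbreviation multi_indices :: "'b set \<Rightarrow> ('b \<Rightarrow> nat) set" where
  "multi_indices S \<equiv> {\<alpha>. \<forall>b. b \<notin> S \<longrightarrow> \<alpha> b = 0}"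

lemma taylor_coeff_scale:
  assumes d: "0 < d" and g: "g holomorphic_on ball 0 d"
  shows "taylor_coeff (\<lambda>\<zeta>. g (t * \<zeta>)) k = t ^ k * taylor_coeff g k"
proof (rule taylor_coeff_eqI)
  let ?e = "d / (1 + cmod t)"
  show "0 < ?e" using d by (simp add: add_pos_nonneg)
  have ball: "t * \<zeta> \<in> ball 0 d" if "\<zeta> \<in> ball 0 ?e" for \<zeta>
  proof -
    have "cmod \<zeta> * (1 + cmod t) < d"
      using that by (simp add: pos_less_divide_eq add_pos_nonneg)
    then have "cmod t * cmod \<zeta> + cmod \<zeta> < d" by (simp add: algebra_simps)
    then have "cmod t * cmod \<zeta> < d" using norm_ge_zero[of \<zeta>] by linarith
    then show ?thesis by (simp add: norm_mult)
  qed
  show "(\<lambda>\<zeta>. g (t * \<zeta>)) holomorphic_on ball 0 ?e"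
  proof -
    have "(\<lambda>\<zeta>. t * \<zeta>) ` ball 0 ?e \<subseteq> ball 0 d" using ball by blast
    from holomorphic_on_compose_gen[OF _ g this] show ?thesis
      by (simp add: o_def holomorphic_on_mult)
  qed
  show "(\<lambda>k. t ^ k * taylor_coeff g k * \<zeta> ^ k) sums g (t * \<zeta>)" if "\<zeta> \<in> ball 0 ?e" for \<zeta>
    using taylor_coeff_sums[OF g ball[OF that]] by (simp add: power_mult_distrib mult_ac)
qed

text \<open>The extension is the sum of the homogeneous expansion at \<open>a\<close>, which converges on \<open>ball a R\<close> by
  Calabi's estimate on each complex line through \<open>a\<close>.\<close>

lemma sv_holomorphic_extension_of_kernel:
  fixes h :: "nat \<Rightarrow> complex^'n \<Rightarrow> complex" and F :: "complex^'n \<Rightarrow> complex \<Rightarrow> complex \<Rightarrow> complex"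
  assumes R: "0 < R" "R \<le> 1" and e: "0 < e" "e \<le> R"
    and F1: "\<And>v \<xi>. norm v = 1 \<Longrightarrow> \<xi> \<in> ball 0 R \<Longrightarrow> (\<lambda>\<zeta>. F v \<zeta> \<xi>) holomorphic_on ball 0 R"
    and F2: "\<And>v \<zeta>. norm v = 1 \<Longrightarrow> \<zeta> \<in> ball 0 R \<Longrightarrow> (\<lambda>\<xi>. F v \<zeta> \<xi>) holomorphic_on ball 0 R"
    and F3: "\<And>v \<zeta> \<xi>. norm v = 1 \<Longrightarrow> \<zeta> \<in> ball 0 R \<Longrightarrow> \<xi> \<in> ball 0 R \<Longrightarrow> cmod (F v \<zeta> \<xi>) \<le> C"
    and F4: "\<And>v \<zeta>. norm v = 1 \<Longrightarrow> \<zeta> \<in> ball 0 R \<Longrightarrow> F v \<zeta> (cnj \<zeta>) = of_real (\<phi> (a + \<zeta> *s v))"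
    and h: "\<And>j. sv_holomorphic_on (h j) (ball a e)"
    and s: "\<And>y. y \<in> ball a e \<Longrightarrow> (\<lambda>j. (cmod (h j y))\<^sup>2) sums \<phi> y"
  obtains g where "\<And>j. sv_holomorphic_on (g j) (ball a R)" "\<And>j y. y \<in> ball a e \<Longrightarrow> g j y = h j y"
    "\<And>y. y \<in> ball a R \<Longrightarrow> (\<lambda>j. (cmod (g j y))\<^sup>2) sums \<phi> y"
proof -
  \<comment> \<open>The homogeneous term of degree k of \<open>h j\<close> at a, evaluated at v. It
    is shown below to be holomorphic for v in the unit ball, because a + \<zeta>v then stays in the
    domain of \<open>h j\<close> for \<open>\<zeta> \<in> ball 0 e\<close>; the assumption R \<le> 1
    keeps the later arguments y - a in that unit ball.\<close>
  define p where "p j k v = taylor_coeff (\<lambda>\<zeta>. h j (a + \<zeta> *s v)) k" for j k v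
  define g where "g j y = (\<Sum>k. p j k (y - a))" for j y
  have polar: "\<exists>\<zeta> u. norm u = 1 \<and> y = a + \<zeta> *s u \<and> cmod \<zeta> = norm (y - a)" for y :: "complex^'n"
  proof (cases "y = a")
    case True
    \<comment> \<open>The centre distinguishes no direction, so any unit vector serves;
      \<open>undefined\<close> is just some index.\<close>
    show ?thesis
      by (rule exI[of _ 0], rule exI[of _ "axis undefined 1"]) (simp add: True norm_axis_1)
  next
    case False
    define u where "u = (1 / complex_of_real (norm (y - a))) *s (y - a)"
    have "norm u = 1" using False unfolding u_def norm_smult_cvec by (simp add: norm_divide)
    moreover have "y - a = of_real (norm (y - a)) *s u"
      using False by (simp add: u_def vector_smult_assoc)
    then have "y = a + of_real (norm (y - a)) *s u" by (metis add.commute diff_add_cancel)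
    ultimately show ?thesis by (intro exI[of _ "of_real (norm (y - a))"] exI[of _ u]) auto
  qed
  have in_ball: "a + \<zeta> *s v \<in> ball a r \<longleftrightarrow> cmod \<zeta> * norm v < r" for \<zeta> v r
    by (simp add: dist_norm norm_smult_cvec)
  have in_e: "a + \<zeta> *s v \<in> ball a e" if "norm v \<le> 1" "cmod \<zeta> < e" for \<zeta> v
    unfolding in_ball using mult_left_le[of "norm v" "cmod \<zeta>"] that by simp
  have line: "(\<lambda>\<zeta>. h j (a + \<zeta> *s v)) holomorphic_on ball 0 e" if "norm v \<le> 1" for j v
    by (rule holomorphic_on_complex_line[OF h]) (use that in_e in auto)
  have \<phi>: "\<phi> y \<le> C" "0 \<le> \<phi> y" if "y \<in> ball a e" for y
  proof -
    obtain \<zeta> u where u: "norm u = 1" "y = a + \<zeta> *s u" using polar by blast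
    then have z: "\<zeta> \<in> ball 0 R" using that e in_ball by auto
    then have "cmod (F u \<zeta> (cnj \<zeta>)) \<le> C" using u by (intro F3) auto
    then show "\<phi> y \<le> C" using F4[OF u(1) z] u by simp
    show "0 \<le> \<phi> y" using sums_le[OF _ sums_zero s[OF that]] by simp
  qed
  have C: "0 \<le> C" using \<phi>[of a] e by auto
  \<comment> \<open>One component is dominated by the norm of the whole family, and Calabi's
    estimate bounds the latter in terms of R. This is where the radius e of the given germ is
    replaced by R.\<close>
  have bound1: "cmod (p j k v) \<le> sqrt C / R ^ k" if v: "norm v = 1" for j k v
  proof -
    have lv: "l2 (\<lambda>j. h j (a + \<zeta> *s v)) \<and> l2sq (\<lambda>j. h j (a + \<zeta> *s v)) = \<phi> (a + \<zeta> *s v)" if "\<zeta> \<in> ball 0 e" for \<zeta>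
      unfolding l2_iff_sums using that v in_ball by (intro s) auto
    have "l2 (\<lambda>j. p j k v) \<and> l2sq (\<lambda>j. p j k v) \<le> C / R ^ k / R ^ k"
      unfolding p_def
      by (intro conjI l2_taylor_coeff_bound[OF R(1) F1[OF v] F2[OF v] F3[OF v] e])
         (use v line lv F4 e in auto)
    moreover have "(cmod (p j k v))\<^sup>2 \<le> (\<Sum>i<Suc j. (cmod (p i k v))\<^sup>2)"
      by (rule member_le_sum) auto
    ultimately have "(cmod (p j k v))\<^sup>2 \<le> C / R ^ k / R ^ k"
      using partial_l2sq_le[of "\<lambda>j. p j k v" "Suc j"] by simp
    also have "\<dots> = (sqrt C / R ^ k)\<^sup>2"
      using C by (simp add: power_divide power2_eq_square)
    finally show ?thesis
      by (rule power2_le_imp_le) (use C R in simp)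
  qed
  have p_scale: "p j k (\<zeta> *s u) = \<zeta> ^ k * p j k u" if "norm u = 1" for j k \<zeta> u
  proof -
    have "p j k (\<zeta> *s u) = taylor_coeff (\<lambda>\<xi>. h j (a + (\<zeta> * \<xi>) *s u)) k"
      by (simp add: p_def vector_smult_assoc mult.commute)
    also have "\<dots> = \<zeta> ^ k * p j k u"
      unfolding p_def using that by (intro taylor_coeff_scale[OF e(1) line]) auto
    finally show ?thesis .
  qed
  have bound: "cmod (p j k v) \<le> sqrt C * (norm v / R) ^ k" for j k v
  proof -
    obtain \<zeta> u where u: "norm u = 1" "v = \<zeta> *s u" "cmod \<zeta> = norm v" using polar[of "a + v"] by auto
    have "cmod (p j k v) = cmod \<zeta> ^ k * cmod (p j k u)"
      unfolding u(2) p_scale[OF u(1)] by (simp add: norm_mult norm_power)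
    also have "\<dots> \<le> cmod \<zeta> ^ k * (sqrt C / R ^ k)"
      using u(1) by (intro mult_left_mono bound1) auto
    finally show ?thesis unfolding u(3) by (simp add: power_divide mult.commute)
  qed
  have hol_p: "sv_holomorphic_on (p j k) (ball 0 1)" for j k
    unfolding p_def
  proof (rule sv_holomorphic_taylor_coeff[OF e(1)])
    show "(\<lambda>\<zeta>. h j (a + \<zeta> *s v)) holomorphic_on ball 0 e" if "v \<in> ball 0 1" for v
      using that by (intro line) auto
    have mem: "a + \<zeta> *s v \<in> ball a e" if "v \<in> ball 0 1" "\<zeta> \<in> ball 0 e" for v \<zeta>
      using that by (intro in_e) auto
    show "cmod (h j (a + \<zeta> *s v)) \<le> sqrt C" if "v \<in> ball 0 1" "\<zeta> \<in> ball 0 e" for v \<zeta>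
    proof -
      let ?y = "a + \<zeta> *s v"
      have y: "?y \<in> ball a e" using mem that by auto
      have "(cmod (h j ?y))\<^sup>2 \<le> (\<Sum>i<Suc j. (cmod (h i ?y))\<^sup>2)"
        by (rule member_le_sum) auto
      also have "\<dots> \<le> \<phi> ?y"
        using l2_iff_sums[THEN iffD2, OF s[OF y]] partial_l2sq_le[of "\<lambda>j. h j ?y" "Suc j"] by simp
      also have "\<dots> \<le> C" using \<phi>[OF y] by auto
      finally show ?thesis by (rule real_le_rsqrt)
    qed
    show "sv_holomorphic_on (\<lambda>v. h j (a + \<zeta> *s v)) (ball 0 1)" if "\<zeta> \<in> ball 0 e" for \<zeta>
      using mem that by (intro sv_holomorphic_on_compose_scale[OF h]) auto
  qed auto
  have hol_pa: "sv_holomorphic_on (\<lambda>y. p j k (y - a)) (ball a 1)" for j k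
    using sv_holomorphic_on_compose_scale[OF hol_p, of "ball a 1" "-a" 1]
    by (simp add: dist_norm norm_minus_commute)
  have g: "sv_holomorphic_on (g j) (ball a R)" for j
  proof (rule sv_holomorphic_on_locally)
    fix x assume x: "x \<in> ball a R"
    define r where "r = (norm (x - a) + R) / 2"
    have r: "norm (x - a) < r" "0 < r" "r < R"
      using x R by (auto simp: r_def dist_norm norm_minus_commute add_nonneg_pos)
    have ul: "uniform_limit (ball a r) (\<lambda>n y. \<Sum>k<n. p j k (y - a)) (\<lambda>y. \<Sum>k. p j k (y - a)) sequentially"
    proof (rule Weierstrass_m_test)
      fix k y assume "y \<in> ball a r"
      then have "norm (y - a) \<le> r" by (simp add: dist_norm norm_minus_commute)
      then have "sqrt C * (norm (y - a) / R) ^ k \<le> sqrt C * (r / R) ^ k"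
        using R C by (intro mult_left_mono power_mono divide_right_mono) auto
      then show "norm (p j k (y - a)) \<le> sqrt C * (r / R) ^ k"
        using bound[of j k "y - a"] by linarith
    next
      show "summable (\<lambda>k. sqrt C * (r / R) ^ k)"
        using r R by (intro summable_mult summable_geometric) auto
    qed
    have "sv_holomorphic_on (\<lambda>y. \<Sum>k<n. p j k (y - a)) (ball a r)" for n
      using r R by (intro sv_holomorphic_on_sum sv_holomorphic_on_subset[OF hol_pa]) auto
    from sv_holomorphic_on_uniform_limit[OF open_ball this ul]
    show "\<exists>T. x \<in> T \<and> sv_holomorphic_on (g j) T"
      using r by (intro exI[of _ "ball a r"]) (auto simp: g_def[abs_def] dist_norm norm_minus_commute)
  qed
  have gh: "g j y = h j y" if y: "y \<in> ball a e" for j y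
  proof -
    obtain \<zeta> u where u: "norm u = 1" "y = a + \<zeta> *s u" using polar[of y] by metis
    then have "(\<lambda>k. taylor_coeff (\<lambda>\<zeta>. h j (a + \<zeta> *s u)) k * \<zeta> ^ k) sums h j (a + \<zeta> *s u)"
      using y in_ball by (intro taylor_coeff_sums[OF line]) auto
    then have "(\<lambda>k. p j k (\<zeta> *s u)) sums h j y"
      using u(1) by (simp add: p_scale u(2)) (simp add: p_def mult.commute)
    then show ?thesis by (simp add: g_def u(2) sums_iff)
  qed
  have gs: "(\<lambda>j. (cmod (g j y))\<^sup>2) sums \<phi> y" if y: "y \<in> ball a R" for y
  proof -
    obtain \<zeta> u where u: "norm u = 1" "y = a + \<zeta> *s u" using polar[of y] by metis
    have z: "\<zeta> \<in> ball 0 R" using y u in_ball by auto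
    have lv: "l2 (\<lambda>j. g j (a + \<zeta> *s u)) \<and> l2sq (\<lambda>j. g j (a + \<zeta> *s u)) = \<phi> (a + \<zeta> *s u)" if "\<zeta> \<in> ball 0 e" for \<zeta>
      unfolding l2_iff_sums using s[of "a + \<zeta> *s u"] gh[of "a + \<zeta> *s u"] that u(1) in_ball by auto
    have gh': "(\<lambda>\<zeta>. g j (a + \<zeta> *s u)) holomorphic_on ball 0 R" for j
      by (rule holomorphic_on_complex_line[OF g]) (use u(1) in_ball in simp)
    \<comment> \<open>Holomorphy of the components says nothing about their sum of squares beyond
      radius e; the kernel on the complex line through a and y supplies it.\<close>
    note K = kernel_eq_l2sq_of_extension[where F = "F u" and g = "\<lambda>j \<zeta>. g j (a + \<zeta> *s u)",
        OF R(1) F1[OF u(1)] F2[OF u(1)] F3[OF u(1)] e gh' _ _ z]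
    have "l2 (\<lambda>j. g j (a + \<zeta> *s u)) \<and> F u \<zeta> (cnj \<zeta>) = of_real (l2sq (\<lambda>j. g j (a + \<zeta> *s u)))"
      by (intro conjI K) (use lv F4 u e in auto)
    then have "l2 (\<lambda>j. g j y) \<and> l2sq (\<lambda>j. g j y) = \<phi> y"
      using F4[OF u(1) z] u(2) by simp
    then show ?thesis by (simp add: l2_iff_sums)
  qed
  show thesis by (rule that[OF g gh gs])
qed

section \<open>Complexification of real-analytic functions and uniform extension\<close>

lemma real_analytic_at_majorant:
  fixes \<phi> :: "'e::euclidean_space \<Rightarrow> real"
  assumes "real_analytic_at \<phi> x"
  obtains r a where "0 < r"
    "(\<lambda>\<alpha>. norm (a \<alpha> * (\<Prod>b\<in>(Basis :: 'e set). r ^ \<alpha> b))) summable_on multi_indices Basis"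
    "\<forall>y. (\<forall>b\<in>Basis. \<bar>(y - x) \<bullet> b\<bar> \<le> r) \<longrightarrow>
       ((\<lambda>\<alpha>. a \<alpha> * (\<Prod>b\<in>Basis. ((y - x) \<bullet> b) ^ \<alpha> b)) has_sum \<phi> y) (multi_indices Basis)"
proof -
  let ?I = "multi_indices (Basis :: 'e set)"
  obtain r0 a where r0: "r0 > 0" and
    a: "\<And>y. y \<in> ball x r0 \<Longrightarrow> ((\<lambda>\<alpha>. a \<alpha> * (\<Prod>b\<in>Basis. ((y - x) \<bullet> b) ^ \<alpha> b)) has_sum \<phi> y) ?I"
    using assms unfolding real_analytic_at_def by blast
  \<comment> \<open>The norm is at most the sum of the absolute coordinates, so the cube of
    half-side r fits into the ball of radius r0.\<close>
  define r where "r = r0 / (2 * DIM('e))"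
  have r: "0 < r" "DIM('e) * r < r0" using r0 by (auto simp: r_def field_simps)
  have near: "y \<in> ball x r0" if "\<And>b. b \<in> Basis \<Longrightarrow> \<bar>(y - x) \<bullet> b\<bar> \<le> r" for y
  proof -
    have "norm (y - x) \<le> (\<Sum>b\<in>Basis. \<bar>(y - x) \<bullet> b\<bar>)" by (rule norm_le_l1)
    also have "\<dots> \<le> DIM('e) * r"
      using sum_bounded_above[of Basis "\<lambda>b. \<bar>(y - x) \<bullet> b\<bar>" r] that by simp
    finally show ?thesis using r by (simp add: dist_norm norm_minus_commute)
  qed
  \<comment> \<open>At this corner of the cube every monomial takes its largest absolute value.
    Unconditional convergence of a real series is absolute convergence, so one evaluation yields a
    majorant for the whole cube.\<close>
  define y1 where "y1 = x + (\<Sum>b\<in>Basis. r *\<^sub>R b)"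
  have y1: "(y1 - x) \<bullet> b = r" if "b \<in> Basis" for b
    using that by (simp add: y1_def inner_sum_left inner_Basis if_distrib cong: if_cong)
  have "((\<lambda>\<alpha>. a \<alpha> * (\<Prod>b\<in>Basis. ((y1 - x) \<bullet> b) ^ \<alpha> b)) has_sum \<phi> y1) ?I"
    using r y1 by (intro a near) auto
  then have "(\<lambda>\<alpha>. a \<alpha> * (\<Prod>b\<in>(Basis :: 'e set). r ^ \<alpha> b)) summable_on ?I"
    using y1 by (auto simp: summable_on_def cong: prod.cong)
  then have "(\<lambda>\<alpha>. norm (a \<alpha> * (\<Prod>b\<in>(Basis :: 'e set). r ^ \<alpha> b))) summable_on ?I"
    by (rule summable_on_iff_abs_summable_on_real[THEN iffD1])
  then show thesis using near a by (intro that[OF r(1)]) auto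
qed

text \<open>The majorant sums the same power series at complex coordinates, so a point of the
  complexification is a function from basis vectors to complex numbers. Holomorphy is recorded along
  complex affine lines, the form in which the one-variable estimates consume it.\<close>

lemma real_analytic_complexification:
  fixes \<phi> :: "'e::euclidean_space \<Rightarrow> real"
  assumes "real_analytic_at \<phi> x"
  obtains r C \<Phi> where "0 < r"
    "\<And>\<zeta>. (\<And>b. b \<in> Basis \<Longrightarrow> cmod (\<zeta> b) \<le> r) \<Longrightarrow> cmod (\<Phi> \<zeta>) \<le> C"
    "\<And>u v T. open T \<Longrightarrow> (\<And>t b. t \<in> T \<Longrightarrow> b \<in> Basis \<Longrightarrow> cmod (u b + t * v b) \<le> r) \<Longrightarrow>
       (\<lambda>t. \<Phi> (\<lambda>b. u b + t * v b)) holomorphic_on T"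
    "\<And>y. (\<And>b. b \<in> Basis \<Longrightarrow> \<bar>(y - x) \<bullet> b\<bar> \<le> r) \<Longrightarrow> \<Phi> (\<lambda>b. of_real ((y - x) \<bullet> b)) = complex_of_real (\<phi> y)"
proof -
  let ?I = "multi_indices (Basis :: 'e set)"
  obtain r a where r: "0 < r"
    and summ: "(\<lambda>\<alpha>. norm (a \<alpha> * (\<Prod>b\<in>(Basis :: 'e set). r ^ \<alpha> b))) summable_on ?I"
    and a: "\<forall>y. (\<forall>b\<in>Basis. \<bar>(y - x) \<bullet> b\<bar> \<le> r) \<longrightarrow>
      ((\<lambda>\<alpha>. a \<alpha> * (\<Prod>b\<in>Basis. ((y - x) \<bullet> b) ^ \<alpha> b)) has_sum \<phi> y) ?I"
    by (rule real_analytic_at_majorant[OF assms], rule that)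
  define M where "M \<alpha> = \<bar>a \<alpha>\<bar> * (\<Prod>b\<in>(Basis :: 'e set). r ^ \<alpha> b)" for \<alpha>
  have "(\<lambda>\<alpha>. norm (a \<alpha> * (\<Prod>b\<in>(Basis :: 'e set). r ^ \<alpha> b))) = M"
    using r by (simp add: M_def abs_mult prod_nonneg fun_eq_iff)
  with summ have M: "M summable_on ?I" by simp
  define mon where "mon \<alpha> \<zeta> = complex_of_real (a \<alpha>) * (\<Prod>b\<in>(Basis :: 'e set). \<zeta> b ^ \<alpha> b)" for \<alpha> \<zeta>
  define \<Phi> where "\<Phi> \<zeta> = (\<Sum>\<^sub>\<infinity>\<alpha>\<in>?I. mon \<alpha> \<zeta>)" for \<zeta>
  have tb: "norm (mon \<alpha> \<zeta>) \<le> M \<alpha>" if "\<And>b. b \<in> Basis \<Longrightarrow> cmod (\<zeta> b) \<le> r" for \<alpha> \<zeta>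
    unfolding mon_def M_def norm_mult norm_of_real prod_norm[symmetric] norm_power
    using that by (intro mult_left_mono prod_mono conjI power_mono) auto
  show thesis
  proof (rule that[OF r])
    show "cmod (\<Phi> \<zeta>) \<le> (\<Sum>\<^sub>\<infinity>\<alpha>\<in>?I. M \<alpha>)" if "\<And>b. b \<in> Basis \<Longrightarrow> cmod (\<zeta> b) \<le> r" for \<zeta>
    proof -
      have "(\<lambda>\<alpha>. norm (mon \<alpha> \<zeta>)) summable_on ?I"
        by (rule Infinite_Sum.abs_summable_on_comparison_test'[OF M]) (use tb that in auto)
      from norm_infsum_le[OF has_sum_infsum[OF abs_summable_summable[OF this]] has_sum_infsum[OF M]]
      show ?thesis unfolding \<Phi>_def using tb that by auto
    qed
    show "(\<lambda>t. \<Phi> (\<lambda>b. u b + t * v b)) holomorphic_on T"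
      if T: "open T" and uv: "\<And>t b. t \<in> T \<Longrightarrow> b \<in> Basis \<Longrightarrow> cmod (u b + t * v b) \<le> r" for u v T
    proof (rule holomorphic_onI)
      fix t assume t: "t \<in> T"
      obtain d where d: "d > 0" "cball t d \<subseteq> T" using T t open_contains_cball by blast
      have "uniform_limit (cball t d) (\<lambda>X t. \<Sum>\<alpha>\<in>X. mon \<alpha> (\<lambda>b. u b + t * v b))
          (\<lambda>t. \<Phi> (\<lambda>b. u b + t * v b)) (finite_subsets_at_top ?I)"
        unfolding \<Phi>_def using d uv by (intro Weierstrass_m_test_general[OF tb M]) auto
      then have "(\<lambda>t. \<Phi> (\<lambda>b. u b + t * v b)) holomorphic_on ball t d"
        by (rule holomorphic_uniform_limit[rotated])
           (auto simp: mon_def intro!: always_eventually continuous_intros holomorphic_intros)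
      then have "(\<lambda>t. \<Phi> (\<lambda>b. u b + t * v b)) field_differentiable at t"
        using d by (intro holomorphic_on_imp_differentiable_at[OF _ open_ball]) auto
      then show "(\<lambda>t. \<Phi> (\<lambda>b. u b + t * v b)) field_differentiable at t within T"
        by (rule field_differentiable_at_within)
    qed
    show "\<Phi> (\<lambda>b. of_real ((y - x) \<bullet> b)) = complex_of_real (\<phi> y)"
      if "\<And>b. b \<in> Basis \<Longrightarrow> \<bar>(y - x) \<bullet> b\<bar> \<le> r" for y
    proof -
      have "((\<lambda>\<alpha>. complex_of_real (a \<alpha> * (\<Prod>b\<in>Basis. ((y - x) \<bullet> b) ^ \<alpha> b))) has_sum of_real (\<phi> y)) ?I"
        by (intro has_sum_of_real a[rule_format] that)
      then show ?thesis by (simp add: \<Phi>_def mon_def infsumI)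
    qed
  qed
qed

text \<open>The order of quantifiers matters: the ball around x is fixed before the centre a, the
  radius e and the family h, so every germ of a family with sum of squares \<phi> at a point of this
  ball extends to all of it.\<close>

lemma real_analytic_local_extension:
  fixes \<phi> :: "complex^'n \<Rightarrow> real"
  assumes "real_analytic_at \<phi> x"
  obtains R where "0 < R"
    "\<And>a e h. a \<in> ball x R \<Longrightarrow> 0 < e \<Longrightarrow> (\<And>j. sv_holomorphic_on (h j) (ball a e)) \<Longrightarrow>
       (\<And>y. y \<in> ball a e \<Longrightarrow> (\<lambda>j. (cmod (h j y))\<^sup>2) sums \<phi> y) \<Longrightarrow>
       \<exists>g d. 0 < d \<and> (\<forall>j. sv_holomorphic_on (g j) (ball x R)) \<and>
         (\<forall>y\<in>ball x R. (\<lambda>j. (cmod (g j y))\<^sup>2) sums \<phi> y) \<and> (\<forall>y\<in>ball a d. \<forall>j. g j y = h j y)"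
proof (rule real_analytic_complexification[OF assms])
  fix r C :: real and \<Phi>
  assume r: "0 < r"
    and bd: "\<And>\<zeta>. (\<And>b. b \<in> Basis \<Longrightarrow> cmod (\<zeta> b) \<le> r) \<Longrightarrow> cmod (\<Phi> \<zeta>) \<le> C"
    and hol: "\<And>u v T. open T \<Longrightarrow> (\<And>t b. t \<in> T \<Longrightarrow> b \<in> Basis \<Longrightarrow> cmod (u b + t * v b) \<le> r) \<Longrightarrow>
       (\<lambda>t. \<Phi> (\<lambda>b. u b + t * v b)) holomorphic_on T"
    and diag: "\<And>y. (\<And>b. b \<in> Basis \<Longrightarrow> \<bar>(y - x) \<bullet> b\<bar> \<le> r) \<Longrightarrow>
       \<Phi> (\<lambda>b. of_real ((y - x) \<bullet> b)) = complex_of_real (\<phi> y)"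
  \<comment> \<open>The complexified coordinates below are bounded by R + 4R, where R accounts for
    the distance from x to a; this has to be at most r. The extension is made to radius 2R around a,
    which must not exceed 1.\<close>
  define R where "R = min (r / 6) (1 / 2)"
  have R: "0 < R" "2 * R \<le> 1" "6 * R \<le> r" using r by (auto simp: R_def)
  show thesis
  proof (rule that[OF R(1)])
    fix a e h
    assume a: "a \<in> ball x R" and e: "0 < (e::real)"
      and h: "\<And>j. sv_holomorphic_on (h j) (ball a e)"
      and s: "\<And>y. y \<in> ball a e \<Longrightarrow> (\<lambda>j. (cmod (h j y))\<^sup>2) sums \<phi> y"
    \<comment> \<open>The \<open>b\<close>-coordinate of \<open>\<zeta> *s v\<close> is
      \<open>Re (\<zeta> * \<beta> v b)\<close>. Writing this real part as half the sum of a number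
      and its conjugate, and replacing the conjugate of \<zeta> by a free variable \<xi>, gives the
      complexified coordinate \<open>\<zeta>'\<close>.\<close>
    define \<beta> where "\<beta> v b = Complex (v \<bullet> b) (- ((\<i> *s v) \<bullet> b))" for v b :: "complex^'n"
    define \<zeta>' where "\<zeta>' v \<zeta> \<xi> b = of_real ((a - x) \<bullet> b) + (\<zeta> * \<beta> v b + \<xi> * cnj (\<beta> v b)) / 2" for v \<zeta> \<xi> b
    have \<beta>: "cmod (\<beta> v b) \<le> 2" if "norm v = 1" "b \<in> Basis" for v b
    proof -
      have "cmod (\<beta> v b) \<le> \<bar>v \<bullet> b\<bar> + \<bar>(\<i> *s v) \<bullet> b\<bar>"
        unfolding \<beta>_def using cmod_le[of "Complex (v \<bullet> b) (- ((\<i> *s v) \<bullet> b))"] by simp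
      also have "\<dots> \<le> norm v + norm (\<i> *s v)"
        using that by (intro add_mono Basis_le_norm)
      finally show ?thesis using that by (simp add: norm_smult_cvec)
    qed
    have z': "cmod (\<zeta>' v \<zeta> \<xi> b) \<le> r" if "norm v = 1" "b \<in> Basis" "\<zeta> \<in> ball 0 (2 * R)" "\<xi> \<in> ball 0 (2 * R)" for v \<zeta> \<xi> b
    proof -
      have 1: "cmod (of_real ((a - x) \<bullet> b)) \<le> R"
        using Basis_le_norm[OF that(2), of "a - x"] a by (simp add: dist_norm norm_minus_commute)
      have "cmod (\<zeta> * \<beta> v b + \<xi> * cnj (\<beta> v b)) \<le> cmod \<zeta> * cmod (\<beta> v b) + cmod \<xi> * cmod (\<beta> v b)"
        by (metis complex_mod_cnj norm_mult norm_triangle_ineq)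
      also have "\<dots> \<le> (2 * R) * 2 + (2 * R) * 2"
        using that \<beta> R by (intro add_mono mult_mono) auto
      finally have "cmod ((\<zeta> * \<beta> v b + \<xi> * cnj (\<beta> v b)) / 2) \<le> 4 * R" by (simp add: norm_divide)
      then have "cmod (\<zeta>' v \<zeta> \<xi> b) \<le> R + 4 * R"
        unfolding \<zeta>'_def using 1 norm_triangle_mono by blast
      then show ?thesis using R by simp
    qed
    define F where "F v \<zeta> \<xi> = \<Phi> (\<zeta>' v \<zeta> \<xi>)" for v \<zeta> \<xi>
    let ?e = "min e (2 * R)"
    have dm: "F v \<zeta> (cnj \<zeta>) = of_real (\<phi> (a + \<zeta> *s v))" if v: "norm v = 1" and z: "\<zeta> \<in> ball 0 (2 * R)" for v \<zeta>
    proof -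
      have eq: "\<zeta>' v \<zeta> (cnj \<zeta>) b = of_real ((a + \<zeta> *s v - x) \<bullet> b)" for b
      proof -
        have "\<zeta> *s v = Re \<zeta> *\<^sub>R v + Im \<zeta> *\<^sub>R (\<i> *s v)"
          by (simp add: vec_eq_iff complex_eq_iff)
        then have A: "(\<zeta> *s v) \<bullet> b = Re \<zeta> * (v \<bullet> b) + Im \<zeta> * ((\<i> *s v) \<bullet> b)"
          by (simp add: inner_add_left)
        have B: "(\<zeta> * \<beta> v b + cnj \<zeta> * cnj (\<beta> v b)) / 2 = of_real (Re (\<zeta> * \<beta> v b))"
          by (simp add: complex_eq_iff)
        have C: "Re (\<zeta> * \<beta> v b) = Re \<zeta> * (v \<bullet> b) + Im \<zeta> * ((\<i> *s v) \<bullet> b)"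
          by (simp add: \<beta>_def)
        show ?thesis
          unfolding \<zeta>'_def B C of_real_add[symmetric] by (simp add: inner_add_left inner_diff_left A)
      qed
      have "cmod (\<zeta>' v \<zeta> (cnj \<zeta>) b) \<le> r" if "b \<in> Basis" for b
        using z' v z that by auto
      then have "\<bar>(a + \<zeta> *s v - x) \<bullet> b\<bar> \<le> r" if "b \<in> Basis" for b
        using that unfolding eq by simp
      from diag[OF this] show ?thesis unfolding F_def eq[abs_def] by simp
    qed
    obtain g where g: "\<And>j. sv_holomorphic_on (g j) (ball a (2 * R))" "\<And>j y. y \<in> ball a ?e \<Longrightarrow> g j y = h j y"
      "\<And>y. y \<in> ball a (2 * R) \<Longrightarrow> (\<lambda>j. (cmod (g j y))\<^sup>2) sums \<phi> y"
    proof (rule sv_holomorphic_extension_of_kernel[where F = F and R = "2 * R" and e = ?e and C = C and a = a and \<phi> = \<phi> and h = h])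
      show "(\<lambda>\<zeta>. F v \<zeta> \<xi>) holomorphic_on ball 0 (2 * R)" if "norm v = 1" "\<xi> \<in> ball 0 (2 * R)" for v \<xi>
        using hol[of "ball 0 (2 * R)" "\<lambda>b. of_real ((a - x) \<bullet> b) + \<xi> * cnj (\<beta> v b) / 2" "\<lambda>b. \<beta> v b / 2"] z'[OF that(1) _ _ that(2)]
        by (simp add: F_def \<zeta>'_def[abs_def] add_divide_distrib add_ac)
      show "F v \<zeta> holomorphic_on ball 0 (2 * R)" if "norm v = 1" "\<zeta> \<in> ball 0 (2 * R)" for v \<zeta>
        using hol[of "ball 0 (2 * R)" "\<lambda>b. of_real ((a - x) \<bullet> b) + \<zeta> * \<beta> v b / 2" "\<lambda>b. cnj (\<beta> v b) / 2"] z'[OF that(1) _ that(2)]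
        by (simp add: F_def[abs_def] \<zeta>'_def[abs_def] add_divide_distrib add_ac)
      show "cmod (F v \<zeta> \<xi>) \<le> C" if "norm v = 1" "\<zeta> \<in> ball 0 (2 * R)" "\<xi> \<in> ball 0 (2 * R)" for v \<zeta> \<xi>
        unfolding F_def using z' that by (intro bd) auto
      show "sv_holomorphic_on (h j) (ball a ?e)" for j
        using h by (rule sv_holomorphic_on_subset) auto
    qed (use R e s dm in auto)
    \<comment> \<open>The reason for doubling the radius: the extension around any a within R of x
      reaches the whole ball around x.\<close>
    have sub: "ball x R \<subseteq> ball a (2 * R)"
    proof
      fix y assume "y \<in> ball x R"
      then show "y \<in> ball a (2 * R)" using a dist_triangle[of a y x] by (simp add: dist_commute)
    qed
    show "\<exists>g d. 0 < d \<and> (\<forall>j. sv_holomorphic_on (g j) (ball x R)) \<and>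
         (\<forall>y\<in>ball x R. (\<lambda>j. (cmod (g j y))\<^sup>2) sums \<phi> y) \<and> (\<forall>y\<in>ball a d. \<forall>j. g j y = h j y)"
      using g sub R e by (intro exI[of _ g] exI[of _ ?e]) (auto intro: sv_holomorphic_on_subset)
  qed
qed

section \<open>Power series of bounded separately holomorphic functions\<close>

lemma has_sum_multi_indices_insert:
  assumes "b0 \<notin> S"
  shows "(f has_sum s) (multi_indices (insert b0 S)) \<longleftrightarrow>
    ((\<lambda>(k, \<beta>). f (\<beta>(b0 := k))) has_sum s) (UNIV \<times> multi_indices S)"
proof -
  have "bij_betw (\<lambda>(k, \<beta>). \<beta>(b0 := k)) (UNIV \<times> multi_indices S) (multi_indices (insert b0 S))"
  proof (rule bij_betw_byWitness[where f' = "\<lambda>\<alpha>. (\<alpha> b0, \<alpha>(b0 := 0))"])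
    show "\<forall>x\<in>UNIV \<times> multi_indices S. (\<lambda>\<alpha>. (\<alpha> b0, \<alpha>(b0 := 0))) (case x of (k, \<beta>) \<Rightarrow> \<beta>(b0 := k)) = x"
      using assms by (auto simp: fun_eq_iff)
  qed (use assms in \<open>auto simp: fun_eq_iff\<close>)
  from has_sum_reindex_bij_betw[OF this, of f s] show ?thesis
    by (simp add: case_prod_unfold)
qed

lemma prod_fun_upd_other:
  assumes "b0 \<notin> S" "finite S"
  shows "(\<Prod>b\<in>insert b0 S. z b ^ (\<beta>(b0 := k)) b) = z b0 ^ k * (\<Prod>b\<in>S. z b ^ \<beta> b)"
proof -
  have "(\<Prod>b\<in>S. z b ^ (\<beta>(b0 := k)) b) = (\<Prod>b\<in>S. z b ^ \<beta> b)"
    using assms by (intro prod.cong) auto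
  then show ?thesis using assms by (simp del: fun_upd_apply) simp
qed

lemma has_sum_multi_geometric:
  fixes q :: "'b \<Rightarrow> real"
  assumes "finite S" "\<And>b. b \<in> S \<Longrightarrow> 0 \<le> q b \<and> q b < 1"
  shows "\<exists>G. ((\<lambda>\<alpha>. \<Prod>b\<in>S. q b ^ \<alpha> b) has_sum G) (multi_indices S)"
  using assms
proof (induction S)
  case empty
  have "multi_indices ({} :: 'b set) = {\<lambda>_. 0}" by auto
  then show ?case by (intro exI[of _ 1] has_sum_finiteI) auto
next
  case (insert b0 S)
  then obtain G where G: "((\<lambda>\<alpha>. \<Prod>b\<in>S. q b ^ \<alpha> b) has_sum G) (multi_indices S)" by auto
  have q0: "0 \<le> q b0" "q b0 < 1" using insert.prems by auto
  let ?f = "\<lambda>(k, \<beta>). \<Prod>b\<in>insert b0 S. q b ^ (\<beta>(b0 := k)) b"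
  have f: "?f (k, \<beta>) = q b0 ^ k * (\<Prod>b\<in>S. q b ^ \<beta> b)" for k \<beta>
    unfolding prod.case by (rule prod_fun_upd_other) (use insert in auto)
  have "?f summable_on UNIV \<times> multi_indices S"
  proof (rule summable_on_SigmaI)
    show "((\<lambda>\<beta>. ?f (k, \<beta>)) has_sum q b0 ^ k * G) (multi_indices S)" for k
      unfolding f by (intro has_sum_cmult_right G)
    have "summable (\<lambda>k. norm (q b0 ^ k * G))"
      unfolding norm_mult norm_power using q0 by (intro summable_mult2 summable_geometric) auto
    then show "(\<lambda>k. q b0 ^ k * G) summable_on UNIV"
      by (rule norm_summable_imp_summable_on)
    show "0 \<le> ?f (k, \<beta>)" for k \<beta>
      unfolding prod.case using insert.prems
      by (intro prod_nonneg zero_le_power ballI) auto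
  qed
  then show ?case
    unfolding has_sum_multi_indices_insert[OF insert.hyps(2)] summable_on_def .
qed


text \<open>Induction over the variables: the Taylor coefficients in the new variable are again
  bounded and separately holomorphic in the others, with \<open>M / R ^ k\<close> as the new bound.
  The coefficient bound is part of the induction because it makes the resulting multiple series
  absolutely convergent.\<close>

lemma separately_holomorphic_multi_power_series:
  fixes \<Phi> :: "('b \<Rightarrow> complex) \<Rightarrow> complex"
  assumes "finite S" and R: "0 < R"
    and bd: "\<And>z. (\<And>b. cmod (z b) < R) \<Longrightarrow> cmod (\<Phi> z) \<le> M"
    and hol: "\<And>z b. (\<And>b. cmod (z b) < R) \<Longrightarrow> b \<in> S \<Longrightarrow> (\<lambda>\<eta>. \<Phi> (z(b := \<eta>))) holomorphic_on ball 0 R"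
  shows "\<exists>a. (\<forall>\<alpha>. cmod (a \<alpha>) \<le> M / R ^ (\<Sum>b\<in>S. \<alpha> b)) \<and>
    (\<forall>z. (\<forall>b. cmod (z b) < R) \<longrightarrow> (\<forall>b. b \<notin> S \<longrightarrow> z b = 0) \<longrightarrow>
       ((\<lambda>\<alpha>. a \<alpha> * (\<Prod>b\<in>S. z b ^ \<alpha> b)) has_sum \<Phi> z) (multi_indices S))"
  using assms(1) bd hol
proof (induction S arbitrary: \<Phi> M)
  case empty
  have mi: "multi_indices ({} :: 'b set) = {\<lambda>_. 0}" by auto
  have b: "cmod (\<Phi> (\<lambda>_. 0)) \<le> M" using R by (intro empty(1)) simp
  have "((\<lambda>\<alpha>. \<Phi> (\<lambda>_. 0) * (\<Prod>b\<in>{}. z b ^ \<alpha> b)) has_sum \<Phi> z) (multi_indices {})"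
    if z: "\<forall>b. b \<notin> {} \<longrightarrow> z b = 0" for z :: "'b \<Rightarrow> complex"
  proof -
    have "z = (\<lambda>_. 0)" using z by auto
    then show ?thesis unfolding mi by (intro has_sum_finiteI) auto
  qed
  with b show ?case
    by (intro exI[of _ "\<lambda>_. \<Phi> (\<lambda>_. 0)"] conjI allI impI) simp_all
next
  case (insert b0 S)
  define c where "c k z = taylor_coeff (\<lambda>\<eta>. \<Phi> (z(b0 := \<eta>))) k" for k z
  have upd: "cmod ((z(b := \<eta>)) b') < R" if "\<And>b. cmod (z b) < R" "\<eta> \<in> ball 0 R" for z b \<eta> b'
    using that by auto
  have hol0: "(\<lambda>\<eta>. \<Phi> (z(b0 := \<eta>))) holomorphic_on ball 0 R" if "\<And>b. cmod (z b) < R" for z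
    by (rule insert.prems(2)) (use that in auto)
  have bd0: "cmod (\<Phi> (z(b0 := \<eta>))) \<le> M" if "\<And>b. cmod (z b) < R" "\<eta> \<in> ball 0 R" for z \<eta>
    by (rule insert.prems(1), rule upd) (use that in auto)
  define Q where "Q k a \<longleftrightarrow> (\<forall>\<alpha>. cmod (a \<alpha>) \<le> M / R ^ k / R ^ (\<Sum>b\<in>S. \<alpha> b)) \<and>
    (\<forall>z. (\<forall>b. cmod (z b) < R) \<longrightarrow> (\<forall>b. b \<notin> S \<longrightarrow> z b = 0) \<longrightarrow>
       ((\<lambda>\<alpha>. a \<alpha> * (\<Prod>b\<in>S. z b ^ \<alpha> b)) has_sum c k z) (multi_indices S))" for k a
  have "\<exists>a. Q k a" for k
    unfolding Q_def
  proof (rule insert.IH)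
    show "cmod (c k z) \<le> M / R ^ k" if "\<And>b. cmod (z b) < R" for z
      unfolding c_def by (rule taylor_coeff_bound[OF hol0 R bd0]) (use that in auto)
    show "(\<lambda>\<eta>. c k (z(b := \<eta>))) holomorphic_on ball 0 R" if z: "\<And>b. cmod (z b) < R" and b: "b \<in> S" for z b
      unfolding c_def
    proof (rule holomorphic_taylor_coeff[OF R])
      show "(\<lambda>\<zeta>. \<Phi> (z(b := \<xi>, b0 := \<zeta>))) holomorphic_on ball 0 R" if "\<xi> \<in> ball 0 R" for \<xi>
        by (rule hol0, rule upd) (use z that in auto)
      show "(\<lambda>\<xi>. \<Phi> (z(b := \<xi>, b0 := \<zeta>))) holomorphic_on ball 0 R" if "\<zeta> \<in> ball 0 R" for \<zeta>
      proof -
        have "b \<noteq> b0" using b insert.hyps by auto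
        then have "(\<lambda>\<xi>. \<Phi> (z(b := \<xi>, b0 := \<zeta>))) = (\<lambda>\<xi>. \<Phi> (z(b0 := \<zeta>, b := \<xi>)))"
          by (simp add: fun_upd_twist)
        moreover have "(\<lambda>\<xi>. \<Phi> (z(b0 := \<zeta>, b := \<xi>))) holomorphic_on ball 0 R"
          by (rule insert.prems(2), rule upd) (use z that b in auto)
        ultimately show ?thesis by simp
      qed
      show "cmod (\<Phi> (z(b := \<xi>, b0 := \<zeta>))) \<le> M" if "\<zeta> \<in> ball 0 R" "\<xi> \<in> ball 0 R" for \<zeta> \<xi>
        by (rule bd0, rule upd) (use z that in auto)
    qed auto
  qed
  then obtain a where a: "\<And>k. Q k (a k)" by metis
  have a1: "cmod (a k \<alpha>) \<le> M / R ^ k / R ^ (\<Sum>b\<in>S. \<alpha> b)" for k \<alpha>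
    using a[of k] by (simp add: Q_def)
  have a2: "((\<lambda>\<alpha>. a k \<alpha> * (\<Prod>b\<in>S. z b ^ \<alpha> b)) has_sum c k z) (multi_indices S)"
    if "\<And>b. cmod (z b) < R" "\<And>b. b \<notin> S \<Longrightarrow> z b = 0" for k z
    using a[of k] that by (simp add: Q_def)
  have M: "0 \<le> M" using insert.prems(1)[of "\<lambda>_. 0"] R by (force intro: order_trans[OF norm_ge_zero])
  \<comment> \<open>The exponent of the new variable selects the coefficient family; resetting it to
    0 leaves a multi-index in the old variables.\<close>
  define a' where "a' \<alpha> = a (\<alpha> b0) (\<alpha>(b0 := 0))" for \<alpha>
  have a'b: "cmod (a' \<alpha>) \<le> M / R ^ (\<Sum>b\<in>insert b0 S. \<alpha> b)" for \<alpha>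
  proof -
    have "(\<Sum>b\<in>S. (\<alpha>(b0 := 0)) b) = (\<Sum>b\<in>S. \<alpha> b)"
      using insert.hyps by (intro sum.cong) auto
    then have "cmod (a' \<alpha>) \<le> M / R ^ \<alpha> b0 / R ^ (\<Sum>b\<in>S. \<alpha> b)"
      unfolding a'_def using a1[of "\<alpha> b0" "\<alpha>(b0 := 0)"] by simp
    also have "\<dots> = M / R ^ (\<Sum>b\<in>insert b0 S. \<alpha> b)"
      using insert.hyps by (simp add: power_add)
    finally show ?thesis .
  qed
  have "((\<lambda>\<alpha>. a' \<alpha> * (\<Prod>b\<in>insert b0 S. z b ^ \<alpha> b)) has_sum \<Phi> z) (multi_indices (insert b0 S))"
    if z: "\<And>b. cmod (z b) < R" and z0: "\<And>b. b \<notin> insert b0 S \<Longrightarrow> z b = 0" for z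
  proof -
    define z' where "z' = z(b0 := 0)"
    have z': "\<And>b. cmod (z' b) < R" "\<And>b. b \<notin> S \<Longrightarrow> z' b = 0"
      using z z0 R by (auto simp: z'_def)
    let ?f = "\<lambda>(k, \<beta>). a' (\<beta>(b0 := k)) * (\<Prod>b\<in>insert b0 S. z b ^ (\<beta>(b0 := k)) b)"
    have f: "?f (k, \<beta>) = z b0 ^ k * (a k \<beta> * (\<Prod>b\<in>S. z' b ^ \<beta> b))" if "\<beta> \<in> multi_indices S" for k \<beta>
    proof -
      have "a' (\<beta>(b0 := k)) = a k \<beta>"
        using that insert.hyps by (simp add: a'_def fun_upd_idem)
      moreover have "(\<Prod>b\<in>S. z b ^ \<beta> b) = (\<Prod>b\<in>S. z' b ^ \<beta> b)"
        using insert.hyps by (intro prod.cong) (auto simp: z'_def)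
      ultimately show ?thesis
        unfolding prod.case prod_fun_upd_other[OF insert.hyps(2,1)] by simp
    qed
    \<comment> \<open>Cauchy's bounds compare the terms with a product of geometric series. This
      absolute summability allows the iterated expansion to be read as one unordered sum.\<close>
    have summ: "?f summable_on UNIV \<times> multi_indices S"
    proof -
      define q where "q b = cmod (z b) / R" for b
      have "\<exists>G. ((\<lambda>\<alpha>. \<Prod>b\<in>insert b0 S. q b ^ \<alpha> b) has_sum G) (multi_indices (insert b0 S))"
        using insert.hyps z R by (intro has_sum_multi_geometric) (auto simp: q_def)
      then have "(\<lambda>(k, \<beta>). \<Prod>b\<in>insert b0 S. q b ^ (\<beta>(b0 := k)) b) summable_on UNIV \<times> multi_indices S"
        unfolding has_sum_multi_indices_insert[OF insert.hyps(2)] summable_on_def .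
      then have "(\<lambda>x. M * (case x of (k, \<beta>) \<Rightarrow> \<Prod>b\<in>insert b0 S. q b ^ (\<beta>(b0 := k)) b)) summable_on UNIV \<times> multi_indices S"
        by (rule summable_on_cmult_right)
      then have "(\<lambda>x. norm (?f x)) summable_on UNIV \<times> multi_indices S"
      proof (rule Infinite_Sum.abs_summable_on_comparison_test')
        fix x :: "nat \<times> ('b \<Rightarrow> nat)"
        obtain k \<beta> where x: "x = (k, \<beta>)" by force
        let ?\<alpha> = "\<beta>(b0 := k)"
        have "norm (?f x) = cmod (a' ?\<alpha>) * (\<Prod>b\<in>insert b0 S. cmod (z b) ^ ?\<alpha> b)"
          unfolding x prod.case norm_mult prod_norm[symmetric] norm_power ..
        also have "\<dots> \<le> M / R ^ (\<Sum>b\<in>insert b0 S. ?\<alpha> b) * (\<Prod>b\<in>insert b0 S. cmod (z b) ^ ?\<alpha> b)"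
          by (intro mult_right_mono a'b prod_nonneg) auto
        also have "\<dots> = M * (\<Prod>b\<in>insert b0 S. q b ^ ?\<alpha> b)"
          unfolding q_def power_divide prod_dividef power_sum by simp
        finally show "norm (?f x) \<le> M * (case x of (k, \<beta>) \<Rightarrow> \<Prod>b\<in>insert b0 S. q b ^ (\<beta>(b0 := k)) b)"
          unfolding x prod.case .
      qed
      then show ?thesis by (rule abs_summable_summable)
    qed
    have "(?f has_sum \<Phi> z) (UNIV \<times> multi_indices S)"
    proof (rule has_sum_SigmaI[OF _ _ summ])
      fix k :: nat
      have "((\<lambda>\<beta>. z b0 ^ k * (a k \<beta> * (\<Prod>b\<in>S. z' b ^ \<beta> b))) has_sum z b0 ^ k * c k z') (multi_indices S)"
        by (intro has_sum_cmult_right a2 z')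
      then show "((\<lambda>\<beta>. ?f (k, \<beta>)) has_sum z b0 ^ k * c k z') (multi_indices S)"
        by (rule has_sum_cong[THEN iffD1, rotated]) (use f in auto)
    next
      have cz: "c k z' = c k z" for k by (simp add: c_def z'_def)
      have zb: "z b0 \<in> ball 0 R" using z by simp
      have "(\<lambda>k. taylor_coeff (\<lambda>\<eta>. \<Phi> (z(b0 := \<eta>))) k * z b0 ^ k) sums \<Phi> (z(b0 := z b0))"
        by (rule taylor_coeff_sums[OF hol0[OF z] zb])
      then have s: "(\<lambda>k. z b0 ^ k * c k z') sums \<Phi> z"
        unfolding cz by (simp add: c_def mult.commute)
      have "summable (\<lambda>k. norm (z b0 ^ k * c k z'))"
      proof (rule summable_comparison_test')
        show "summable (\<lambda>k. M * (cmod (z b0) / R) ^ k)"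
          using z[of b0] R by (intro summable_mult summable_geometric) auto
        fix k :: nat
        have "cmod (c k z) \<le> M / R ^ k"
          unfolding c_def by (rule taylor_coeff_bound[OF hol0 R bd0]) (use z in auto)
        then have "cmod (z b0) ^ k * cmod (c k z) \<le> cmod (z b0) ^ k * (M / R ^ k)"
          by (intro mult_left_mono) auto
        then show "norm (norm (z b0 ^ k * c k z')) \<le> M * (cmod (z b0) / R) ^ k"
          unfolding cz by (simp add: norm_mult norm_power power_divide mult.commute)
      qed
      then show "((\<lambda>k. z b0 ^ k * c k z') has_sum \<Phi> z) UNIV"
        using s by (rule norm_summable_imp_has_sum)
    qed
    then show ?thesis
      unfolding has_sum_multi_indices_insert[OF insert.hyps(2)] by (simp only: case_prod_unfold)
  qed
  then show ?case using a'b by (intro exI[of _ a']) blast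
qed

text \<open>The map \<open>pt\<close> combines all real basis vectors with complex coefficients. The
  product of g at \<open>pt z\<close> with the conjugate of g at \<open>pt\<close> of the conjugate
  coefficients is bounded and separately holomorphic, and for the real coordinates of a point it
  equals the squared modulus of g there.\<close>

lemma real_analytic_at_cmod_power2:
  fixes g :: "complex^'n \<Rightarrow> complex"
  assumes g: "sv_holomorphic_on g S" and S: "open S" "x \<in> S"
  shows "real_analytic_at (\<lambda>y. (cmod (g y))\<^sup>2) x"
proof -
  let ?B = "Basis :: (complex^'n) set"
  obtain r where r: "0 < r" "cball x r \<subseteq> S" using S open_contains_cball by blast
  have "compact (g ` cball x r)"
    using sv_holomorphic_on_imp_continuous_on[OF sv_holomorphic_on_subset[OF g r(2)]]
    by (intro compact_continuous_image) auto
  then obtain B where "\<forall>w\<in>g ` cball x r. cmod w \<le> B"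
    using compact_imp_bounded bounded_iff by blast
  then have B: "\<And>y. y \<in> cball x r \<Longrightarrow> cmod (g y) \<le> B" by blast
  define R where "R = r / DIM(complex^'n)"
  have R: "0 < R" using r by (simp add: R_def)
  define pt where "pt z = x + (\<Sum>b\<in>?B. z b *s b)" for z
  have pt: "pt z \<in> cball x r" if "\<And>b. cmod (z b) < R" for z
  proof -
    have "norm (\<Sum>b\<in>?B. z b *s b) \<le> (\<Sum>b\<in>?B. R)"
      by (rule sum_norm_le) (use that in \<open>auto simp: norm_smult_cvec less_imp_le\<close>)
    also have "\<dots> = r" by (simp add: R_def)
    finally show ?thesis by (simp add: pt_def dist_norm)
  qed
  have pt_upd: "pt (z(b := \<eta>)) = pt (z(b := 0)) + \<eta> *s b" if "b \<in> ?B" for z b \<eta>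
  proof -
    have "(\<Sum>b'\<in>?B. (z(b := w)) b' *s b') = w *s b + (\<Sum>b'\<in>?B - {b}. z b' *s b')" for w
      using that by (subst sum.remove[of _ b]) (auto intro!: sum.cong)
    from this[of \<eta>] this[of 0] show ?thesis by (simp add: pt_def)
  qed
  define \<Phi> where "\<Phi> z = g (pt z) * cnj (g (pt (\<lambda>b. cnj (z b))))" for z
  have "\<exists>a. (\<forall>\<alpha>. cmod (a \<alpha>) \<le> B * B / R ^ (\<Sum>b\<in>?B. \<alpha> b)) \<and>
    (\<forall>z. (\<forall>b. cmod (z b) < R) \<longrightarrow> (\<forall>b. b \<notin> ?B \<longrightarrow> z b = 0) \<longrightarrow>
       ((\<lambda>\<alpha>. a \<alpha> * (\<Prod>b\<in>?B. z b ^ \<alpha> b)) has_sum \<Phi> z) (multi_indices ?B))"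
  proof (rule separately_holomorphic_multi_power_series[OF _ R])
    fix z :: "complex^'n \<Rightarrow> complex" assume z: "\<And>b. cmod (z b) < R"
    have "cmod (g (pt z)) * cmod (g (pt (\<lambda>b. cnj (z b)))) \<le> B * B"
      using z by (intro mult_mono B pt) (auto intro: order_trans[OF norm_ge_zero B[OF pt[OF z]]])
    then show "cmod (\<Phi> z) \<le> B * B" by (simp add: \<Phi>_def norm_mult)
    fix b assume b: "b \<in> ?B"
    have line: "(\<lambda>\<eta>. g (pt (w(b := 0)) + \<eta> *s b)) holomorphic_on ball 0 R" if w: "\<And>b. cmod (w b) < R" for w
    proof (rule holomorphic_on_complex_line[OF g])
      fix \<eta> :: complex assume "\<eta> \<in> ball 0 R"
      then have "pt (w(b := \<eta>)) \<in> cball x r" using w by (intro pt) auto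
      then show "pt (w(b := 0)) + \<eta> *s b \<in> S"
        unfolding pt_upd[OF b, of w \<eta>] using r(2) by blast
    qed
    have "(\<lambda>\<eta>. g (pt (z(b := 0)) + \<eta> *s b) * cnj (g (pt ((\<lambda>b. cnj (z b))(b := 0)) + cnj \<eta> *s b)))
        holomorphic_on ball 0 R"
    proof (intro holomorphic_on_mult)
      show "(\<lambda>\<eta>. g (pt (z(b := 0)) + \<eta> *s b)) holomorphic_on ball 0 R"
        using z by (rule line)
      show "(\<lambda>\<eta>. cnj (g (pt ((\<lambda>b. cnj (z b))(b := 0)) + cnj \<eta> *s b))) holomorphic_on ball 0 R"
        by (rule taylor_coeff_cnj(1)[OF R line]) (use z in simp)
    qed
    moreover have "(\<lambda>\<eta>. \<Phi> (z(b := \<eta>))) = (\<lambda>\<eta>. g (pt (z(b := 0)) + \<eta> *s b) * cnj (g (pt ((\<lambda>b. cnj (z b))(b := 0)) + cnj \<eta> *s b)))"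
    proof
      fix \<eta>
      have "(\<lambda>b'. cnj ((z(b := \<eta>)) b')) = (\<lambda>b. cnj (z b))(b := cnj \<eta>)" by auto
      then show "\<Phi> (z(b := \<eta>)) = g (pt (z(b := 0)) + \<eta> *s b) * cnj (g (pt ((\<lambda>b. cnj (z b))(b := 0)) + cnj \<eta> *s b))"
        unfolding \<Phi>_def by (simp only: pt_upd[OF b, of z \<eta>] pt_upd[OF b, of "\<lambda>b. cnj (z b)" "cnj \<eta>"])
    qed
    ultimately show "(\<lambda>\<eta>. \<Phi> (z(b := \<eta>))) holomorphic_on ball 0 R" by simp
  qed auto
  then obtain a where a: "\<forall>z. (\<forall>b. cmod (z b) < R) \<longrightarrow> (\<forall>b. b \<notin> ?B \<longrightarrow> z b = 0) \<longrightarrow>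
       ((\<lambda>\<alpha>. a \<alpha> * (\<Prod>b\<in>?B. z b ^ \<alpha> b)) has_sum \<Phi> z) (multi_indices ?B)"
    by (elim exE conjE) (rule that)
  have "((\<lambda>\<alpha>. Re (a \<alpha>) * (\<Prod>b\<in>?B. ((y - x) \<bullet> b) ^ \<alpha> b)) has_sum (cmod (g y))\<^sup>2) (multi_indices ?B)"
    if y: "y \<in> ball x R" for y
  proof -
    define z where "z b = (if b \<in> ?B then complex_of_real ((y - x) \<bullet> b) else 0)" for b
    have "cmod (z b) < R" for b
      using y R Basis_le_norm[of b "y - x"] by (auto simp: z_def dist_norm norm_minus_commute)
    then have "((\<lambda>\<alpha>. a \<alpha> * (\<Prod>b\<in>?B. z b ^ \<alpha> b)) has_sum \<Phi> z) (multi_indices ?B)"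
      by (intro a[rule_format]) (simp_all add: z_def)
    \<comment> \<open>The monomials are real at real points, so the real parts of the coefficients
      form a real power series with the required sum.\<close>
    then have "((\<lambda>\<alpha>. Re (a \<alpha> * (\<Prod>b\<in>?B. z b ^ \<alpha> b))) has_sum Re (\<Phi> z)) (multi_indices ?B)"
      by (rule has_sum_Re)
    moreover have "Re (a \<alpha> * (\<Prod>b\<in>?B. z b ^ \<alpha> b)) = Re (a \<alpha>) * (\<Prod>b\<in>?B. ((y - x) \<bullet> b) ^ \<alpha> b)" for \<alpha>
    proof -
      have "(\<Prod>b\<in>?B. z b ^ \<alpha> b) = of_real (\<Prod>b\<in>?B. ((y - x) \<bullet> b) ^ \<alpha> b)"
        by (simp add: z_def)
      then show ?thesis
        by (simp only: times_complex.sel Re_complex_of_real Im_complex_of_real mult_zero_right diff_zero)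
    qed
    moreover have "Re (\<Phi> z) = (cmod (g y))\<^sup>2"
    proof -
      have "(\<Sum>b\<in>?B. z b *s b) = (\<Sum>b\<in>?B. ((y - x) \<bullet> b) *\<^sub>R b)"
        by (intro sum.cong) (auto simp: z_def smult_cvec_scaleR)
      then have "pt z = y" by (simp add: pt_def euclidean_representation)
      moreover have "(\<lambda>b. cnj (z b)) = z" by (auto simp: z_def)
      ultimately have "\<Phi> z = of_real ((cmod (g y))\<^sup>2)" by (simp only: \<Phi>_def complex_norm_square)
      then show ?thesis by simp
    qed
    ultimately show ?thesis by simp
  qed
  then show ?thesis
    unfolding real_analytic_at_def using R by (intro exI[of _ R] conjI exI[of _ "\<lambda>\<alpha>. Re (a \<alpha>)"]) auto
qed

lemma has_derivative_vec_componentwise: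
  fixes f :: "'a::real_normed_vector \<Rightarrow> complex^'n"
  assumes "\<And>i. ((\<lambda>x. f x $ i) has_derivative (\<lambda>h. L h $ i)) (at x)"
  shows "(f has_derivative L) (at x)"
proof (subst has_derivative_componentwise_within, rule ballI)
  fix b :: "complex^'n" assume "b \<in> Basis"
  then obtain i u where b: "b = axis i u" by (auto simp: Basis_vec_def)
  show "((\<lambda>x. f x \<bullet> b) has_derivative (\<lambda>h. L h \<bullet> b)) (at x)"
    unfolding b inner_axis using assms by (intro has_derivative_inner_left)
qed

text \<open>The majorant makes the finite partial sums converge uniformly. Applied to \<rho>, this
  continuity supplies local bounds on sums of squares and the continuous limit for Dini's
  theorem.\<close>

lemma real_analytic_at_imp_isCont:
  fixes \<phi> :: "'e::euclidean_space \<Rightarrow> real"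
  assumes "real_analytic_at \<phi> x"
  shows "isCont \<phi> x"
proof -
  let ?I = "multi_indices (Basis :: 'e set)"
  obtain r a where r: "0 < r"
    and M: "(\<lambda>\<alpha>. norm (a \<alpha> * (\<Prod>b\<in>(Basis :: 'e set). r ^ \<alpha> b))) summable_on ?I"
    and a: "\<forall>y. (\<forall>b\<in>Basis. \<bar>(y - x) \<bullet> b\<bar> \<le> r) \<longrightarrow>
      ((\<lambda>\<alpha>. a \<alpha> * (\<Prod>b\<in>Basis. ((y - x) \<bullet> b) ^ \<alpha> b)) has_sum \<phi> y) ?I"
    by (rule real_analytic_at_majorant[OF assms], rule that)
  have coord: "\<bar>(y - x) \<bullet> b\<bar> \<le> r" if "y \<in> ball x r" "b \<in> Basis" for y b
    using Basis_le_norm[OF that(2), of "y - x"] that(1) by (simp add: dist_norm norm_minus_commute)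
  have "uniform_limit (ball x r) (\<lambda>X y. \<Sum>\<alpha>\<in>X. a \<alpha> * (\<Prod>b\<in>Basis. ((y - x) \<bullet> b) ^ \<alpha> b)) \<phi>
      (finite_subsets_at_top ?I)"
  proof (rule Weierstrass_m_test_general'[OF _ _ M])
    fix \<alpha> y assume "y \<in> ball x r"
    then have "(\<Prod>b\<in>Basis. \<bar>(y - x) \<bullet> b\<bar> ^ \<alpha> b) \<le> (\<Prod>b\<in>(Basis :: 'e set). r ^ \<alpha> b)"
      using coord by (intro prod_mono conjI power_mono) auto
    then show "norm (a \<alpha> * (\<Prod>b\<in>Basis. ((y - x) \<bullet> b) ^ \<alpha> b)) \<le> norm (a \<alpha> * (\<Prod>b\<in>(Basis :: 'e set). r ^ \<alpha> b))"
      using r by (simp add: abs_mult abs_prod power_abs mult_left_mono)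
  qed (use a coord in auto)
  then have "continuous_on (ball x r) \<phi>"
    by (rule uniform_limit_theorem[rotated]) (auto intro!: always_eventually continuous_intros)
  then show ?thesis
    using r continuous_on_eq_continuous_at[of "ball x r" \<phi>] by simp
qed

section \<open>Identity theorems on complex manifolds\<close>

locale cmanifold =
  fixes A :: "('m::{t2_space, second_countable_topology}, 'n::finite) chart set"
  assumes cm: "complex_manifold A"
begin

abbreviation hol_on :: "('m \<Rightarrow> complex) \<Rightarrow> 'm set \<Rightarrow> bool" where
  "hol_on \<equiv> mf_holomorphic_on A"

lemma chart:
  assumes "\<kappa> \<in> A"
  shows "open (fst \<kappa>)" "open (snd \<kappa> ` fst \<kappa>)" "continuous_on (fst \<kappa>) (snd \<kappa>)"
    "continuous_on (snd \<kappa> ` fst \<kappa>) (chart_inv \<kappa>)"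
    "\<And>p. p \<in> fst \<kappa> \<Longrightarrow> chart_inv \<kappa> (snd \<kappa> p) = p"
    "\<And>x. x \<in> snd \<kappa> ` fst \<kappa> \<Longrightarrow> chart_inv \<kappa> x \<in> fst \<kappa> \<and> snd \<kappa> (chart_inv \<kappa> x) = x"
proof -
  have c: "is_chart \<kappa>" using cm assms by (auto simp: complex_manifold_def)
  then have h: "homeomorphism (fst \<kappa>) (snd \<kappa> ` fst \<kappa>) (snd \<kappa>) (chart_inv \<kappa>)"
    and o: "open (fst \<kappa>)" "open (snd \<kappa> ` fst \<kappa>)" by (auto simp: is_chart_def)
  show "open (fst \<kappa>)" "open (snd \<kappa> ` fst \<kappa>)" by fact+
  show "continuous_on (fst \<kappa>) (snd \<kappa>)" "continuous_on (snd \<kappa> ` fst \<kappa>) (chart_inv \<kappa>)"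
    using h by (auto simp: homeomorphism_def)
  show "chart_inv \<kappa> (snd \<kappa> p) = p" if "p \<in> fst \<kappa>" for p
    using h that by (auto simp: homeomorphism_def)
  show "chart_inv \<kappa> x \<in> fst \<kappa> \<and> snd \<kappa> (chart_inv \<kappa> x) = x" if "x \<in> snd \<kappa> ` fst \<kappa>" for x
    using h that by (auto simp: homeomorphism_def)
qed

lemma ex_chart: "\<exists>\<kappa>\<in>A. p \<in> fst \<kappa>"
  using cm by (auto simp: complex_manifold_def set_eq_iff)

lemma open_chart_image:
  assumes "\<kappa> \<in> A" "open S"
  shows "open (snd \<kappa> ` (fst \<kappa> \<inter> S))"
proof -
  have "snd \<kappa> ` (fst \<kappa> \<inter> S) = snd \<kappa> ` fst \<kappa> \<inter> chart_inv \<kappa> -` S"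
    using chart(5,6)[OF assms(1)] by force
  then show ?thesis
    using continuous_open_preimage[OF chart(4,2)[OF assms(1)] assms(2)] by simp
qed

lemma open_chart_inv_image:
  assumes "\<kappa> \<in> A" "open T" "T \<subseteq> snd \<kappa> ` fst \<kappa>"
  shows "open (chart_inv \<kappa> ` T)"
proof -
  have "chart_inv \<kappa> ` T = fst \<kappa> \<inter> snd \<kappa> -` T"
    using chart(5,6)[OF assms(1)] assms(3) by force
  then show ?thesis
    using continuous_open_preimage[OF chart(3,1)[OF assms(1)] assms(2)] by simp
qed

lemma hol_on_subset: "hol_on f S \<Longrightarrow> T \<subseteq> S \<Longrightarrow> hol_on f T"
  unfolding mf_holomorphic_on_def by (blast intro: sv_holomorphic_on_subset image_mono)

lemma hol_on_local: "(\<And>x. x \<in> S \<Longrightarrow> \<exists>T. x \<in> T \<and> hol_on f T) \<Longrightarrow> hol_on f S"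
  unfolding mf_holomorphic_on_def sv_holomorphic_on_def by blast

lemma hol_on_cmult: "hol_on f S \<Longrightarrow> hol_on (\<lambda>x. c * f x) S"
  unfolding mf_holomorphic_on_def o_def by (intro ballI sv_holomorphic_on_cmult) auto

lemma hol_on_sum: "(\<And>i. i < (n::nat) \<Longrightarrow> hol_on (f i) S) \<Longrightarrow> hol_on (\<lambda>x. \<Sum>i<n. f i x * c i) S"
  unfolding mf_holomorphic_on_def o_def
  by (auto intro!: sv_holomorphic_on_sum sv_holomorphic_on_mult sv_holomorphic_on_const)

lemma hol_on_uniform_limit:
  assumes S: "open S" "\<And>n. hol_on (f n) S" "uniform_limit S f g sequentially"
  shows "hol_on g S"
  unfolding mf_holomorphic_on_def
proof
  fix \<kappa> assume k: "\<kappa> \<in> A"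
  show "sv_holomorphic_on (g \<circ> chart_inv \<kappa>) (snd \<kappa> ` (fst \<kappa> \<inter> S))"
  proof (rule sv_holomorphic_on_uniform_limit[OF open_chart_image[OF k S(1)]])
    show "sv_holomorphic_on (f n \<circ> chart_inv \<kappa>) (snd \<kappa> ` (fst \<kappa> \<inter> S))" for n
      using S(2) k by (auto simp: mf_holomorphic_on_def)
    show "uniform_limit (snd \<kappa> ` (fst \<kappa> \<inter> S)) (\<lambda>n. f n \<circ> chart_inv \<kappa>) (g \<circ> chart_inv \<kappa>) sequentially"
      unfolding o_def
      by (rule uniform_limit_compose'[OF S(3)]) (use chart(5)[OF k] in auto)
  qed
qed

text \<open>Holomorphy is demanded in every chart of the atlas. The transition maps have complex
  linear derivatives, so by the chain rule a check in one chart suffices.\<close>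

lemma hol_on_from_chart:
  assumes k: "\<kappa> \<in> A" and S: "open S" "S \<subseteq> fst \<kappa>"
    and f: "sv_holomorphic_on (f \<circ> chart_inv \<kappa>) (snd \<kappa> ` S)"
  shows "hol_on f S"
  unfolding mf_holomorphic_on_def sv_holomorphic_on_def
proof (intro ballI)
  fix \<kappa>' x assume k': "\<kappa>' \<in> A" and x: "x \<in> snd \<kappa>' ` (fst \<kappa>' \<inter> S)"
  then obtain p where p: "p \<in> fst \<kappa>'" "p \<in> S" "x = snd \<kappa>' p" by auto
  have px: "chart_inv \<kappa>' x = p" using p chart(5)[OF k'] by simp
  define \<tau> where "\<tau> y = snd \<kappa> (chart_inv \<kappa>' y)" for y
  have "\<exists>L. ((\<lambda>y. \<tau> y $ i) has_derivative L) (at x) \<and> (\<forall>c v. L (c *s v) = c * L v)" for i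
  proof -
    have "sv_holomorphic_on (\<lambda>y. \<tau> y $ i) (snd \<kappa>' ` (fst \<kappa>' \<inter> fst \<kappa>))"
      using cm k k' by (auto simp: complex_manifold_def \<tau>_def)
    moreover have "x \<in> snd \<kappa>' ` (fst \<kappa>' \<inter> fst \<kappa>)" using p S by auto
    ultimately show ?thesis unfolding sv_holomorphic_on_def by blast
  qed
  then obtain L where L: "\<And>i. ((\<lambda>y. \<tau> y $ i) has_derivative L i) (at x)"
    "\<And>i c v. L i (c *s v) = c * L i v" by metis
  have d\<tau>: "(\<tau> has_derivative (\<lambda>v. \<chi> i. L i v)) (at x)"
    by (rule has_derivative_vec_componentwise) (simp add: L)
  have "\<tau> x \<in> snd \<kappa> ` S" using p px by (auto simp: \<tau>_def)
  then obtain M where M: "((f \<circ> chart_inv \<kappa>) has_derivative M) (at (\<tau> x))" "\<And>c v. M (c *s v) = c * M v"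
    using f unfolding sv_holomorphic_on_def by metis
  have "((\<lambda>y. (f \<circ> chart_inv \<kappa>) (\<tau> y)) has_derivative (\<lambda>v. M (\<chi> i. L i v))) (at x)"
    by (rule has_derivative_compose[OF d\<tau> M(1)])
  then have "((f \<circ> chart_inv \<kappa>') has_derivative (\<lambda>v. M (\<chi> i. L i v))) (at x)"
  proof (rule has_derivative_transform_within_open)
    show "open (snd \<kappa>' ` (fst \<kappa>' \<inter> S))" by (rule open_chart_image[OF k' S(1)])
    show "x \<in> snd \<kappa>' ` (fst \<kappa>' \<inter> S)" by (rule x)
    fix y assume "y \<in> snd \<kappa>' ` (fst \<kappa>' \<inter> S)"
    then have "chart_inv \<kappa>' y \<in> S" using chart(5)[OF k'] by auto
    then show "(f \<circ> chart_inv \<kappa>) (\<tau> y) = (f \<circ> chart_inv \<kappa>') y"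
      using S chart(5)[OF k] by (auto simp: \<tau>_def)
  qed
  moreover have "M (\<chi> i. L i (c *s v)) = c * M (\<chi> i. L i v)" for c v
  proof -
    have "(\<chi> i. L i (c *s v)) = c *s (\<chi> i. L i v)" by (simp add: vec_eq_iff L)
    then show ?thesis by (simp add: M)
  qed
  ultimately show "\<exists>L. ((f \<circ> chart_inv \<kappa>') has_derivative L) (at x) \<and> (\<forall>c v. L (c *s v) = c * L v)"
    by blast
qed

lemma hol_on_continuous_on:
  assumes "open S" "hol_on f S"
  shows "continuous_on S f"
proof (intro continuous_at_imp_continuous_on ballI)
  fix x assume x: "x \<in> S"
  obtain \<kappa> where k: "\<kappa> \<in> A" "x \<in> fst \<kappa>" using ex_chart by blast
  have op: "open (fst \<kappa> \<inter> S)" using chart(1)[OF k(1)] assms(1) by auto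
  have 1: "continuous_on (snd \<kappa> ` (fst \<kappa> \<inter> S)) (f \<circ> chart_inv \<kappa>)"
    using assms(2) k by (intro sv_holomorphic_on_imp_continuous_on) (auto simp: mf_holomorphic_on_def)
  have 2: "continuous_on (fst \<kappa> \<inter> S) (snd \<kappa>)"
    using chart(3)[OF k(1)] continuous_on_subset by blast
  have "continuous_on (fst \<kappa> \<inter> S) (\<lambda>y. (f \<circ> chart_inv \<kappa>) (snd \<kappa> y))"
    by (rule continuous_on_compose2[OF 1 2]) auto
  then have "continuous_on (fst \<kappa> \<inter> S) f"
    by (rule continuous_on_cong[THEN iffD1, rotated 2]) (use chart(5)[OF k(1)] in auto)
  then show "isCont f x"
    using continuous_on_eq_continuous_at[OF op] k x by auto
qed

section \<open>Coordinate balls and the propagation of identities over connected sets\<close>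

definition coord_ball :: "'m set \<Rightarrow> ('m, 'n) chart \<Rightarrow> complex^'n \<Rightarrow> real \<Rightarrow> bool" where
  "coord_ball B \<kappa> c r \<longleftrightarrow> \<kappa> \<in> A \<and> 0 < r \<and> ball c r \<subseteq> snd \<kappa> ` fst \<kappa> \<and> B = chart_inv \<kappa> ` ball c r"

lemma coord_ball:
  assumes "coord_ball B \<kappa> c r"
  shows "open B" "connected B" "B \<subseteq> fst \<kappa>" "snd \<kappa> ` B = ball c r"
proof -
  have k: "\<kappa> \<in> A" and r: "0 < r" "ball c r \<subseteq> snd \<kappa> ` fst \<kappa>" and B: "B = chart_inv \<kappa> ` ball c r"
    using assms by (auto simp: coord_ball_def)
  show "open B" unfolding B by (rule open_chart_inv_image[OF k _ r(2)]) auto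
  show "connected B"
    unfolding B by (intro connected_continuous_image continuous_on_subset[OF chart(4)[OF k] r(2)]) auto
  show "B \<subseteq> fst \<kappa>" "snd \<kappa> ` B = ball c r"
    unfolding B using r chart(6)[OF k] by force+
qed

lemma ex_coord_ball:
  assumes "open S" "p \<in> S"
  obtains B \<kappa> r where "coord_ball B \<kappa> (snd \<kappa> p) r" "p \<in> B" "B \<subseteq> S"
proof -
  obtain \<kappa> where k: "\<kappa> \<in> A" "p \<in> fst \<kappa>" using ex_chart by blast
  have "open (snd \<kappa> ` (fst \<kappa> \<inter> S))" "snd \<kappa> p \<in> snd \<kappa> ` (fst \<kappa> \<inter> S)"
    using open_chart_image k assms by auto
  then obtain r where r: "0 < r" "ball (snd \<kappa> p) r \<subseteq> snd \<kappa> ` (fst \<kappa> \<inter> S)"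
    using open_contains_ball by metis
  show thesis
  proof (rule that[of "chart_inv \<kappa> ` ball (snd \<kappa> p) r" \<kappa> r])
    show "coord_ball (chart_inv \<kappa> ` ball (snd \<kappa> p) r) \<kappa> (snd \<kappa> p) r"
      using r k by (auto simp: coord_ball_def)
    have "chart_inv \<kappa> (snd \<kappa> p) \<in> chart_inv \<kappa> ` ball (snd \<kappa> p) r" using r by auto
    then show "p \<in> chart_inv \<kappa> ` ball (snd \<kappa> p) r" using chart(5)[OF k(1)] k by simp
    show "chart_inv \<kappa> ` ball (snd \<kappa> p) r \<subseteq> S"
    proof
      fix q assume "q \<in> chart_inv \<kappa> ` ball (snd \<kappa> p) r"
      then obtain y where "y \<in> fst \<kappa> \<inter> S" "q = chart_inv \<kappa> (snd \<kappa> y)" using r by blast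
      then show "q \<in> S" using chart(5)[OF k(1)] by simp
    qed
  qed
qed

lemma coord_ball_hol_on:
  assumes "coord_ball B \<kappa> c r" "hol_on f S" "B \<subseteq> S"
  shows "sv_holomorphic_on (f \<circ> chart_inv \<kappa>) (ball c r)"
proof -
  have "ball c r = snd \<kappa> ` (fst \<kappa> \<inter> B)"
    using coord_ball(3,4)[OF assms(1)] by (simp add: Int_absorb1)
  also have "\<dots> \<subseteq> snd \<kappa> ` (fst \<kappa> \<inter> S)" using assms(3) by auto
  finally show ?thesis
    using assms(1,2) by (auto simp: coord_ball_def mf_holomorphic_on_def intro: sv_holomorphic_on_subset)
qed

text \<open>Any two points of a coordinate ball lie on a complex line; this reduces identity theorems on
  manifolds to one variable.\<close>

lemma coord_ball_disc:
  assumes B: "coord_ball B \<kappa> c r" and xy: "x \<in> B" "y \<in> B"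
  obtains T \<phi> where "open T" "convex T" "0 \<in> T" "1 \<in> T" "\<phi> 0 = x" "\<phi> 1 = y"
    "continuous_on T \<phi>" "\<phi> ` T \<subseteq> B" "\<forall>f. hol_on f B \<longrightarrow> (\<lambda>\<zeta>. f (\<phi> \<zeta>)) holomorphic_on T"
proof -
  have k: "\<kappa> \<in> A" and r: "ball c r \<subseteq> snd \<kappa> ` fst \<kappa>" and Beq: "B = chart_inv \<kappa> ` ball c r"
    using B by (auto simp: coord_ball_def)
  define x' y' where "x' = snd \<kappa> x" and "y' = snd \<kappa> y"
  have xy': "x' \<in> ball c r" "y' \<in> ball c r" using xy coord_ball(4)[OF B] by (auto simp: x'_def y'_def)
  have inv: "chart_inv \<kappa> x' = x" "chart_inv \<kappa> y' = y"
    using xy coord_ball(3)[OF B] chart(5)[OF k] by (auto simp: x'_def y'_def)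
  define l where "l \<zeta> = x' + \<zeta> *s (y' - x')" for \<zeta>
  define T where "T = l -` ball c r"
  have cl: "continuous_on UNIV l"
    unfolding l_def
    by (intro continuous_intros linear_continuous_on bounded_linear_smult_left)
  show thesis
  proof (rule that[of T "\<lambda>\<zeta>. chart_inv \<kappa> (l \<zeta>)"])
    show "open T" unfolding T_def by (rule open_vimage[OF open_ball cl])
    show "convex T"
    proof (rule convexI)
      fix s t :: complex and u v :: real
      assume st: "s \<in> T" "t \<in> T" and uv: "0 \<le> u" "0 \<le> v" "u + v = 1"
      have "l (u *\<^sub>R s + v *\<^sub>R t) = (u + v) *\<^sub>R x' + (u *\<^sub>R s + v *\<^sub>R t) *s (y' - x')"
        using uv by (simp add: l_def)
      also have "\<dots> = u *\<^sub>R l s + v *\<^sub>R l t"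
        by (simp add: l_def vec_eq_iff algebra_simps)
      also have "\<dots> \<in> ball c r"
        using st uv convex_ball[of c r] by (auto simp: T_def convex_def)
      finally show "u *\<^sub>R s + v *\<^sub>R t \<in> T" by (simp add: T_def)
    qed
    show "0 \<in> T" "1 \<in> T" using xy' by (auto simp: T_def l_def)
    show "chart_inv \<kappa> (l 0) = x" "chart_inv \<kappa> (l 1) = y" using inv by (auto simp: l_def)
    show "continuous_on T (\<lambda>\<zeta>. chart_inv \<kappa> (l \<zeta>))"
      by (rule continuous_on_compose2[OF continuous_on_subset[OF chart(4)[OF k] r]
          continuous_on_subset[OF cl subset_UNIV]]) (auto simp: T_def)
    show "(\<lambda>\<zeta>. chart_inv \<kappa> (l \<zeta>)) ` T \<subseteq> B" by (auto simp: T_def Beq)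
    show "\<forall>f. hol_on f B \<longrightarrow> (\<lambda>\<zeta>. f (chart_inv \<kappa> (l \<zeta>))) holomorphic_on T"
    proof (intro allI impI)
      fix f assume f: "hol_on f B"
      have "(\<lambda>\<zeta>. (f \<circ> chart_inv \<kappa>) (x' + \<zeta> *s (y' - x'))) holomorphic_on T"
        by (rule holomorphic_on_complex_line[OF coord_ball_hol_on[OF B f]]) (auto simp: T_def l_def)
      then show "(\<lambda>\<zeta>. f (chart_inv \<kappa> (l \<zeta>))) holomorphic_on T" by (simp add: l_def)
    qed
  qed
qed

text \<open>By \<open>step\<close>, within a coordinate ball contained in S the property holds near
  all points or near none. Hence the set of points near which it holds is open and closed in S. This
  is the common core of the identity theorems for values and for moduli.\<close>

lemma coord_ball_propagation:
  assumes S: "open S" "connected S" and x0: "x0 \<in> S" "eventually P (nhds x0)"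
    and step: "\<And>B \<kappa> c r x y. coord_ball B \<kappa> c r \<Longrightarrow> B \<subseteq> S \<Longrightarrow> x \<in> B \<Longrightarrow> y \<in> B \<Longrightarrow>
      eventually P (nhds x) \<Longrightarrow> P y"
    and y: "y \<in> S"
  shows "P y"
proof -
  have "\<forall>a\<in>S. eventually (\<lambda>b. eventually P (nhds a) = eventually P (nhds b)) (at a within S)"
  proof
    fix a assume a: "a \<in> S"
    obtain B \<kappa> r where B: "coord_ball B \<kappa> (snd \<kappa> a) r" "a \<in> B" "B \<subseteq> S"
      using ex_coord_ball[OF S(1) a] by metis
    have *: "eventually P (nhds z)" if "eventually P (nhds x)" "x \<in> B" "z \<in> B" for x z
      using step[OF B(1,3) that(2) _ that(1)] coord_ball(1)[OF B(1)] that(3)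
      unfolding eventually_nhds by blast
    have "eventually (\<lambda>b. b \<in> B) (at a within S)"
      using coord_ball(1)[OF B(1)] B(2) by (auto simp: eventually_at_topological)
    then show "eventually (\<lambda>b. eventually P (nhds a) = eventually P (nhds b)) (at a within S)"
      by eventually_elim (use * B(2) in blast)
  qed
  from connected_local_const[OF S(2) x0(1) y this] x0(2) have "eventually P (nhds y)" by simp
  then show ?thesis by (rule eventually_nhds_x_imp_x)
qed

lemma continuous_eventually:
  assumes "open T" "continuous_on T \<phi>" "0 \<in> T" "eventually P (nhds (\<phi> 0))"
  shows "\<exists>Q. open Q \<and> 0 \<in> Q \<and> Q \<subseteq> T \<and> (\<forall>\<zeta>\<in>Q. P (\<phi> \<zeta>))"
proof -
  obtain W where W: "open W" "\<phi> 0 \<in> W" "\<And>x. x \<in> W \<Longrightarrow> P x"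
    using assms(4) unfolding eventually_nhds by blast
  show ?thesis
    by (rule exI[of _ "T \<inter> \<phi> -` W"])
       (use assms W continuous_open_preimage[OF assms(2,1) W(1)] in auto)
qed

lemma hol_on_identity:
  assumes S: "open S" "connected S" and f: "hol_on f S" "hol_on g S"
    and x0: "x0 \<in> S" "eventually (\<lambda>x. f x = g x) (nhds x0)" and y: "y \<in> S"
  shows "f y = g y"
proof (rule coord_ball_propagation[OF S x0 _ y])
  fix B \<kappa> c r x y
  assume B: "coord_ball B \<kappa> c r" "B \<subseteq> S" and xy: "x \<in> B" "y \<in> B" and ev: "eventually (\<lambda>x. f x = g x) (nhds x)"
  obtain T \<phi> where T: "open T" "convex T" "(0::complex) \<in> T" "1 \<in> T" "\<phi> 0 = x" "\<phi> 1 = y"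
    "continuous_on T \<phi>" "\<phi> ` T \<subseteq> B" "\<forall>f. hol_on f B \<longrightarrow> (\<lambda>\<zeta>. f (\<phi> \<zeta>)) holomorphic_on T"
    by (rule coord_ball_disc[OF B(1) xy], rule that)
  obtain Q where Q: "open Q" "0 \<in> Q" "Q \<subseteq> T" "\<forall>\<zeta>\<in>Q. f (\<phi> \<zeta>) = g (\<phi> \<zeta>)"
    using continuous_eventually[OF T(1,7,3) ev[folded T(5)]] by (elim exE conjE) (rule that)
  have "f (\<phi> 1) = g (\<phi> 1)"
    by (rule analytic_continuation_open[of Q T "\<lambda>\<zeta>. f (\<phi> \<zeta>)" "\<lambda>\<zeta>. g (\<phi> \<zeta>)"])
       (use Q T hol_on_subset[OF f(1) B(2)] hol_on_subset[OF f(2) B(2)] in \<open>auto intro: convex_connected\<close>)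
  then show "f y = g y" using T by simp
qed

lemma hol_on_modulus_powr_identity:
  assumes S: "open S" "connected S" and f: "hol_on f S" "hol_on g S" and \<mu>: "0 < \<mu>"
    and x0: "x0 \<in> S" "eventually (\<lambda>x. cmod (f x) powr \<mu> = cmod (g x)) (nhds x0)" and y: "y \<in> S"
  shows "cmod (f y) powr \<mu> = cmod (g y)"
proof (rule coord_ball_propagation[OF S x0 _ y])
  fix B \<kappa> c r x y
  assume B: "coord_ball B \<kappa> c r" "B \<subseteq> S" and xy: "x \<in> B" "y \<in> B"
    and ev: "eventually (\<lambda>x. cmod (f x) powr \<mu> = cmod (g x)) (nhds x)"
  obtain T \<phi> where T: "open T" "convex T" "(0::complex) \<in> T" "1 \<in> T" "\<phi> 0 = x" "\<phi> 1 = y"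
    "continuous_on T \<phi>" "\<phi> ` T \<subseteq> B" "\<forall>f. hol_on f B \<longrightarrow> (\<lambda>\<zeta>. f (\<phi> \<zeta>)) holomorphic_on T"
    by (rule coord_ball_disc[OF B(1) xy], rule that)
  obtain Q where Q: "open Q" "0 \<in> Q" "Q \<subseteq> T" "\<forall>\<zeta>\<in>Q. cmod (f (\<phi> \<zeta>)) powr \<mu> = cmod (g (\<phi> \<zeta>))"
    using continuous_eventually[OF T(1,7,3) ev[folded T(5)]] by (elim exE conjE) (rule that)
  have "cmod (f (\<phi> 1)) powr \<mu> = cmod (g (\<phi> 1))"
    by (rule modulus_powr_identity[of T "\<lambda>\<zeta>. f (\<phi> \<zeta>)" "\<lambda>\<zeta>. g (\<phi> \<zeta>)" \<mu> Q])
       (use Q T \<mu> hol_on_subset[OF f(1) B(2)] hol_on_subset[OF f(2) B(2)] in \<open>auto intro: convex_connected\<close>)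
  then show "cmod (f y) powr \<mu> = cmod (g y)" using T by simp
qed

text \<open>Near a point where g does not vanish, f / g has modulus 1 and is constant on every
  complex line by the maximum modulus principle; the identity theorem carries the relation to all of
  S. If g vanishes identically, so does f, and any unimodular constant will do.\<close>

lemma hol_on_equal_modulus:
  assumes S: "open S" "connected S" and f: "hol_on f S" "hol_on g S"
    and eq: "\<And>x. x \<in> S \<Longrightarrow> cmod (f x) = cmod (g x)"
  shows "\<exists>c. cmod c = 1 \<and> (\<forall>x\<in>S. f x = c * g x)"
proof (cases "\<forall>x\<in>S. g x = 0")
  case True
  then show ?thesis using eq by (intro exI[of _ 1]) auto
next
  case False
  then obtain z0 where z0: "z0 \<in> S" "g z0 \<noteq> 0" by blast
  have "open (S \<inter> g -` (-{0}))"
    by (rule continuous_open_preimage[OF hol_on_continuous_on[OF S(1) f(2)] S(1)]) auto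
  moreover have "z0 \<in> S \<inter> g -` (-{0})" using z0 by auto
  ultimately obtain B \<kappa> r where B: "coord_ball B \<kappa> (snd \<kappa> z0) r" "z0 \<in> B" "B \<subseteq> S \<inter> g -` (-{0})"
    using ex_coord_ball by metis
  define c where "c = f z0 / g z0"
  have BS: "B \<subseteq> S" using B by auto
  have on_B: "f y = c * g y" if y: "y \<in> B" for y
  proof -
    obtain T \<phi> where T: "open T" "convex T" "(0::complex) \<in> T" "1 \<in> T" "\<phi> 0 = z0" "\<phi> 1 = y"
      "continuous_on T \<phi>" "\<phi> ` T \<subseteq> B" "\<forall>f. hol_on f B \<longrightarrow> (\<lambda>\<zeta>. f (\<phi> \<zeta>)) holomorphic_on T"
      by (rule coord_ball_disc[OF B(1,2) y], rule that)
    have nz: "g (\<phi> \<zeta>) \<noteq> 0" "cmod (f (\<phi> \<zeta>)) = cmod (g (\<phi> \<zeta>))" if "\<zeta> \<in> T" for \<zeta>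
      using that T(8) B(3) eq by auto
    have "(\<lambda>\<zeta>. f (\<phi> \<zeta>) / g (\<phi> \<zeta>)) holomorphic_on T"
      using T(9) hol_on_subset[OF f(1) BS] hol_on_subset[OF f(2) BS] nz by (intro holomorphic_intros) auto
    moreover have "norm (f (\<phi> \<zeta>) / g (\<phi> \<zeta>)) \<le> norm (f (\<phi> 0) / g (\<phi> 0))" if "\<zeta> \<in> T" for \<zeta>
      using nz[OF that] nz[OF T(3)] by (simp add: norm_divide)
    ultimately have "(\<lambda>\<zeta>. f (\<phi> \<zeta>) / g (\<phi> \<zeta>)) constant_on T"
      using T convex_connected by (intro maximum_modulus_principle[of _ T T 0]) auto
    then have "f (\<phi> 1) / g (\<phi> 1) = f (\<phi> 0) / g (\<phi> 0)"
      using T unfolding constant_on_def by metis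
    then show ?thesis using T nz[OF T(4)] by (simp add: c_def divide_eq_eq)
  qed
  have "eventually (\<lambda>x. x \<in> B) (nhds z0)"
    using coord_ball(1)[OF B(1)] B(2) by (rule eventually_nhds_in_open)
  then have "eventually (\<lambda>x. f x = c * g x) (nhds z0)"
    by eventually_elim (rule on_B)
  then have "f y = c * g y" if "y \<in> S" for y
    using hol_on_identity[OF S f(1) hol_on_cmult[OF f(2)] z0(1) _ that] by blast
  moreover have "cmod c = 1" using eq z0 by (simp add: c_def norm_divide)
  ultimately show ?thesis by blast
qed

text \<open>Coordinate balls are path-connected, so path components are open and connectedness
  leaves only one.\<close>

lemma ex_path:
  assumes "U \<noteq> {}"
  obtains \<gamma> where "path \<gamma>" "pathstart \<gamma> \<in> U" "pathfinish \<gamma> = (q::'m)"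
proof -
  obtain p where p: "p \<in> U" using assms by blast
  have conn: "connected (UNIV :: 'm set)" using cm by (auto simp: complex_manifold_def)
  have pc: "path_component B x y" if B: "coord_ball B \<kappa> c r" and xy: "x \<in> B" "y \<in> B" for B \<kappa> c r x y
  proof -
    obtain T \<phi> where T: "open T" "convex T" "(0::complex) \<in> T" "1 \<in> T" "\<phi> 0 = x" "\<phi> 1 = y"
      "continuous_on T \<phi>" "\<phi> ` T \<subseteq> B" "\<forall>f. hol_on f B \<longrightarrow> (\<lambda>\<zeta>. f (\<phi> \<zeta>)) holomorphic_on T"
      by (rule coord_ball_disc[OF B xy], rule that)
    have "complex_of_real ` {0..1} \<subseteq> T"
    proof
      fix z assume "z \<in> complex_of_real ` {0..1}"
      then obtain t where t: "0 \<le> t" "t \<le> 1" "z = of_real t" by auto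
      then have "(1 - t) *\<^sub>R 0 + t *\<^sub>R 1 \<in> T"
        using T(2,3,4) by (intro convexD) auto
      then show "z \<in> T" using t by (simp add: scaleR_conv_of_real)
    qed
    then have "continuous_on {0..1} (\<lambda>t. \<phi> (of_real t))" "(\<lambda>t. \<phi> (complex_of_real t)) ` {0..1} \<subseteq> B"
      using T(7,8) by (auto intro!: continuous_on_compose2[OF T(7)] continuous_intros)
    then show ?thesis
      unfolding path_component_def using T(5,6)
      by (intro exI[of _ "\<lambda>t. \<phi> (of_real t)"]) (auto simp: path_def path_image_def pathstart_def pathfinish_def)
  qed
  have "\<forall>a\<in>UNIV. eventually (\<lambda>b. path_component UNIV p a = path_component UNIV p b) (at a within UNIV)"
  proof
    fix a :: 'm
    obtain B \<kappa> r where B: "coord_ball B \<kappa> (snd \<kappa> a) r" "a \<in> B" "B \<subseteq> UNIV"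
      using ex_coord_ball[of UNIV a] by (metis UNIV_I open_UNIV)
    have "eventually (\<lambda>b. b \<in> B) (at a)"
      using coord_ball(1)[OF B(1)] B(2) by (rule eventually_at_in_open')
    then show "eventually (\<lambda>b. path_component UNIV p a = path_component UNIV p b) (at a within UNIV)"
    proof eventually_elim
      fix b assume "b \<in> B"
      then have "path_component UNIV a b"
        using pc[OF B(1,2)] path_component_of_subset by blast
      then show "path_component UNIV p a = path_component UNIV p b"
        using path_component_trans path_component_sym by blast
    qed
  qed
  from connected_local_const[OF conn _ _ this, of p q] have "path_component UNIV p q"
    by (simp add: path_component_refl)
  then show thesis using that p unfolding path_component_def by blast
qed

lemma isCont_path_eventually:
  assumes g: "path \<gamma>" and t: "t \<le> 1" "s \<in> {0..t}" and W: "open W" "\<gamma> s \<in> W"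
  shows "eventually (\<lambda>s'. \<gamma> s' \<in> W) (at s within {0..t})"
proof -
  have "continuous_on {0..t} \<gamma>"
    using g t by (auto simp: path_def intro: continuous_on_subset)
  then have "(\<gamma> \<longlongrightarrow> \<gamma> s) (at s within {0..t})" using t by (auto simp: continuous_on_def)
  then show ?thesis using W by (rule topological_tendstoD)
qed

end

section \<open>Continuation of a resolution of \<open>\<rho>\<close>\<close>

lemma powr_cancel_base:
  fixes a b \<mu> :: real
  assumes "a powr \<mu> = b powr \<mu>" "0 < \<mu>" "0 \<le> a" "0 \<le> b"
  shows "a = b"
proof -
  have "(x powr \<mu>) powr (1 / \<mu>) = x" if "0 \<le> x" for x
    using assms(2) that by (simp add: powr_powr)
  then show ?thesis using assms by metis
qed

text \<open>One setting for finite and infinite N: \<open>h\<close> is always a full sequence, and a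
  finite tuple enters padded with zero functions. The hypotheses on K are those of separate
  holomorphy.\<close>

locale kernel_resolution = cmanifold A for A :: "('m::{t2_space, second_countable_topology}, 'n::finite) chart set" +
  fixes \<rho> :: "'m \<Rightarrow> real" and h :: "nat \<Rightarrow> 'm \<Rightarrow> complex" and U :: "'m set" and \<mu> :: real
    and K :: "'m \<Rightarrow> 'm \<Rightarrow> complex"
  assumes ra: "mf_real_analytic_on A \<rho> UNIV" and pos: "0 < \<rho> p"
    and U: "open U" "connected U" "U \<noteq> {}"
    and h_hol: "hol_on (h j) U" and h_sums: "p \<in> U \<Longrightarrow> (\<lambda>j. (cmod (h j p))\<^sup>2) sums \<rho> p"
    and \<mu>: "0 < \<mu>"
    and K1: "hol_on (\<lambda>z. K z w) UNIV" and K2: "hol_on (\<lambda>w. cnj (K z w)) UNIV"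
    and K_diag: "K z z = of_real (\<rho> z powr \<mu>)"
begin

lemma continuous_rho: "continuous_on UNIV \<rho>"
proof (intro continuous_at_imp_continuous_on ballI)
  fix p :: 'm
  obtain \<kappa> where k: "\<kappa> \<in> A" "p \<in> fst \<kappa>" using ex_chart by blast
  have "real_analytic_at (\<rho> \<circ> chart_inv \<kappa>) (snd \<kappa> p)"
    using ra k by (auto simp: mf_real_analytic_on_def)
  then have "isCont (\<rho> \<circ> chart_inv \<kappa>) (snd \<kappa> p)" by (rule real_analytic_at_imp_isCont)
  moreover have "isCont (snd \<kappa>) p"
    using chart(1,3)[OF k(1)] k(2) continuous_on_eq_continuous_at by blast
  ultimately have c: "isCont (\<lambda>q. (\<rho> \<circ> chart_inv \<kappa>) (snd \<kappa> q)) p"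
    by (rule isCont_o2[rotated])
  have "eventually (\<lambda>q. q \<in> fst \<kappa>) (nhds p)"
    using chart(1)[OF k(1)] k(2) by (rule eventually_nhds_in_open)
  then have "eventually (\<lambda>q. (\<rho> \<circ> chart_inv \<kappa>) (snd \<kappa> q) = \<rho> q) (nhds p)"
    by eventually_elim (simp add: chart(5)[OF k(1)])
  from isCont_cong[THEN iffD1, OF this c] show "isCont \<rho> p" .
qed

definition resolution :: "'m set \<Rightarrow> (nat \<Rightarrow> 'm \<Rightarrow> complex) \<Rightarrow> bool" where
  "resolution S G \<longleftrightarrow> open S \<and> connected S \<and> (\<forall>j. hol_on (G j) S) \<and> (\<forall>x\<in>S. (\<lambda>j. (cmod (G j x))\<^sup>2) sums \<rho> x)"

lemma resolution_l2:
  assumes "resolution S G" "x \<in> S"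
  shows "l2 (\<lambda>j. G j x)" "l2sq (\<lambda>j. G j x) = \<rho> x"
  using assms l2_iff_sums[of "\<lambda>j. G j x" "\<rho> x"] by (auto simp: resolution_def)

lemma resolution_h: "resolution U h"
  using U h_hol h_sums by (auto simp: resolution_def)

text \<open>By continuity \<rho> is bounded near each point. As the squared norm of the family
  equals \<rho>, the partial sums of the pairing converge uniformly there.\<close>

lemma hol_on_pairing:
  assumes G: "resolution S G" and d: "l2 d"
  shows "hol_on (\<lambda>x. pairing (\<lambda>j. G j x) d) S"
proof (rule hol_on_local)
  fix x assume x: "x \<in> S"
  define W where "W = S \<inter> \<rho> -` {..<\<rho> x + 1}"
  have "open W"
    unfolding W_def using G continuous_rho by (auto simp: resolution_def intro!: open_Int open_vimage)
  moreover have "hol_on (\<lambda>x. \<Sum>j<n. G j x * cnj (d j)) W" for n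
    using G by (intro hol_on_sum hol_on_subset[of _ S W]) (auto simp: resolution_def W_def)
  moreover have "uniform_limit W (\<lambda>n x. \<Sum>j<n. G j x * cnj (d j)) (\<lambda>x. pairing (\<lambda>j. G j x) d) sequentially"
    using resolution_l2[OF G] by (intro uniform_limit_pairing[where C = "\<rho> x + 1"] d) (auto simp: W_def)
  ultimately have "hol_on (\<lambda>x. pairing (\<lambda>j. G j x) d) W" by (rule hol_on_uniform_limit)
  then show "\<exists>T. x \<in> T \<and> hol_on (\<lambda>x. pairing (\<lambda>j. G j x) d) T"
    using x by (intro exI[of _ W]) (auto simp: W_def)
qed

text \<open>\<open>K\<close> is only separately holomorphic, so it need not be bounded near a given diagonal point; by
  Baire's theorem (Osgood's argument) it is bounded near some diagonal point of \<open>U\<close>, which suffices.\<close>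

lemma K_bounded_near_diagonal_point:
  assumes B: "coord_ball B \<kappa> c r"
  obtains y \<delta> n where "0 < \<delta>" "ball y \<delta> \<subseteq> ball c r"
    "\<And>x z. x \<in> ball y \<delta> \<Longrightarrow> z \<in> ball y \<delta> \<Longrightarrow> cmod (K (chart_inv \<kappa> x) (chart_inv \<kappa> z)) \<le> real n"
proof -
  define k where "k x z = K (chart_inv \<kappa> x) (chart_inv \<kappa> z)" for x z
  have r: "0 < r" using B by (auto simp: coord_ball_def)
  define D where "D = cball c (r / 2)"
  have D: "D \<subseteq> ball c r" "closed D" "compact D" "D \<noteq> {}" using r by (auto simp: D_def)
  have k1: "continuous_on D (\<lambda>x. k x z)" for z
    using sv_holomorphic_on_imp_continuous_on[OF coord_ball_hol_on[OF B K1 subset_UNIV]] D(1)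
    by (auto simp: k_def o_def intro: continuous_on_subset)
  have k2: "continuous_on D (\<lambda>z. cmod (k x z))" for x
  proof -
    have "continuous_on D (\<lambda>z. cnj (k x z))"
      using sv_holomorphic_on_imp_continuous_on[OF coord_ball_hol_on[OF B K2 subset_UNIV]] D(1)
      by (auto simp: k_def o_def intro: continuous_on_subset)
    from continuous_on_norm[OF this] show ?thesis by simp
  qed
  \<comment> \<open>These sets are closed by continuity of K in the second variable, and they cover
    D by continuity in the first variable on the compact set D. Separate continuity is thus enough
    for Baire's theorem.\<close>
  define E where "E n = {z\<in>D. \<forall>x\<in>D. cmod (k x z) \<le> real n}" for n :: nat
  have clE: "closed (E n)" for n
  proof -
    have "E n = (\<Inter>x\<in>D. D \<inter> (\<lambda>z. cmod (k x z)) -` {..real n})" using D by (auto simp: E_def)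
    also have "closed \<dots>"
      by (intro closed_INT ballI continuous_closed_preimage k2 D closed_atMost)
    finally show ?thesis .
  qed
  have cover: "\<exists>n. z \<in> E n" if z: "z \<in> D" for z
  proof -
    have "compact ((\<lambda>x. k x z) ` D)" by (rule compact_continuous_image[OF k1 D(3)])
    then obtain b where b: "\<forall>w\<in>(\<lambda>x. k x z) ` D. cmod w \<le> b"
      using compact_imp_bounded bounded_iff by blast
    obtain n where "b \<le> real n" using real_arch_simple by blast
    then have "z \<in> E n" using b z unfolding E_def by fastforce
    then show ?thesis by blast
  qed
  have "\<exists>n. \<not> D \<subseteq> closure (D - E n)"
  proof (rule ccontr)
    assume a: "\<not> (\<exists>n. \<not> D \<subseteq> closure (D - E n))"
    have "D \<subseteq> closure (\<Inter> (range (\<lambda>n. D - E n)))"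
    proof (rule Baire[OF D(2)])
      fix T assume "T \<in> range (\<lambda>n. D - E n)"
      then obtain n where T: "T = D - E n" by auto
      have "openin (top_of_set D) (D \<inter> - E n)" using clE by (intro openin_open_Int) auto
      then show "openin (top_of_set D) T \<and> D \<subseteq> closure T" using a T by (auto simp: Diff_eq)
    qed auto
    moreover have "\<Inter> (range (\<lambda>n. D - E n)) = {}" using cover by blast
    ultimately have "D \<subseteq> closure {}" by (simp only:)
    then show False using D by simp
  qed
  then obtain n z where z: "z \<in> D" "z \<notin> closure (D - E n)" by blast
  define W where "W = - closure (D - E n)"
  have W: "open W" "z \<in> W" "W \<inter> D \<subseteq> E n"
    using z closure_subset[of "D - E n"] by (auto simp: W_def)
  \<comment> \<open>The Baire point may lie on the boundary sphere of D. As the open ball is dense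
    in D, the neighbourhood W also meets the open ball, and a full ball fits into the
    intersection.\<close>
  have "closure (ball c (r / 2)) = D" using r by (simp add: D_def)
  then have "W \<inter> ball c (r / 2) \<noteq> {}"
    using W z open_Int_closure_eq_empty[OF W(1), of "ball c (r / 2)"] by auto
  then obtain y where y: "y \<in> W \<inter> ball c (r / 2)" by blast
  obtain \<delta> where \<delta>: "0 < \<delta>" "ball y \<delta> \<subseteq> W \<inter> ball c (r / 2)"
    using openE[OF open_Int[OF W(1) open_ball] y] by blast
  have "ball y \<delta> \<subseteq> D" using \<delta>(2) ball_subset_cball[of c "r / 2"] unfolding D_def by blast
  then have sub: "ball y \<delta> \<subseteq> E n" "ball y \<delta> \<subseteq> D" using \<delta>(2) W(3) by blast+
  show thesis
  proof (rule that[OF \<delta>(1)])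
    show "ball y \<delta> \<subseteq> ball c r" using sub D by blast
    show "cmod (K (chart_inv \<kappa> x) (chart_inv \<kappa> z)) \<le> real n" if "x \<in> ball y \<delta>" "z \<in> ball y \<delta>" for x z
      using sub that unfolding E_def k_def by blast
  qed
qed

text \<open>Close to a diagonal point where K is bounded, the pairing lies in the right half-plane.
  The principal branch of its \<mu>-th power is then holomorphic and coincides with K on the
  diagonal, hence off it as well. Only the equality of moduli is retained, since the branch need not
  survive continuation.\<close>

lemma ex_base_region:
  obtains V where "open V" "connected V" "V \<noteq> {}" "V \<subseteq> U"
    "\<And>z w. z \<in> V \<Longrightarrow> w \<in> V \<Longrightarrow>
      cmod (pairing (\<lambda>j. h j z) (\<lambda>j. h j w)) powr \<mu> = cmod (K z w)"
proof -
  obtain p0 where p0: "p0 \<in> U" using U by blast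
  obtain B \<kappa> r where B: "coord_ball B \<kappa> (snd \<kappa> p0) r" "p0 \<in> B" "B \<subseteq> U"
    using ex_coord_ball[OF U(1) p0] by metis
  define c where "c = snd \<kappa> p0"
  define \<iota> where "\<iota> = chart_inv \<kappa>"
  have B': "coord_ball B \<kappa> c r" using B by (simp add: c_def)
  have \<kappa>: "\<kappa> \<in> A" "ball c r \<subseteq> snd \<kappa> ` fst \<kappa>" "B = \<iota> ` ball c r"
    using B' by (auto simp: coord_ball_def \<iota>_def)
  obtain y1 \<delta> n where \<delta>: "0 < \<delta>" "ball y1 \<delta> \<subseteq> ball c r"
    and Kb: "\<And>x z. x \<in> ball y1 \<delta> \<Longrightarrow> z \<in> ball y1 \<delta> \<Longrightarrow> cmod (K (\<iota> x) (\<iota> z)) \<le> real n"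
    unfolding \<iota>_def by (rule K_bounded_near_diagonal_point[OF B']) blast
  define H where "H x j = h j (\<iota> x)" for x j
  define f where "f x y = pairing (H x) (H y)" for x y
  have \<iota>U: "\<iota> x \<in> U" if "x \<in> ball c r" for x using that \<kappa> B by blast
  have H: "l2 (H x)" "l2sq (H x) = \<rho> (\<iota> x)" if "x \<in> ball c r" for x
    using resolution_l2[OF resolution_h \<iota>U[OF that]] by (simp_all add: H_def[abs_def])
  have f_hol: "sv_holomorphic_on (\<lambda>x. f x y) (ball c r)" if "y \<in> ball c r" for y
    using coord_ball_hol_on[OF B' hol_on_pairing[OF resolution_h H(1)[OF that]] B(3)]
    by (simp add: f_def H_def[abs_def] o_def \<iota>_def)
  have y1: "y1 \<in> ball c r" using \<delta> by (meson centre_in_ball subsetD)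
  have \<rho>_cont: "continuous_on (ball c r) (\<lambda>x. \<rho> (\<iota> x))"
    unfolding \<iota>_def
    by (rule continuous_on_compose2[OF continuous_rho continuous_on_subset[OF chart(4)[OF \<kappa>(1)] \<kappa>(2)]]) auto
  define a where "a = l2sq (H y1)"
  have a: "a = \<rho> (\<iota> y1)" "0 < a" using H[OF y1] pos by (auto simp: a_def)
  \<comment> \<open>This is the squared distance of \<open>H x\<close> from \<open>H y1\<close>.
    Expanding the square expresses it through \<rho> and one pairing, both continuous, which yields
    continuity of \<open>H\<close> in norm at y1.\<close>
  define Q where "Q x = \<rho> (\<iota> x) + a - 2 * Re (f x y1)" for x
  have Q: "l2sq (\<lambda>j. H x j - H y1 j) = Q x" if "x \<in> ball c r" for x
    using l2sq_diff[OF H(1)[OF that] H(1)[OF y1]] H(2)[OF that] by (simp add: Q_def f_def a_def)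
  have Q_cont: "continuous_on (ball c r) Q"
    unfolding Q_def
    by (intro continuous_intros \<rho>_cont sv_holomorphic_on_imp_continuous_on[OF f_hol[OF y1]])
  define W where "W = (ball c r \<inter> Q -` {..<a / 36}) \<inter> (ball c r \<inter> (\<lambda>x. \<rho> (\<iota> x)) -` {..<4 * a}) \<inter> ball y1 \<delta>"
  have "open W"
    unfolding W_def using continuous_open_preimage[OF Q_cont open_ball, of "{..<a / 36}"]
      continuous_open_preimage[OF \<rho>_cont open_ball, of "{..<4 * a}"] by auto
  moreover have "f y1 y1 = of_real a" using H(1)[OF y1] by (simp add: f_def a_def pairing_self)
  then have "y1 \<in> W" using y1 \<delta> a by (simp add: W_def Q_def)
  ultimately obtain e where e: "0 < e" "ball y1 e \<subseteq> W" using open_contains_ball by blast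
  have e_in: "x \<in> ball c r" "x \<in> ball y1 \<delta>" "Q x \<le> a / 36" "\<rho> (\<iota> x) \<le> 4 * a" if "x \<in> ball y1 e" for x
    using that e by (auto simp: W_def)
  have f_pos: "0 < Re (f x y)" if "x \<in> ball y1 e" "y \<in> ball y1 e" for x y
    unfolding f_def
    using e_in[OF that(1)] e_in[OF that(2)] H Q y1 a
    by (intro Re_pairing_near[of "H y1"]) (auto simp: a_def)
  have f_bound: "cmod (f x y) \<le> 4 * a" if "x \<in> ball y1 e" "y \<in> ball y1 e" for x y
  proof -
    have "(cmod (f x y))\<^sup>2 \<le> \<rho> (\<iota> x) * \<rho> (\<iota> y)"
      using Cauchy_Schwarz_pairing[of "H x" "H y"] H e_in that by (simp add: f_def)
    also have "\<dots> \<le> (4 * a) * (4 * a)"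
      using e_in that pos a by (intro mult_mono) (auto simp: less_imp_le)
    also have "\<dots> = (4 * a)\<^sup>2" by (simp add: power2_eq_square)
    finally show ?thesis by (rule power2_le_imp_le) (use a in simp)
  qed
  \<comment> \<open>Two points of this ball differ by at most e / 3, so the complex line through
    them with parameter of modulus below 2 stays within e / 6 + 2e / 3 < e of y1.\<close>
  define V where "V = \<iota> ` ball y1 (e / 6)"
  have sub: "ball y1 (e / 6) \<subseteq> ball c r"
    using e_in(1) subset_ball[of "e / 6" e y1] e(1) by auto
  have Vc: "coord_ball V \<kappa> y1 (e / 6)"
    using \<kappa> sub e by (auto simp: coord_ball_def V_def \<iota>_def)
  have main: "cmod (f x y) powr \<mu> = cmod (K (\<iota> x) (\<iota> y))"
    if x: "x \<in> ball y1 (e / 6)" and y: "y \<in> ball y1 (e / 6)" for x y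
  proof -
    define v where "v = y - x"
    define l where "l \<zeta> = x + \<zeta> *s v" for \<zeta>
    have l: "l \<zeta> \<in> ball y1 e" if "\<zeta> \<in> ball 0 2" for \<zeta>
    proof -
      have "norm v = dist x y" by (simp add: v_def dist_norm norm_minus_commute)
      also have "\<dots> \<le> dist y1 x + dist y1 y"
        using dist_triangle[of x y y1] by (simp add: dist_commute)
      also have "\<dots> \<le> e / 6 + e / 6" using x y by (intro add_mono) auto
      finally have "cmod \<zeta> * norm v \<le> 2 * (e / 6 + e / 6)" using that by (intro mult_mono) auto
      moreover have "dist y1 (l \<zeta>) \<le> dist y1 x + norm (\<zeta> *s v)"
        using dist_triangle[of y1 "l \<zeta>" x] by (simp add: l_def dist_norm)
      ultimately show ?thesis using x e by (simp add: norm_smult_cvec)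
    qed
    define G where "G \<zeta> \<xi> = exp (of_real \<mu> * Ln (f (l \<zeta>) (l (cnj \<xi>)))) - K (\<iota> (l \<zeta>)) (\<iota> (l (cnj \<xi>)))" for \<zeta> \<xi>
    have lc: "l (cnj \<xi>) \<in> ball y1 e" if "\<xi> \<in> ball 0 2" for \<xi> using l that by simp
    have nonpos: "f x y \<notin> \<real>\<^sub>\<le>\<^sub>0" "f x y \<noteq> 0" if "x \<in> ball y1 e" "y \<in> ball y1 e" for x y
      using f_pos[OF that] by (auto simp: complex_nonpos_Reals_iff)
    have fl: "(\<lambda>\<zeta>. f (l \<zeta>) w) holomorphic_on ball 0 2" if "w \<in> ball y1 e" for w
      unfolding l_def
      by (rule holomorphic_on_complex_line[OF f_hol[OF e_in(1)[OF that]]])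
         (use l e_in(1) in \<open>simp add: l_def\<close>)
    \<comment> \<open>The parameters 0 and 1 correspond to x and y, so the vanishing of G here is
      the desired identity; the disc of radius 2 is chosen to contain both. The constant bounds the
      branch of the power, whose argument has modulus at most 4a, plus the bound n for K.\<close>
    have "G 0 1 = 0"
    proof (rule antidiagonal_zero[where G = G and \<zeta> = 0 and \<xi> = 1 and R = 2 and e = 2 and C = "exp (\<mu> * ln (4 * a)) + real n"])
      fix \<xi> :: complex assume \<xi>: "\<xi> \<in> ball 0 2"
      have "sv_holomorphic_on (\<lambda>z. K (\<iota> z) (\<iota> (l (cnj \<xi>)))) (ball c r)"
        using coord_ball_hol_on[OF B' K1 subset_UNIV] by (simp add: o_def \<iota>_def)
      then have "(\<lambda>\<zeta>. K (\<iota> (l \<zeta>)) (\<iota> (l (cnj \<xi>)))) holomorphic_on ball 0 2"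
        unfolding l_def by (rule holomorphic_on_complex_line) (use l e_in(1) in \<open>simp add: l_def\<close>)
      then show "(\<lambda>\<zeta>. G \<zeta> \<xi>) holomorphic_on ball 0 2"
        unfolding G_def using fl[OF lc[OF \<xi>]] nonpos[OF l lc[OF \<xi>]] by (intro holomorphic_intros) auto
    next
      fix \<zeta> :: complex assume \<zeta>: "\<zeta> \<in> ball 0 2"
      have "sv_holomorphic_on (\<lambda>z. cnj (K (\<iota> (l \<zeta>)) (\<iota> z))) (ball c r)"
        using coord_ball_hol_on[OF B' K2 subset_UNIV] by (simp add: o_def \<iota>_def)
      then have "(\<lambda>\<xi>. cnj (K (\<iota> (l \<zeta>)) (\<iota> (l \<xi>)))) holomorphic_on ball 0 2"
        unfolding l_def by (rule holomorphic_on_complex_line) (use l e_in(1) in \<open>simp add: l_def\<close>)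
      from taylor_coeff_cnj(1)[OF _ this]
      have 1: "(\<lambda>\<xi>. K (\<iota> (l \<zeta>)) (\<iota> (l (cnj \<xi>)))) holomorphic_on ball 0 2" by simp
      have fc: "f (l \<zeta>) (l (cnj \<xi>)) = cnj (f (l (cnj \<xi>)) (l \<zeta>))" if "\<xi> \<in> ball 0 2" for \<xi>
        unfolding f_def using H(1) e_in(1) l[OF \<zeta>] lc[OF that] by (intro pairing_cnj[symmetric]) auto
      then have 2: "(\<lambda>\<xi>. f (l \<zeta>) (l (cnj \<xi>))) holomorphic_on ball 0 2"
        by (intro holomorphic_transform[OF taylor_coeff_cnj(1)[OF _ fl[OF l[OF \<zeta>]]]]) (simp_all add: fc)
      show "(\<lambda>\<xi>. G \<zeta> \<xi>) holomorphic_on ball 0 2"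
        unfolding G_def using 1 2 nonpos[OF l[OF \<zeta>] lc] by (intro holomorphic_intros) auto
    next
      fix \<zeta> \<xi> :: complex assume z: "\<zeta> \<in> ball 0 2" "\<xi> \<in> ball 0 2"
      let ?w = "f (l \<zeta>) (l (cnj \<xi>))"
      have w: "?w \<noteq> 0" "cmod ?w \<le> 4 * a" using nonpos f_bound l[OF z(1)] lc[OF z(2)] by blast+
      have "ln (cmod ?w) \<le> ln (4 * a)" using w a by (subst ln_le_cancel_iff) auto
      then have "cmod (exp (of_real \<mu> * Ln ?w)) \<le> exp (\<mu> * ln (4 * a))"
        using w \<mu> by simp
      moreover have "cmod (K (\<iota> (l \<zeta>)) (\<iota> (l (cnj \<xi>)))) \<le> real n"
        using Kb e_in(2) l[OF z(1)] lc[OF z(2)] by blast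
      ultimately show "cmod (G \<zeta> \<xi>) \<le> exp (\<mu> * ln (4 * a)) + real n"
        unfolding G_def using norm_triangle_ineq4 add_mono order_trans by blast
    next
      fix \<zeta> :: complex assume \<zeta>: "\<zeta> \<in> ball 0 2"
      have "f (l \<zeta>) (l \<zeta>) = of_real (\<rho> (\<iota> (l \<zeta>)))"
        using H[OF e_in(1)[OF l[OF \<zeta>]]] by (simp add: f_def pairing_self)
      moreover have "exp (of_real \<mu> * Ln (of_real (\<rho> (\<iota> (l \<zeta>))))) = complex_of_real (\<rho> (\<iota> (l \<zeta>)) powr \<mu>)"
        using pos[of "\<iota> (l \<zeta>)"] by (simp add: Ln_of_real powr_def exp_of_real[symmetric])
      ultimately show "G \<zeta> (cnj \<zeta>) = 0" by (simp add: G_def K_diag)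
    qed auto
    then have eq: "exp (of_real \<mu> * Ln (f x y)) = K (\<iota> x) (\<iota> y)"
      by (simp add: G_def l_def v_def)
    have "f x y \<noteq> 0" using nonpos x y e by auto
    then have "cmod (f x y) powr \<mu> = cmod (exp (of_real \<mu> * Ln (f x y)))"
      by (simp add: powr_def)
    then show ?thesis by (simp add: eq)
  qed
  show thesis
  proof (rule that[of V])
    show "open V" "connected V" using coord_ball[OF Vc] by auto
    show "V \<noteq> {}" using e by (auto simp: V_def)
    show "V \<subseteq> U" using \<iota>U sub by (auto simp: V_def)
    show "cmod (pairing (\<lambda>j. h j z) (\<lambda>j. h j w)) powr \<mu> = cmod (K z w)" if "z \<in> V" "w \<in> V" for z w
      using that main unfolding V_def f_def H_def[abs_def] by auto
  qed
qed

text \<open>Both conditions persist under analytic continuation, and together they determine \<open>G\<close> up to a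
  constant of modulus 1.\<close>

definition admissible :: "'m set \<Rightarrow> 'm set \<Rightarrow> (nat \<Rightarrow> 'm \<Rightarrow> complex) \<Rightarrow> bool" where
  "admissible V S G \<longleftrightarrow> resolution S G \<and>
     (\<forall>w\<in>V. \<forall>x\<in>S. cmod (pairing (\<lambda>j. G j x) (\<lambda>j. h j w)) powr \<mu> = cmod (K x w)) \<and>
     (\<forall>d. l2 d \<longrightarrow> (\<forall>w\<in>V. pairing (\<lambda>j. h j w) d = 0) \<longrightarrow> (\<forall>x\<in>S. pairing (\<lambda>j. G j x) d = 0))"

section \<open>Transfer, uniqueness and local extension of admissible resolutions\<close>

lemma admissible_imp_resol: "admissible V S G \<Longrightarrow> resolution S G"
  by (simp add: admissible_def)

lemma admissible_modulus:
  "admissible V S G \<Longrightarrow> w \<in> V \<Longrightarrow> x \<in> S \<Longrightarrow> cmod (pairing (\<lambda>j. G j x) (\<lambda>j. h j w)) powr \<mu> = cmod (K x w)"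
  by (simp add: admissible_def)

lemma admissible_pairing_eq_0:
  "admissible V S G \<Longrightarrow> l2 d \<Longrightarrow> (\<And>w. w \<in> V \<Longrightarrow> pairing (\<lambda>j. h j w) d = 0) \<Longrightarrow> x \<in> S \<Longrightarrow> pairing (\<lambda>j. G j x) d = 0"
  by (simp add: admissible_def)

definition base_region :: "'m set \<Rightarrow> bool" where
  "base_region V \<longleftrightarrow> open V \<and> connected V \<and> V \<noteq> {} \<and> V \<subseteq> U \<and>
     (\<forall>z\<in>V. \<forall>w\<in>V. cmod (pairing (\<lambda>j. h j z) (\<lambda>j. h j w)) powr \<mu> = cmod (K z w))"

lemma obtain_base_region: obtains V where "base_region V"
  by (rule ex_base_region) (auto simp: base_region_def)

lemma l2_h: "w \<in> U \<Longrightarrow> l2 (\<lambda>j. h j w)"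
  using resolution_l2[OF resolution_h] by simp

lemma admissible_h:
  assumes V: "base_region V"
  shows "admissible V U h"
  unfolding admissible_def
proof (intro conjI ballI allI impI resolution_h)
  obtain v where v: "v \<in> V" "v \<in> U" using V by (auto simp: base_region_def)
  have evV: "eventually (\<lambda>x. x \<in> V) (nhds v)"
    using V v by (intro eventually_nhds_in_open) (auto simp: base_region_def)
  show "cmod (pairing (\<lambda>j. h j x) (\<lambda>j. h j w)) powr \<mu> = cmod (K x w)" if w: "w \<in> V" and x: "x \<in> U" for w x
  proof (rule hol_on_modulus_powr_identity[OF U(1,2) _ hol_on_subset[OF K1 subset_UNIV] \<mu> v(2) _ x])
    have "w \<in> U" using V w by (auto simp: base_region_def)
    then show "hol_on (\<lambda>x. pairing (\<lambda>j. h j x) (\<lambda>j. h j w)) U" by (intro hol_on_pairing resolution_h l2_h)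
    show "eventually (\<lambda>x. cmod (pairing (\<lambda>j. h j x) (\<lambda>j. h j w)) powr \<mu> = cmod (K x w)) (nhds v)"
      using evV by eventually_elim (use V w in \<open>auto simp: base_region_def\<close>)
  qed
  show "pairing (\<lambda>j. h j x) d = 0" if d: "l2 d" "\<forall>w\<in>V. pairing (\<lambda>j. h j w) d = 0" and x: "x \<in> U" for d x
  proof (rule hol_on_identity[OF U(1,2) hol_on_pairing[OF resolution_h d(1)] _ v(2) _ x])
    show "hol_on (\<lambda>_. 0) U" using hol_on_cmult[OF h_hol, of 0] by simp
    show "eventually (\<lambda>x. pairing (\<lambda>j. h j x) d = 0) (nhds v)"
      using evV by eventually_elim (use d in auto)
  qed
qed

text \<open>For fixed w or d, each condition is an identity between holomorphic functions of the
  point x, or between their moduli. It therefore spreads from a common germ at q over the connected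
  domain of \<open>G'\<close>.\<close>

lemma admissible_transfer:
  assumes V: "base_region V" and G: "admissible V S G" and G': "resolution S' G'" and q: "q \<in> S" "q \<in> S'"
    and ev: "eventually (\<lambda>x. \<forall>j. G' j x = G j x) (nhds q)"
  shows "admissible V S' G'"
  unfolding admissible_def
proof (intro conjI ballI allI impI G')
  have S': "open S'" "connected S'" and S: "open S" using G G' by (auto simp: resolution_def admissible_def)
  have "eventually (\<lambda>x. x \<in> S) (nhds q)" using S q by (intro eventually_nhds_in_open)
  with ev have ev': "eventually (\<lambda>x. x \<in> S \<and> (\<lambda>j. G' j x) = (\<lambda>j. G j x)) (nhds q)"
    by eventually_elim auto
  show "cmod (pairing (\<lambda>j. G' j x) (\<lambda>j. h j w)) powr \<mu> = cmod (K x w)" if w: "w \<in> V" and x: "x \<in> S'" for w x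
  proof (rule hol_on_modulus_powr_identity[OF S' _ hol_on_subset[OF K1 subset_UNIV] \<mu> q(2) _ x])
    have "w \<in> U" using V w by (auto simp: base_region_def)
    then show "hol_on (\<lambda>x. pairing (\<lambda>j. G' j x) (\<lambda>j. h j w)) S'" by (intro hol_on_pairing G' l2_h)
    show "eventually (\<lambda>x. cmod (pairing (\<lambda>j. G' j x) (\<lambda>j. h j w)) powr \<mu> = cmod (K x w)) (nhds q)"
      using ev' by eventually_elim (use G w in \<open>auto simp: admissible_def\<close>)
  qed
  show "pairing (\<lambda>j. G' j x) d = 0" if d: "l2 d" "\<forall>w\<in>V. pairing (\<lambda>j. h j w) d = 0" and x: "x \<in> S'" for d x
  proof (rule hol_on_identity[OF S' hol_on_pairing[OF G' d(1)] _ q(2) _ x])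
    show "hol_on (\<lambda>_. 0) S'" using hol_on_cmult[of "G' 0" S' 0] G' by (simp add: resolution_def)
    show "eventually (\<lambda>x. pairing (\<lambda>j. G' j x) d = 0) (nhds q)"
      using ev' by eventually_elim (use G d in \<open>auto simp: admissible_def\<close>)
  qed
qed

lemma admissible_subset:
  assumes "admissible V S G" "T \<subseteq> S" "open T" "connected T"
  shows "admissible V T G"
  using assms unfolding admissible_def resolution_def by (blast intro: hol_on_subset)

lemma admissible_unique:
  assumes V: "base_region V" and G: "admissible V S G" and G': "admissible V S G'" and ne: "S \<noteq> {}"
  shows "\<exists>\<theta>. \<forall>x\<in>S. \<forall>j. G j x = cis \<theta> * G' j x"
proof -
  have S: "open S" "connected S" and res: "resolution S G" "resolution S G'"
    using G G' by (auto simp: admissible_def resolution_def)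
  have V': "open V" "connected V" "V \<subseteq> U" using V by (auto simp: base_region_def)
  have lh: "l2 (\<lambda>j. h j w)" if "w \<in> V" for w using l2_h V' that by auto
  note lG = resolution_l2[OF res(1)] and lG' = resolution_l2[OF res(2)]
  have resV: "resolution V h" using resolution_h V' unfolding resolution_def by (blast intro: hol_on_subset)
  have m1: "hol_on (\<lambda>x. pairing (\<lambda>j. G j x) (\<lambda>j. h j w)) S" and m2: "hol_on (\<lambda>x. pairing (\<lambda>j. G' j x) (\<lambda>j. h j w)) S"
    if "w \<in> V" for w using hol_on_pairing res lh that by auto
  have mod: "cmod (pairing (\<lambda>j. G j x) (\<lambda>j. h j w)) = cmod (pairing (\<lambda>j. G' j x) (\<lambda>j. h j w))"
    if "x \<in> S" "w \<in> V" for x w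
    by (rule powr_cancel_base[OF _ \<mu> norm_ge_zero norm_ge_zero])
       (simp only: admissible_modulus[OF G that(2,1)] admissible_modulus[OF G' that(2,1)])
  \<comment> \<open>Otherwise \<open>G'\<close> at z would be orthogonal to all \<open>h\<close> on
    V, hence by admissibility to itself, contradicting \<rho> > 0. The nonzero value is needed to
    compare the constants below.\<close>
  have "\<exists>z\<in>S. \<exists>w\<in>V. pairing (\<lambda>j. G' j z) (\<lambda>j. h j w) \<noteq> 0"
  proof (rule ccontr)
    assume *: "\<not> ?thesis"
    obtain z where z: "z \<in> S" using ne by blast
    have "pairing (\<lambda>j. h j w) (\<lambda>j. G' j z) = 0" if "w \<in> V" for w
      using * z that pairing_cnj[OF lG'(1)[OF z] lh[OF that]] by auto
    then have "pairing (\<lambda>j. G' j z) (\<lambda>j. G' j z) = 0"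
      by (rule admissible_pairing_eq_0[OF G' lG'(1)[OF z] _ z])
    then have "\<rho> z = 0" using pairing_self[OF lG'(1)[OF z]] lG'(2)[OF z] by simp
    then show False using pos[of z] by simp
  qed
  then obtain z0 w0 where zw: "z0 \<in> S" "w0 \<in> V" "pairing (\<lambda>j. G' j z0) (\<lambda>j. h j w0) \<noteq> 0" by blast
  obtain c where c: "cmod c = 1"
    "\<And>x. x \<in> S \<Longrightarrow> pairing (\<lambda>j. G j x) (\<lambda>j. h j w0) = c * pairing (\<lambda>j. G' j x) (\<lambda>j. h j w0)"
    using hol_on_equal_modulus[OF S m1[OF zw(2)] m2[OF zw(2)] mod[OF _ zw(2)]] by blast
  define T where "T = S \<inter> (\<lambda>x. pairing (\<lambda>j. G' j x) (\<lambda>j. h j w0)) -` (-{0})"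
  have T: "open T" "z0 \<in> T"
    unfolding T_def using zw
    by (auto intro!: continuous_open_preimage hol_on_continuous_on[OF S(1)] m2 S)
  have on_T: "pairing (\<lambda>j. G j z) (\<lambda>j. h j w) = c * pairing (\<lambda>j. G' j z) (\<lambda>j. h j w)"
    if z: "z \<in> T" and w: "w \<in> V" for z w
  proof -
    have zS: "z \<in> S" and nz: "pairing (\<lambda>j. G' j z) (\<lambda>j. h j w0) \<noteq> 0" using z by (auto simp: T_def)
    have flip: "pairing (\<lambda>j. h j w) (\<lambda>j. G j z) = cnj (pairing (\<lambda>j. G j z) (\<lambda>j. h j w))"
      "pairing (\<lambda>j. h j w) (\<lambda>j. G' j z) = cnj (pairing (\<lambda>j. G' j z) (\<lambda>j. h j w))" if "w \<in> V" for w
      using pairing_cnj lG(1)[OF zS] lG'(1)[OF zS] lh[OF that] by simp_all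
    \<comment> \<open>The roles are exchanged: for fixed z the pairings have equal modulus as
      functions of w, so they differ by a constant depending on z. Its conjugate is c, as seen at
      w0, where the pairing with \<open>G'\<close> is nonzero on T. So c serves every w, and the
      identity theorem then removes the restriction to T.\<close>
    have "\<exists>e. cmod e = 1 \<and> (\<forall>w\<in>V. pairing (\<lambda>j. h j w) (\<lambda>j. G j z) = e * pairing (\<lambda>j. h j w) (\<lambda>j. G' j z))"
      using lG(1)[OF zS] lG'(1)[OF zS] mod[OF zS]
      by (intro hol_on_equal_modulus V' hol_on_pairing[OF resV]) (simp_all add: flip)
    then obtain e where e: "\<And>w. w \<in> V \<Longrightarrow> pairing (\<lambda>j. h j w) (\<lambda>j. G j z) = e * pairing (\<lambda>j. h j w) (\<lambda>j. G' j z)"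
      by blast
    have e': "pairing (\<lambda>j. G j z) (\<lambda>j. h j w) = cnj e * pairing (\<lambda>j. G' j z) (\<lambda>j. h j w)" if "w \<in> V" for w
    proof -
      have "cnj (cnj (pairing (\<lambda>j. G j z) (\<lambda>j. h j w))) = cnj (e * cnj (pairing (\<lambda>j. G' j z) (\<lambda>j. h j w)))"
        using e[OF that] unfolding flip[OF that] by (rule arg_cong)
      then show ?thesis by simp
    qed
    have "cnj e = c" using e'[OF zw(2)] c(2)[OF zS] nz by simp
    then show ?thesis using e'[OF w] by simp
  qed
  have evT: "eventually (\<lambda>x. x \<in> T) (nhds z0)" using T by (rule eventually_nhds_in_open)
  have on_S: "pairing (\<lambda>j. G j z) (\<lambda>j. h j w) = c * pairing (\<lambda>j. G' j z) (\<lambda>j. h j w)"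
    if z: "z \<in> S" and w: "w \<in> V" for z w
  proof (rule hol_on_identity[OF S m1[OF w] hol_on_cmult[OF m2[OF w]] zw(1) _ z])
    show "eventually (\<lambda>z. pairing (\<lambda>j. G j z) (\<lambda>j. h j w) = c * pairing (\<lambda>j. G' j z) (\<lambda>j. h j w)) (nhds z0)"
      using evT by eventually_elim (use on_T w in auto)
  qed
  have GG': "G j z = c * G' j z" if z: "z \<in> S" for z j
  proof -
    define D where "D j = G j z - c * G' j z" for j
    have l: "l2 D" unfolding D_def by (rule l2_diff_scale[OF lG(1)[OF z] lG'(1)[OF z]])
    have "pairing (\<lambda>j. h j w) D = 0" if w: "w \<in> V" for w
    proof -
      have "pairing D (\<lambda>j. h j w) = 0"
        unfolding D_def pairing_diff_scale_left[OF lG(1)[OF z] lG'(1)[OF z] lh[OF w]]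
        using on_S[OF z w] by simp
      then show ?thesis using pairing_cnj[OF l lh[OF w]] by simp
    qed
    then have "pairing (\<lambda>j. G j z) D = 0" "pairing (\<lambda>j. G' j z) D = 0"
      using admissible_pairing_eq_0[OF G l _ z] admissible_pairing_eq_0[OF G' l _ z] by simp_all
    then have "pairing D D = 0"
      using pairing_diff_scale_left[OF lG(1)[OF z] lG'(1)[OF z] l, of c] by (simp add: D_def[abs_def])
    then have "l2sq D = 0" using pairing_self[OF l] by simp
    from l2_eq_0[OF l this, of j] show ?thesis by (simp add: D_def)
  qed
  have "cis (Arg c) = c" using rcis_cmod_Arg[of c] c(1) by (simp add: rcis_def)
  then show ?thesis using GG' by (intro exI[of _ "Arg c"]) simp
qed

text \<open>The neighbourhood is chosen before the germ: any admissible germ arriving at any of its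
  points extends over all of it. This is what allows continuation to pass every parameter of a
  curve.\<close>

lemma ex_extension_nbhd:
  assumes V: "base_region V"
  shows "\<exists>S. open S \<and> connected S \<and> p \<in> S \<and> (\<forall>S' G q. admissible V S' G \<longrightarrow> q \<in> S' \<longrightarrow> q \<in> S \<longrightarrow>
    (\<exists>G'. admissible V S G' \<and> eventually (\<lambda>x. \<forall>j. G' j x = G j x) (nhds q)))"
proof -
  obtain \<kappa> where k: "\<kappa> \<in> A" "p \<in> fst \<kappa>" using ex_chart by blast
  define c where "c = snd \<kappa> p"
  define \<phi> where "\<phi> = \<rho> \<circ> chart_inv \<kappa>"
  have "real_analytic_at \<phi> c"
    using ra k by (auto simp: mf_real_analytic_on_def \<phi>_def c_def)
  then show ?thesis
  proof (rule real_analytic_local_extension)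
    fix R
    assume R: "0 < R" and ext: "\<And>a e h. a \<in> ball c R \<Longrightarrow> 0 < e \<Longrightarrow> (\<And>j. sv_holomorphic_on (h j) (ball a e)) \<Longrightarrow>
       (\<And>y. y \<in> ball a e \<Longrightarrow> (\<lambda>j. (cmod (h j y))\<^sup>2) sums \<phi> y) \<Longrightarrow>
       \<exists>g d. 0 < d \<and> (\<forall>j. sv_holomorphic_on (g j) (ball c R)) \<and>
         (\<forall>y\<in>ball c R. (\<lambda>j. (cmod (g j y))\<^sup>2) sums \<phi> y) \<and> (\<forall>y\<in>ball a d. \<forall>j. g j y = h j y)"
    obtain r where r: "0 < r" "ball c r \<subseteq> snd \<kappa> ` fst \<kappa>"
      using chart(2)[OF k(1)] k(2) open_contains_ball unfolding c_def by blast
    define s where "s = min r R"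
    have s: "0 < s" "s \<le> R" "ball c s \<subseteq> snd \<kappa> ` fst \<kappa>" using r R by (auto simp: s_def)
    define S where "S = chart_inv \<kappa> ` ball c s"
    have B: "coord_ball S \<kappa> c s" using k s by (auto simp: coord_ball_def S_def)
    note SB = coord_ball[OF B]
    have "chart_inv \<kappa> c = p" using chart(5)[OF k(1,2)] by (simp add: c_def)
    then have p: "p \<in> S" using s unfolding S_def by (metis centre_in_ball imageI)
    have "\<exists>G'. admissible V S G' \<and> eventually (\<lambda>x. \<forall>j. G' j x = G j x) (nhds q)"
      if G: "admissible V S' G" and q: "q \<in> S'" "q \<in> S" for S' G q
    proof -
      have G': "open S'" "\<And>j. hol_on (G j) S'" "\<And>x. x \<in> S' \<Longrightarrow> (\<lambda>j. (cmod (G j x))\<^sup>2) sums \<rho> x"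
        using G by (auto simp: admissible_def resolution_def)
      define a where "a = snd \<kappa> q"
      have a: "a \<in> ball c s" "q \<in> fst \<kappa>" "chart_inv \<kappa> a = q"
        using q SB chart(5)[OF k(1)] unfolding a_def by blast+
      have "open (snd \<kappa> ` (fst \<kappa> \<inter> S'))" "a \<in> snd \<kappa> ` (fst \<kappa> \<inter> S')"
        using open_chart_image[OF k(1) G'(1)] a q by (auto simp: a_def)
      then obtain e where e: "0 < e" "ball a e \<subseteq> snd \<kappa> ` (fst \<kappa> \<inter> S')" using open_contains_ball by metis
      have inS': "chart_inv \<kappa> y \<in> S'" if "y \<in> ball a e" for y
      proof -
        have "y \<in> snd \<kappa> ` (fst \<kappa> \<inter> S')" using that e(2) by blast
        then show ?thesis using chart(5)[OF k(1)] by auto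
      qed
      have "\<exists>g d. 0 < d \<and> (\<forall>j. sv_holomorphic_on (g j) (ball c R)) \<and>
         (\<forall>y\<in>ball c R. (\<lambda>j. (cmod (g j y))\<^sup>2) sums \<phi> y) \<and> (\<forall>y\<in>ball a d. \<forall>j. g j y = (G j \<circ> chart_inv \<kappa>) y)"
      proof (rule ext[OF _ e(1)])
        show "a \<in> ball c R" using a s by auto
        show "sv_holomorphic_on (G j \<circ> chart_inv \<kappa>) (ball a e)" for j
          using G'(2)[of j] k e(2) unfolding mf_holomorphic_on_def by (blast intro: sv_holomorphic_on_subset)
        show "(\<lambda>j. (cmod ((G j \<circ> chart_inv \<kappa>) y))\<^sup>2) sums \<phi> y" if "y \<in> ball a e" for y
          using G'(3)[OF inS'[OF that]] by (simp add: \<phi>_def)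
      qed
      then obtain g d where g0: "0 < d" "\<forall>j. sv_holomorphic_on (g j) (ball c R)"
        "\<forall>y\<in>ball c R. (\<lambda>j. (cmod (g j y))\<^sup>2) sums \<phi> y" "\<forall>y\<in>ball a d. \<forall>j. g j y = (G j \<circ> chart_inv \<kappa>) y"
        by (elim exE conjE) (rule that)
      note g = g0(1) g0(2)[rule_format] g0(3)[rule_format] g0(4)[unfolded o_def, rule_format]
      define G1 where "G1 j x = g j (snd \<kappa> x)" for j x
      have res: "resolution S G1"
        unfolding resolution_def
      proof (intro conjI allI ballI SB)
        show "hol_on (G1 j) S" for j
        proof (rule hol_on_from_chart[OF k(1) SB(1,3)])
          have "sv_holomorphic_on (g j) (ball c s)"
            using g(2) by (rule sv_holomorphic_on_subset) (use s in auto)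
          then show "sv_holomorphic_on (G1 j \<circ> chart_inv \<kappa>) (snd \<kappa> ` S)"
            unfolding SB(4)
            by (rule sv_holomorphic_on_cong_open[OF open_ball])
               (use s(3) chart(6)[OF k(1)] in \<open>auto simp: G1_def\<close>)
        qed
        fix x assume x: "x \<in> S"
        then have "snd \<kappa> x \<in> ball c s" using SB(4) by blast
        then have "snd \<kappa> x \<in> ball c R" using s(2) by simp
        moreover have "chart_inv \<kappa> (snd \<kappa> x) = x" using x SB(3) chart(5)[OF k(1)] by blast
        ultimately show "(\<lambda>j. (cmod (G1 j x))\<^sup>2) sums \<rho> x"
          using g(3)[of "snd \<kappa> x"] by (simp add: G1_def \<phi>_def)
      qed
      have "eventually (\<lambda>x. x \<in> fst \<kappa> \<inter> snd \<kappa> -` ball a d) (nhds q)"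
        using continuous_open_preimage[OF chart(3,1)[OF k(1)] open_ball[of a d]] a g(1)
        by (intro eventually_nhds_in_open) (auto simp: a_def)
      then have ev: "eventually (\<lambda>x. \<forall>j. G1 j x = G j x) (nhds q)"
        by eventually_elim (use g(4) chart(5)[OF k(1)] in \<open>auto simp: G1_def\<close>)
      show ?thesis
        using admissible_transfer[OF V G res q ev] ev by blast
    qed
    then show ?thesis using SB(1,2) p by blast
  qed
qed


section \<open>Continuation of admissible resolutions along curves\<close>

text \<open>This is \<open>continuation_along\<close> for all components at once, with one
  neighbourhood per parameter common to all of them and admissibility carried along, so that the
  uniqueness results apply at the end point.\<close>

definition family :: "'m set \<Rightarrow> (real \<Rightarrow> 'm) \<Rightarrow> real \<Rightarrow> (real \<Rightarrow> 'm set) \<Rightarrow> (real \<Rightarrow> nat \<Rightarrow> 'm \<Rightarrow> complex) \<Rightarrow> bool" where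
  "family V \<gamma> t S F \<longleftrightarrow> (\<forall>s\<in>{0..t}. admissible V (S s) (F s) \<and> \<gamma> s \<in> S s) \<and>
     (\<forall>\<^sub>F x in nhds (\<gamma> 0). \<forall>j. F 0 j x = h j x) \<and>
     (\<forall>s\<in>{0..t}. \<forall>\<^sub>F s' in at s within {0..t}. \<forall>\<^sub>F x in nhds (\<gamma> s'). \<forall>j. F s' j x = F s j x)"

lemma family_restrict:
  assumes "family V \<gamma> t S F" "t' \<le> t"
  shows "family V \<gamma> t' S F"
proof -
  have sub: "{0..t'} \<subseteq> {0..t}" using assms(2) by auto
  show ?thesis
    unfolding family_def
  proof (intro conjI ballI)
    fix s assume "s \<in> {0..t'}"
    then have s: "s \<in> {0..t}" using sub by blast
    show "admissible V (S s) (F s)" "\<gamma> s \<in> S s" using assms(1) s by (simp_all add: family_def)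
    have "\<forall>\<^sub>F s' in at s within {0..t}. \<forall>\<^sub>F x in nhds (\<gamma> s'). \<forall>j. F s' j x = F s j x"
      using assms(1) s by (simp add: family_def)
    then show "\<forall>\<^sub>F s' in at s within {0..t'}. \<forall>\<^sub>F x in nhds (\<gamma> s'). \<forall>j. F s' j x = F s j x"
      by (rule filter_leD[OF at_le[OF sub]])
  qed (use assms(1) in \<open>simp add: family_def\<close>)
qed

text \<open>Beyond t the curve stays in the domain of a single resolution G, so the family can be
  prolonged by the constant choice G.\<close>

lemma family_extend:
  assumes fam: "family V \<gamma> t S F" and t: "0 \<le> t" "t < t'"
    and G: "admissible V T G" and ev: "eventually (\<lambda>x. \<forall>j. G j x = F t j x) (nhds (\<gamma> t))"
    and \<gamma>T: "\<And>s. t \<le> s \<Longrightarrow> s \<le> t' \<Longrightarrow> \<gamma> s \<in> T"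
    and \<gamma>: "path \<gamma>" "t' \<le> 1"
  shows "family V \<gamma> t' (\<lambda>s. if s \<le> t then S s else T) (\<lambda>s. if s \<le> t then F s else G)"
  unfolding family_def
proof (intro conjI ballI)
  let ?F = "\<lambda>s. if s \<le> t then F s else G"
  show "\<forall>\<^sub>F x in nhds (\<gamma> 0). \<forall>j. ?F 0 j x = h j x"
    using fam t by (simp add: family_def)
  fix s assume s: "s \<in> {0..t'}"
  show "admissible V (if s \<le> t then S s else T) (if s \<le> t then F s else G)" "\<gamma> s \<in> (if s \<le> t then S s else T)"
    using fam s G \<gamma>T[of s] by (auto simp: family_def)
  show "\<forall>\<^sub>F s' in at s within {0..t'}. \<forall>\<^sub>F x in nhds (\<gamma> s'). \<forall>j. ?F s' j x = ?F s j x"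
  proof (cases "s \<le> t")
    case False
    then have "\<forall>\<^sub>F s' in at s within {0..t'}. t < s'"
      by (intro order_tendstoD tendsto_ident_at) auto
    then show ?thesis
      by eventually_elim (use False in simp)
  next
    case True
    then have "\<forall>\<^sub>F s' in at s within {0..t}. \<forall>\<^sub>F x in nhds (\<gamma> s'). \<forall>j. F s' j x = F s j x"
      using fam s by (simp add: family_def)
    then obtain d where d: "d > 0"
      "\<And>s'. s' \<in> {0..t} \<Longrightarrow> s' \<noteq> s \<Longrightarrow> dist s' s < d \<Longrightarrow> (\<forall>\<^sub>F x in nhds (\<gamma> s'). \<forall>j. F s' j x = F s j x)"
      unfolding eventually_at by blast
    have near: "\<forall>\<^sub>F s' in at s within {0..t'}. dist s' s < d \<and> s' \<in> {0..t'} \<and> s' \<noteq> s"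
      unfolding eventually_at using d(1) by blast
    \<comment> \<open>Parameters beyond t come arbitrarily close to s only at the junction s = t.
      There G and \<open>F t\<close> agree on an open set W, hence near every curve point that lies
      in W.\<close>
    have right: "\<forall>\<^sub>F s' in at s within {0..t'}. t < s' \<longrightarrow> (\<forall>\<^sub>F x in nhds (\<gamma> s'). \<forall>j. G j x = F s j x)"
    proof (cases "s = t")
      case True
      obtain W where W: "open W" "\<gamma> t \<in> W" "\<forall>x\<in>W. \<forall>j. G j x = F t j x"
        using ev unfolding eventually_nhds by blast
      have "\<forall>\<^sub>F s' in at s within {0..t'}. \<gamma> s' \<in> W"
        using isCont_path_eventually[OF \<gamma> s W(1)] W(2) True by simp
      then show ?thesis
      proof eventually_elim
        fix s' assume "\<gamma> s' \<in> W"
        then have "\<forall>\<^sub>F x in nhds (\<gamma> s'). x \<in> W" using W(1) by (intro eventually_nhds_in_open)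
        then have "\<forall>\<^sub>F x in nhds (\<gamma> s'). \<forall>j. G j x = F s j x"
          by eventually_elim (use W True in blast)
        then show "t < s' \<longrightarrow> (\<forall>\<^sub>F x in nhds (\<gamma> s'). \<forall>j. G j x = F s j x)" by blast
      qed
    next
      case False
      then have "\<forall>\<^sub>F s' in at s within {0..t'}. s' < t"
        using True by (intro order_tendstoD tendsto_ident_at) auto
      then show ?thesis by eventually_elim simp
    qed
    from near right show ?thesis
    proof eventually_elim
      case (elim s')
      then show ?case using d(2)[of s'] True by auto
    qed
  qed
qed

text \<open>Existence up to t is locally constant in t: near a parameter a the curve stays in one
  extension neighbourhood, so a family reaching any nearby parameter can be prolonged to the others
  or restricted to them. The interval is connected and the case t = 0 is given by
  \<open>h\<close>.\<close>

lemma ex_family: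
  assumes V: "base_region V" and \<gamma>: "path \<gamma>" "\<gamma> 0 \<in> U" and t: "t \<in> {0..1}"
  shows "\<exists>S F. family V \<gamma> t S F"
proof -
  define P where "P t \<longleftrightarrow> (\<exists>S F. family V \<gamma> t S F)" for t
  have "P 0"
    unfolding P_def family_def
    by (rule exI[of _ "\<lambda>_. U"], rule exI[of _ "\<lambda>_. h"]) (use \<gamma>(2) admissible_h[OF V] in simp)
  have "\<forall>a\<in>{0..1}. eventually (\<lambda>b. P a = P b) (at a within {0..1})"
  proof
    fix a :: real assume a: "a \<in> {0..1}"
    obtain T where T: "open T" "\<gamma> a \<in> T"
      and ext: "\<And>S' G q. admissible V S' G \<Longrightarrow> q \<in> S' \<Longrightarrow> q \<in> T \<Longrightarrow>
        (\<exists>G'. admissible V T G' \<and> eventually (\<lambda>x. \<forall>j. G' j x = G j x) (nhds q))"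
      using ex_extension_nbhd[OF V, of "\<gamma> a"] by metis
    have "eventually (\<lambda>b. \<gamma> b \<in> T) (at a within {0..1})"
      using isCont_path_eventually[OF \<gamma>(1) order_refl a T(1,2)] .
    then obtain d where d: "d > 0" "\<And>b. b \<in> {0..1} \<Longrightarrow> b \<noteq> a \<Longrightarrow> dist b a < d \<Longrightarrow> \<gamma> b \<in> T"
      unfolding eventually_at by blast
    have d': "\<gamma> b \<in> T" if "b \<in> {0..1}" "dist b a < d" for b
      using d(2)[OF that(1) _ that(2)] T(2) by (cases "b = a") auto
    have imp: "P s2" if s1: "s1 \<in> {0..1}" "dist s1 a < d" "P s1" and s2: "s2 \<in> {0..1}" "dist s2 a < d" for s1 s2
    proof (cases "s2 \<le> s1")
      case True
      then show ?thesis using s1(3) family_restrict unfolding P_def by blast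
    next
      case False
      obtain S F where fam: "family V \<gamma> s1 S F" using s1(3) by (auto simp: P_def)
      then have "admissible V (S s1) (F s1)" "\<gamma> s1 \<in> S s1" using s1(1) by (auto simp: family_def)
      then obtain G where G: "admissible V T G" "eventually (\<lambda>x. \<forall>j. G j x = F s1 j x) (nhds (\<gamma> s1))"
        using ext d'[OF s1(1,2)] by blast
      have "\<gamma> s \<in> T" if "s1 \<le> s" "s \<le> s2" for s
        using that s1 s2 by (intro d') (auto simp: dist_real_def)
      then have "family V \<gamma> s2 (\<lambda>s. if s \<le> s1 then S s else T) (\<lambda>s. if s \<le> s1 then F s else G)"
        using s1 s2 False by (intro family_extend[OF fam _ _ G _ \<gamma>(1)]) auto
      then show ?thesis unfolding P_def by blast
    qed
    have "eventually (\<lambda>b. b \<in> {0..1} \<and> dist b a < d) (at a within {0..1})"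
      unfolding eventually_at using d(1) by blast
    then show "eventually (\<lambda>b. P a = P b) (at a within {0..1})"
    proof eventually_elim
      case (elim b)
      then show ?case using imp[of a b] imp[of b a] a d(1) by auto
    qed
  qed
  from connected_local_const[OF _ _ t this, of 0] \<open>P 0\<close> have "P t" by simp
  then show ?thesis by (simp add: P_def)
qed

lemma continuation_of_family:
  assumes "family V \<gamma> t S F" "0 \<le> t"
  shows "continuation_along A (h j) \<gamma> t (S t) (F t j)"
  unfolding continuation_along_def
proof (intro exI[of _ S] exI[of _ "\<lambda>s. F s j"] conjI ballI)
  fix s assume s: "s \<in> {0..t}"
  show "open (S s)" "\<gamma> s \<in> S s" "hol_on (F s j) (S s)"
    using assms(1) s by (auto simp: family_def admissible_def resolution_def)
  have "\<forall>\<^sub>F s' in at s within {0..t}. \<forall>\<^sub>F x in nhds (\<gamma> s'). \<forall>j. F s' j x = F s j x"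
    using assms(1) s by (simp add: family_def)
  then show "\<forall>\<^sub>F s' in at s within {0..t}. \<forall>\<^sub>F x in nhds (\<gamma> s'). F s' j x = F s j x"
    by (auto elim!: eventually_mono)
next
  have "\<forall>\<^sub>F x in nhds (\<gamma> 0). \<forall>j. F 0 j x = h j x" using assms(1) by (simp add: family_def)
  then show "\<forall>\<^sub>F x in nhds (\<gamma> 0). F 0 j x = h j x" by (auto elim!: eventually_mono)
qed auto

text \<open>Agreement of the two germs at \<gamma>(s) is locally constant in s, by the identity
  theorem on a coordinate ball around a nearby curve point. The given continuation concerns a single
  component; the lemma ties it to a family in which all components are present, so that results for
  whole resolutions become usable for one function.\<close>

lemma family_unique:
  assumes fam: "family V \<gamma> 1 S F" and \<gamma>: "path \<gamma>" and c: "continuation_along A (h j) \<gamma> 1 W g"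
  shows "open W" "\<gamma> 1 \<in> W" "hol_on g W" "eventually (\<lambda>x. g x = F 1 j x) (nhds (\<gamma> 1))"
proof -
  obtain V' F' where V': "\<And>s. s \<in> {0..1} \<Longrightarrow> open (V' s) \<and> \<gamma> s \<in> V' s \<and> hol_on (F' s) (V' s)"
    and start: "\<forall>\<^sub>F x in nhds (\<gamma> 0). F' 0 x = h j x"
    and loc: "\<And>s. s \<in> {0..1} \<Longrightarrow> \<forall>\<^sub>F s' in at s within {0..1}. \<forall>\<^sub>F x in nhds (\<gamma> s'). F' s' x = F' s x"
    and fin: "V' 1 = W" "F' 1 = g"
    using c unfolding continuation_along_def by blast
  show "open W" "\<gamma> 1 \<in> W" "hol_on g W" using V'[of 1] fin by auto
  define P where "P s \<longleftrightarrow> (\<forall>\<^sub>F x in nhds (\<gamma> s). F' s x = F s j x)" for s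
  have "\<forall>\<^sub>F x in nhds (\<gamma> 0). \<forall>j. F 0 j x = h j x" using fam by (simp add: family_def)
  with start have "P 0" unfolding P_def by eventually_elim simp
  have "\<forall>a\<in>{0..1}. eventually (\<lambda>b. P a = P b) (at a within {0..1})"
  proof
    fix a :: real assume a: "a \<in> {0..1}"
    have S: "open (S a)" "\<gamma> a \<in> S a" "hol_on (F a j) (S a)"
      using fam a by (auto simp: family_def admissible_def resolution_def)
    obtain B \<kappa> r where B: "coord_ball B \<kappa> (snd \<kappa> (\<gamma> a)) r" "\<gamma> a \<in> B" "B \<subseteq> S a \<inter> V' a"
      using ex_coord_ball[of "S a \<inter> V' a" "\<gamma> a"] S V'[OF a] by (metis IntI open_Int)
    note SB = coord_ball(1,2)[OF B(1)]
    have hol: "hol_on (F a j) B" "hol_on (F' a) B" using S V'[OF a] B(3) hol_on_subset by blast+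
    have e1: "\<forall>\<^sub>F b in at a within {0..1}. \<forall>\<^sub>F x in nhds (\<gamma> b). \<forall>j. F b j x = F a j x"
      using fam a by (simp add: family_def)
    have e2: "\<forall>\<^sub>F b in at a within {0..1}. \<gamma> b \<in> B"
      by (rule isCont_path_eventually[OF \<gamma> order_refl a SB(1) B(2)])
    from e1 loc[OF a] e2 show "eventually (\<lambda>b. P a = P b) (at a within {0..1})"
    proof eventually_elim
      case (elim b)
      have nb: "\<forall>\<^sub>F x in nhds (\<gamma> b). x \<in> B" "\<forall>\<^sub>F x in nhds (\<gamma> a). x \<in> B"
        using SB(1) elim(3) B(2) by (auto intro: eventually_nhds_in_open)
      show "P a = P b"
      proof
        assume "P a"
        then have "F' a y = F a j y" if "y \<in> B" for y
          using hol_on_identity[OF SB hol(2,1) B(2) _ that] by (simp add: P_def)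
        with nb(1) have "\<forall>\<^sub>F x in nhds (\<gamma> b). F' a x = F a j x" by (auto elim!: eventually_mono)
        with elim(1,2) show "P b" unfolding P_def by eventually_elim simp
      next
        assume "P b"
        with elim(1,2) have "\<forall>\<^sub>F x in nhds (\<gamma> b). F' a x = F a j x"
          unfolding P_def by eventually_elim simp
        then have "F' a y = F a j y" if "y \<in> B" for y
          using hol_on_identity[OF SB hol(2,1) elim(3) _ that] by simp
        with nb(2) show "P a" unfolding P_def by (auto elim!: eventually_mono)
      qed
    qed
  qed
  from connected_local_const[OF _ _ _ this, of 0 1] \<open>P 0\<close> have "P 1" by simp
  then show "eventually (\<lambda>x. g x = F 1 j x) (nhds (\<gamma> 1))" by (simp add: P_def fin)
qed

lemma family_unique_on:
  assumes "family V \<gamma> 1 S F" "path \<gamma>" "continuation_along A (h j) \<gamma> 1 W g"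
    and B: "open B" "connected B" "\<gamma> 1 \<in> B" "B \<subseteq> S 1" "B \<subseteq> W" and x: "x \<in> B"
  shows "g x = F 1 j x"
proof (rule hol_on_identity[OF B(1,2) _ _ B(3) family_unique(4)[OF assms(1-3)] x])
  show "hol_on g B" using family_unique(3)[OF assms(1-3)] B(5) by (rule hol_on_subset)
  have "hol_on (F 1 j) (S 1)" using assms(1) by (simp add: family_def admissible_def resolution_def)
  then show "hol_on (F 1 j) B" using B(4) by (rule hol_on_subset)
qed

text \<open>Dini's theorem: the partial sums increase to the continuous limit \<open>\<rho>\<close>.\<close>

lemma resolution_locally_uniform:
  assumes "resolution S G"
  shows "locally_uniformly_convergent_on S (sq_partial_sum G)"
  unfolding locally_uniformly_convergent_on_def
proof
  fix p assume p: "p \<in> S"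
  have S: "open S" and hol: "\<And>j. hol_on (G j) S" and sums: "\<And>x. x \<in> S \<Longrightarrow> (\<lambda>j. (cmod (G j x))\<^sup>2) sums \<rho> x"
    using assms by (auto simp: resolution_def)
  obtain B \<kappa> r where B: "coord_ball B \<kappa> (snd \<kappa> p) r" "p \<in> B" "B \<subseteq> S"
    using ex_coord_ball[OF S p] by metis
  define C where "C = chart_inv \<kappa> ` cball (snd \<kappa> p) (r / 2)"
  have \<kappa>: "\<kappa> \<in> A" "0 < r" "ball (snd \<kappa> p) r \<subseteq> snd \<kappa> ` fst \<kappa>" "B = chart_inv \<kappa> ` ball (snd \<kappa> p) r"
    using B by (auto simp: coord_ball_def)
  have sub: "cball (snd \<kappa> p) (r / 2) \<subseteq> ball (snd \<kappa> p) r" using \<kappa>(2) by auto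
  have "compact C"
    unfolding C_def using sub \<kappa>(3)
    by (intro compact_continuous_image continuous_on_subset[OF chart(4)[OF \<kappa>(1)]]) auto
  have CS: "C \<subseteq> S" using sub B \<kappa>(4) by (auto simp: C_def)
  define W where "W = chart_inv \<kappa> ` ball (snd \<kappa> p) (r / 2)"
  have WB: "coord_ball W \<kappa> (snd \<kappa> p) (r / 2)"
    using \<kappa> sub by (auto simp: coord_ball_def W_def)
  have WC: "W \<subseteq> C" unfolding W_def C_def by (intro image_mono ball_subset_cball)
  have "snd \<kappa> p \<in> snd \<kappa> ` B" using B by auto
  have "chart_inv \<kappa> (snd \<kappa> p) = p"
    using coord_ball(3)[OF B(1)] B(2) chart(5)[OF \<kappa>(1)] by blast
  then have pW: "p \<in> W" unfolding W_def using \<kappa>(2) by (metis centre_in_ball half_gt_zero imageI)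
  have mono: "sq_partial_sum G m x \<le> sq_partial_sum G n x" if "m \<le> n" for m n x
    unfolding sq_partial_sum_def using that by (intro sum_mono2) auto
  have le: "sq_partial_sum G n x \<le> \<rho> x" if "x \<in> S" for n x
    unfolding sq_partial_sum_def using resolution_l2[OF assms that] partial_l2sq_le[of "\<lambda>j. G j x" n] by simp
  have "uniform_limit C (sq_partial_sum G) \<rho> sequentially"
  proof (rule uniform_limitI)
    fix e :: real assume e: "0 < e"
    define O' where "O' n = S \<inter> (\<lambda>x. \<rho> x - sq_partial_sum G n x) -` {..<e}" for n
    have op: "open (O' n)" for n
      unfolding O'_def sq_partial_sum_def
      by (intro continuous_open_preimage continuous_intros S open_lessThan
          continuous_on_subset[OF continuous_rho] hol_on_continuous_on[OF S hol]) auto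
    have cov: "C \<subseteq> (\<Union>n. O' n)"
    proof
      fix x assume "x \<in> C"
      then have x: "x \<in> S" using CS by blast
      have "(\<lambda>n. sq_partial_sum G n x) \<longlonglongrightarrow> \<rho> x"
        using sums[OF x] by (simp add: sums_def sq_partial_sum_def)
      then have "eventually (\<lambda>n. \<rho> x - e < sq_partial_sum G n x) sequentially"
        by (rule order_tendstoD) (use e in simp)
      then obtain n where "\<rho> x - e < sq_partial_sum G n x"
        unfolding eventually_sequentially by blast
      then have "x \<in> O' n" using x by (simp add: O'_def)
      then show "x \<in> (\<Union>n. O' n)" by blast
    qed
    obtain I where I: "finite I" "C \<subseteq> (\<Union>n\<in>I. O' n)"
      by (rule compactE_image[OF \<open>compact C\<close> op cov], rule that)
    show "eventually (\<lambda>n. \<forall>x\<in>C. dist (sq_partial_sum G n x) (\<rho> x) < e) sequentially"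
      unfolding eventually_sequentially
    proof (intro exI allI impI ballI)
      \<comment> \<open>The partial sums increase with the index, so the largest index of the finite
        subcover works everywhere; inserting 0 keeps the maximum defined if I is empty.\<close>
      fix n x assume n: "Max (insert 0 I) \<le> n" and x: "x \<in> C"
      obtain i where i: "i \<in> I" "x \<in> O' i" using subsetD[OF I(2) x] by (elim UN_E) (rule that)
      have "i \<le> Max (insert 0 I)" using i(1) I(1) by (intro Max_ge) auto
      then have "i \<le> n" using n by linarith
      then have "\<rho> x - sq_partial_sum G n x < e" using mono[of i n x] i by (auto simp: O'_def)
      then show "dist (sq_partial_sum G n x) (\<rho> x) < e"
        using le[of x n] x CS by (auto simp: dist_real_def)
    qed
  qed
  then have "uniformly_convergent_on (W \<inter> S) (sq_partial_sum G)"
    using WC by (intro uniformly_convergentI[OF uniform_limit_on_subset]) auto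
  then show "\<exists>W. open W \<and> p \<in> W \<and> uniformly_convergent_on (W \<inter> S) (sq_partial_sum G)"
    using coord_ball(1)[OF WB] pW by blast
qed

text \<open>The orthogonality condition, tested with the j-th unit vector, says that a component
  vanishing identically in \<open>h\<close> stays zero in every admissible resolution. Padding thus
  survives continuation.\<close>

lemma admissible_component_zero:
  assumes V: "base_region V" and G: "admissible V S G" and x: "x \<in> S" and 0: "\<And>w. h j w = 0"
  shows "G j x = 0"
proof -
  define d :: "nat \<Rightarrow> complex" where "d i = (if i = j then 1 else 0)" for i
  have pd: "pairing a d = a j" for a
  proof -
    have "(\<lambda>i. a i * cnj (d i)) = (\<lambda>i. if i = j then a i else 0)" by (auto simp: d_def)
    then show ?thesis using sums_single[of j a] by (simp add: pairing_def sums_iff)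
  qed
  have "(\<lambda>i. (cmod (d i))\<^sup>2) = (\<lambda>i. if i = j then 1 else 0)" by (auto simp: d_def)
  then have "l2 d" using sums_single[of j "\<lambda>_. 1 :: real"] by (simp add: l2_def sums_iff)
  then show ?thesis using admissible_pairing_eq_0[OF G _ _ x, of d] 0 by (simp add: pd)
qed

lemma ex_admissible: "base_region V \<Longrightarrow> \<exists>S G. admissible V S G \<and> q \<in> S"
proof -
  assume V: "base_region V"
  obtain \<gamma> where \<gamma>: "path \<gamma>" "pathstart \<gamma> \<in> U" "pathfinish \<gamma> = q"
    using ex_path[OF U(3), of q] by metis
  then obtain S F where "family V \<gamma> 1 S F"
    using ex_family[OF V \<gamma>(1), of 1] by (auto simp: pathstart_def)
  then have "admissible V (S 1) (F 1)" "\<gamma> 1 \<in> S 1" by (auto simp: family_def)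
  then show ?thesis using \<gamma>(3) by (auto simp: pathfinish_def)
qed

text \<open>The intersection of two domains may be disconnected, so uniqueness is applied on a
  coordinate ball around q inside it; T leaves room for further constraints on that ball.\<close>

lemma admissible_unique_at:
  assumes V: "base_region V" and G: "admissible V S G" "admissible V S' G'" and q: "q \<in> S" "q \<in> S'" and T: "open T" "q \<in> T"
  obtains B \<kappa> r \<theta> where "coord_ball B \<kappa> (snd \<kappa> q) r" "q \<in> B" "B \<subseteq> S \<inter> S' \<inter> T"
    "\<And>x j. x \<in> B \<Longrightarrow> G j x = cis \<theta> * G' j x"
proof -
  have "open (S \<inter> S' \<inter> T)" "q \<in> S \<inter> S' \<inter> T" using G q T by (auto simp: admissible_def resolution_def)
  then obtain B \<kappa> r where B: "coord_ball B \<kappa> (snd \<kappa> q) r" "q \<in> B" "B \<subseteq> S \<inter> S' \<inter> T"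
    using ex_coord_ball by metis
  note SB = coord_ball(1,2)[OF B(1)]
  have sub: "B \<subseteq> S" "B \<subseteq> S'" "B \<noteq> {}" using B by auto
  obtain \<theta> where "\<forall>x\<in>B. \<forall>j. G j x = cis \<theta> * G' j x"
    using admissible_unique[OF V admissible_subset[OF G(1) sub(1) SB] admissible_subset[OF G(2) sub(2) SB] sub(3)] by blast
  then show thesis using that[OF B] by blast
qed

end

section \<open>Locality of analyticity and of the differential operators; projective classes\<close>

lemma real_analytic_at_cong:
  assumes "real_analytic_at f x" "eventually (\<lambda>y. f y = g y) (nhds x)"
  shows "real_analytic_at g x"
proof -
  obtain r a where r: "r > 0" "\<forall>y\<in>ball x r. ((\<lambda>\<alpha>. a \<alpha> * (\<Prod>b\<in>Basis. ((y - x) \<bullet> b) ^ \<alpha> b)) has_sum f y)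
      {\<alpha>. \<forall>b. b \<notin> Basis \<longrightarrow> \<alpha> b = 0}"
    using assms(1) unfolding real_analytic_at_def by blast
  obtain d where d: "d > 0" "\<forall>y. dist y x < d \<longrightarrow> f y = g y"
    using assms(2) unfolding eventually_nhds_metric by blast
  show ?thesis
    unfolding real_analytic_at_def
  proof (intro exI[of _ "min r d"] conjI exI[of _ a] ballI)
    fix y assume "y \<in> ball x (min r d)"
    then have y: "y \<in> ball x r" "f y = g y" using d(2) by (auto simp: dist_commute)
    from bspec[OF r(2) y(1)] show "((\<lambda>\<alpha>. a \<alpha> * (\<Prod>b\<in>Basis. ((y - x) \<bullet> b) ^ \<alpha> b)) has_sum g y) {\<alpha>. \<forall>b. b \<notin> Basis \<longrightarrow> \<alpha> b = 0}"
      unfolding y(2) .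
  qed (use r d in simp)
qed

text \<open>\<open>frechet_derivative\<close> is a choice among the derivatives. Equal germs have
  the same derivatives and so the same choice, whether or not any derivative exists.\<close>

lemma frechet_derivative_cong_eventually:
  assumes "eventually (\<lambda>x. f x = g x) (nhds x)"
  shows "frechet_derivative f (at x) = frechet_derivative g (at x)"
proof -
  have ev: "eventually (\<lambda>x. f x = g x) (at x)" "eventually (\<lambda>x. g x = f x) (at x)"
    using assms by (auto simp: eventually_at_filter elim: eventually_mono)
  have "(f has_derivative D) (at x) \<longleftrightarrow> (g has_derivative D) (at x)" for D
    using has_derivative_transform_eventually[OF _ ev(1)] has_derivative_transform_eventually[OF _ ev(2)]
      eventually_nhds_x_imp_x[OF assms] by auto
  then show ?thesis by (simp add: frechet_derivative_def)
qed

lemma wirtinger_cong: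
  assumes "eventually (\<lambda>x. f x = g x) (nhds x)"
  shows "wirtinger j f x = wirtinger j g x" "wirtinger_bar j f x = wirtinger_bar j g x"
  using frechet_derivative_cong_eventually[OF assms] by (simp_all add: wirtinger_def wirtinger_bar_def)

lemma i_ddbar_cong:
  assumes "eventually (\<lambda>x. f (chart_inv \<kappa> x) = g (chart_inv \<kappa> x)) (nhds (snd \<kappa> p))"
  shows "i_ddbar f \<kappa> p u v = i_ddbar g \<kappa> p u v"
proof -
  have "eventually (\<lambda>x. wirtinger_bar k (\<lambda>x. complex_of_real (f (chart_inv \<kappa> x))) x =
      wirtinger_bar k (\<lambda>x. complex_of_real (g (chart_inv \<kappa> x))) x) (nhds (snd \<kappa> p))" for k
  proof -
    \<comment> \<open>The operator is of second order: the inner derivatives have to agree near the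
      point and not only at it, so the equality of germs is spread to all nearby points.\<close>
    have "eventually (\<lambda>x. eventually (\<lambda>x. f (chart_inv \<kappa> x) = g (chart_inv \<kappa> x)) (nhds x)) (nhds (snd \<kappa> p))"
      using assms by (simp only: eventually_eventually)
    then show ?thesis
    proof eventually_elim
      case (elim x)
      then have "eventually (\<lambda>x. complex_of_real (f (chart_inv \<kappa> x)) = complex_of_real (g (chart_inv \<kappa> x))) (nhds x)"
        by eventually_elim simp
      then show ?case by (rule wirtinger_cong(2))
    qed
  qed
  from wirtinger_cong(1)[OF this] show ?thesis by (simp add: i_ddbar_def)
qed

lemma proj_class_scale:
  assumes "z \<in> cspace N - {\<lambda>_. 0}" "w \<in> cspace N - {\<lambda>_. 0}" "c \<noteq> 0" "w = (\<lambda>j. c * z j)"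
  shows "proj_class N z = proj_class N w"
proof -
  have z: "z = (\<lambda>j. inverse c * w j)" using assms by auto
  have "(z, u) \<in> proj_rel N \<longleftrightarrow> (w, u) \<in> proj_rel N" for u
  proof
    assume "(z, u) \<in> proj_rel N"
    then obtain d where d: "u \<in> cspace N - {\<lambda>_. 0}" "d \<noteq> 0" "u = (\<lambda>j. d * z j)" by (auto simp: proj_rel_def)
    have "u = (\<lambda>j. (d * inverse c) * w j)" unfolding d(3) by (subst z) (simp add: mult.assoc)
    then show "(w, u) \<in> proj_rel N" using d assms unfolding proj_rel_def
      by (auto intro!: exI[of _ "d * inverse c"])
  next
    assume "(w, u) \<in> proj_rel N"
    then obtain d where d: "u \<in> cspace N - {\<lambda>_. 0}" "d \<noteq> 0" "u = (\<lambda>j. d * w j)" by (auto simp: proj_rel_def)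
    have "u = (\<lambda>j. (d * c) * z j)" unfolding d(3) assms(4) by (simp add: mult.assoc)
    then show "(z, u) \<in> proj_rel N" using d assms(1,3) unfolding proj_rel_def
      by (auto intro!: exI[of _ "d * c"])
  qed
  then show ?thesis by (auto simp: proj_class_def)
qed

theorem theorem8:
  fixes A :: "('m::{t2_space, second_countable_topology}, 'n::finite) chart set"
    and \<omega> :: "('m, 'n) form2"
    and \<rho> :: "'m \<Rightarrow> real"
    and U :: "'m set"
    and N :: enat
    and h :: "nat \<Rightarrow> 'm \<Rightarrow> complex"
    and \<mu> :: real
  assumes "complex_manifold A"
    and "kaehler_form A \<omega>"
    and "mf_real_analytic_on A \<rho> UNIV"
    and "\<forall>p. \<rho> p > 0"
    and "form2_is_i_ddbar_on A \<omega> (\<lambda>p. ln (\<rho> p)) UNIV"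
    and "open U" and "connected U" and "U \<noteq> {}"
    and "1 \<le> N"
    and "\<forall>j. enat j < N \<longrightarrow> mf_holomorphic_on A (h j) U"
    and "\<forall>p\<in>U. (\<lambda>j. (cmod (tuple N h p j))\<^sup>2) sums \<rho> p"
    and "N = \<infinity> \<longrightarrow> locally_uniformly_convergent_on U (sq_partial_sum h)"
    and "\<mu> > 0"
    and "\<exists>K. sesqui_holomorphic A K \<and> (\<forall>z. K z z = complex_of_real (\<rho> z powr \<mu>))"
  shows "admits_semi_single_valued_extension A U N h
    \<and> (\<forall>j. enat j < N \<longrightarrow> admits_semi_single_valued_extension A U 1 (\<lambda>_. h j))
    \<and> (\<exists>k :: nat \<Rightarrow> 'm \<Rightarrow> real.
          (\<forall>j. enat j < N \<longrightarrow>
             mf_real_analytic_on A (k j) UNIV \<and>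
             (\<forall>p\<in>U. k j p = (cmod (h j p))\<^sup>2) \<and>
             (\<forall>\<gamma> W g. path \<gamma> \<and> pathstart \<gamma> \<in> U \<and> continuation_along A (h j) \<gamma> 1 W g \<longrightarrow>
                (\<forall>\<^sub>F x in nhds (pathfinish \<gamma>). k j x = (cmod (g x))\<^sup>2))) \<and>
          (\<forall>q. (\<lambda>j. if enat j < N then k j q else 0) sums \<rho> q))
    \<and> (2 \<le> N \<longrightarrow>
          bracket_well_defined A U N h \<and> isometric_immersion A \<omega> N (bracket A U N h))"
proof -
  obtain K where K: "sesqui_holomorphic A K" "\<forall>z. K z z = complex_of_real (\<rho> z powr \<mu>)"
    using assms(14) by blast
  \<comment> \<open>Padding by zeros turns the tuple into a sequence, so finite and infinite N are
    treated alike.\<close>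
  define H where "H j x = tuple N h x j" for j x
  have H_lt: "H j = h j" if "enat j < N" for j using that by (auto simp: H_def tuple_def)
  have H_ge: "H j = (\<lambda>_. 0)" if "\<not> enat j < N" for j using that by (auto simp: H_def tuple_def)
  interpret kernel_resolution A \<rho> H U \<mu> K
  proof
    show "mf_holomorphic_on A (H j) U" for j
    proof (cases "enat j < N")
      case True
      then show ?thesis using assms(10) H_lt by simp
    next
      case False
      then show ?thesis
        unfolding H_ge[OF False] mf_holomorphic_on_def o_def by (simp add: sv_holomorphic_on_const)
    qed
    show "(\<lambda>j. (cmod (H j p))\<^sup>2) sums \<rho> p" if "p \<in> U" for p
      using assms(11) that by (simp add: H_def)
  qed (use assms K in \<open>auto simp: sesqui_holomorphic_def\<close>)
  obtain V where V: "base_region V" by (rule obtain_base_region)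
  have fam_ex: "\<exists>S F. family V \<gamma> t S F" if "path \<gamma>" "pathstart \<gamma> \<in> U" "t \<in> {0..1}" for \<gamma> t
    using ex_family[OF V that(1) _ that(3)] that(2) by (simp add: pathstart_def)
  have family_admissible: "admissible V (S t) (F t)" "\<gamma> t \<in> S t" if "family V \<gamma> t S F" "0 \<le> t" for \<gamma> t S F
    using that by (auto simp: family_def)
  \<comment> \<open>Stated for a selection of components so that it serves both the full tuple and a
    single function regarded as a 1-tuple. Local uniform convergence is claimed only for the full
    sequence.\<close>
  have cont: "tuple_continuation_along A N' h' \<gamma> t (S t) F'"
    if fam: "family V \<gamma> t S F" and t: "0 \<le> t" and h': "\<And>j. enat j < N' \<Longrightarrow> \<exists>i. h' j = H i \<and> F' j = F t i"
      and inf: "N' = \<infinity> \<Longrightarrow> F' = F t" for \<gamma> t S F N' h' F'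
    unfolding tuple_continuation_along_def
  proof (intro conjI allI impI)
    have a: "resolution (S t) (F t)" using family_admissible[OF fam t] admissible_imp_resol by blast
    show "open (S t)" using a by (simp add: resolution_def)
    show "\<gamma> t \<in> S t" by (rule family_admissible[OF fam t])
    show "continuation_along A (h' j) \<gamma> t (S t) (F' j)" if "enat j < N'" for j
      using h'[OF that] continuation_of_family[OF fam t] by auto
    show "locally_uniformly_convergent_on (S t) (sq_partial_sum F')" if "N' = \<infinity>"
      using resolution_locally_uniform[OF a] inf[OF that] by simp
  qed
  have ext: "admits_extension A U N h"
    unfolding admits_extension_def
  proof (intro allI impI ballI)
    fix \<gamma> :: "real \<Rightarrow> 'm" and t :: real assume g: "path \<gamma> \<and> pathstart \<gamma> \<in> U" and t: "t \<in> {0..1}"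
    obtain S F where fam: "family V \<gamma> t S F" using fam_ex[of \<gamma> t] g t by auto
    have "tuple_continuation_along A N h \<gamma> t (S t) (F t)"
    proof (rule cont[OF fam])
      show "\<exists>i. h j = H i \<and> F t j = F t i" if "enat j < N" for j
        using H_lt[OF that] by (intro exI[of _ j]) simp
    qed (use t in auto)
    then show "\<exists>W g. tuple_continuation_along A N h \<gamma> t W g" by blast
  qed
  have ext1: "admits_extension A U 1 (\<lambda>_. h j)" if j: "enat j < N" for j
    unfolding admits_extension_def
  proof (intro allI impI ballI)
    fix \<gamma> :: "real \<Rightarrow> 'm" and t :: real assume g: "path \<gamma> \<and> pathstart \<gamma> \<in> U" and t: "t \<in> {0..1}"
    obtain S F where fam: "family V \<gamma> t S F" using fam_ex[of \<gamma> t] g t by auto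
    have "tuple_continuation_along A 1 (\<lambda>_. h j) \<gamma> t (S t) (\<lambda>_. F t j)"
    proof (rule cont[OF fam])
      show "\<exists>i. h j = H i \<and> F t j = F t i" using H_lt[OF j] by (intro exI[of _ j]) simp
    qed (use t in \<open>auto simp: one_enat_def\<close>)
    then show "\<exists>W g. tuple_continuation_along A 1 (\<lambda>_. h j) \<gamma> t W g" by blast
  qed
  \<comment> \<open>J is either the set of all indices below N or a singleton. In the second case
    only one component is continued in the data; the families constructed above supply the others,
    and the angle comes from comparing those families.\<close>
  have semi: "\<exists>\<theta>. \<forall>\<^sub>F x in nhds (pathfinish \<gamma>1). \<forall>j\<in>J. g1 j x = cis \<theta> * g2 j x"
    if \<gamma>: "path \<gamma>1" "path \<gamma>2" "pathstart \<gamma>1 \<in> U" "pathstart \<gamma>2 \<in> U" "pathfinish \<gamma>1 = pathfinish \<gamma>2"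
      and W: "open W1" "open W2" "pathfinish \<gamma>1 \<in> W1" "pathfinish \<gamma>1 \<in> W2"
      and c: "\<And>j. j \<in> J \<Longrightarrow> continuation_along A (H j) \<gamma>1 1 W1 (g1 j)"
        "\<And>j. j \<in> J \<Longrightarrow> continuation_along A (H j) \<gamma>2 1 W2 (g2 j)" for \<gamma>1 \<gamma>2 W1 W2 g1 g2 J
  proof -
    obtain S1 F1 where f1: "family V \<gamma>1 1 S1 F1" using fam_ex[OF \<gamma>(1,3), of 1] by auto
    obtain S2 F2 where f2: "family V \<gamma>2 1 S2 F2" using fam_ex[OF \<gamma>(2,4), of 1] by auto
    note a1 = family_admissible[OF f1 zero_le_one] and a2 = family_admissible[OF f2 zero_le_one]
    define q where "q = pathfinish \<gamma>1"
    have q: "\<gamma>1 1 = q" "\<gamma>2 1 = q" using \<gamma>(5) by (simp_all add: q_def pathfinish_def)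
    have W12: "open (W1 \<inter> W2)" "q \<in> W1 \<inter> W2" using W by (auto simp: q_def)
    obtain B \<kappa> r \<theta> where B: "coord_ball B \<kappa> (snd \<kappa> q) r" "q \<in> B" "B \<subseteq> S1 1 \<inter> S2 1 \<inter> (W1 \<inter> W2)"
      and \<theta>: "\<And>x j. x \<in> B \<Longrightarrow> F1 1 j x = cis \<theta> * F2 1 j x"
      using admissible_unique_at[OF V a1(1) a2(1) a1(2)[unfolded q] a2(2)[unfolded q] W12] by metis
    note SB = coord_ball(1,2)[OF B(1)]
    have "g1 j x = cis \<theta> * g2 j x" if x: "x \<in> B" and j: "j \<in> J" for x j
    proof -
      have "g1 j x = F1 1 j x"
        by (rule family_unique_on[OF f1 \<gamma>(1) c(1)[OF j] SB _ _ _ x]) (use B q in auto)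
      moreover have "g2 j x = F2 1 j x"
        by (rule family_unique_on[OF f2 \<gamma>(2) c(2)[OF j] SB _ _ _ x]) (use B q in auto)
      ultimately show ?thesis using \<theta>[OF x] by simp
    qed
    moreover have "\<forall>\<^sub>F x in nhds q. x \<in> B" using SB(1) B(2) by (rule eventually_nhds_in_open)
    ultimately show ?thesis unfolding q_def by (auto elim!: eventually_mono)
  qed
  have p1: "admits_semi_single_valued_extension A U N h"
    unfolding admits_semi_single_valued_extension_def
  proof (intro conjI ext allI impI, elim conjE)
    fix \<gamma>1 \<gamma>2 W1 W2 g1 g2
    assume g: "path \<gamma>1" "path \<gamma>2" "pathstart \<gamma>1 \<in> U" "pathstart \<gamma>1 = pathstart \<gamma>2" "pathfinish \<gamma>1 = pathfinish \<gamma>2"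
      and t: "tuple_continuation_along A N h \<gamma>1 1 W1 g1" "tuple_continuation_along A N h \<gamma>2 1 W2 g2"
    have "\<exists>\<theta>. \<forall>\<^sub>F x in nhds (pathfinish \<gamma>1). \<forall>j\<in>{j. enat j < N}. g1 j x = cis \<theta> * g2 j x"
    proof (rule semi[OF g(1,2,3) _ g(5)])
      show "pathstart \<gamma>2 \<in> U" using g by simp
      show "open W1" "open W2" "pathfinish \<gamma>1 \<in> W1" using t by (auto simp: tuple_continuation_along_def pathfinish_def)
      show "pathfinish \<gamma>1 \<in> W2" unfolding g(5) using t by (auto simp: tuple_continuation_along_def pathfinish_def)
    qed (use t H_lt in \<open>auto simp: tuple_continuation_along_def\<close>)
    then show "\<exists>\<theta>. \<forall>\<^sub>F x in nhds (pathfinish \<gamma>1). \<forall>j. enat j < N \<longrightarrow> g1 j x = cis \<theta> * g2 j x" by simp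
  qed
  have p2: "admits_semi_single_valued_extension A U 1 (\<lambda>_. h j)" if j: "enat j < N" for j
    unfolding admits_semi_single_valued_extension_def
  proof (intro conjI ext1[OF j] allI impI, elim conjE)
    fix \<gamma>1 \<gamma>2 W1 W2 g1 g2
    assume g: "path \<gamma>1" "path \<gamma>2" "pathstart \<gamma>1 \<in> U" "pathstart \<gamma>1 = pathstart \<gamma>2" "pathfinish \<gamma>1 = pathfinish \<gamma>2"
      and t: "tuple_continuation_along A 1 (\<lambda>_. h j) \<gamma>1 1 W1 g1" "tuple_continuation_along A 1 (\<lambda>_. h j) \<gamma>2 1 W2 g2"
    have "\<exists>\<theta>. \<forall>\<^sub>F x in nhds (pathfinish \<gamma>1). \<forall>i\<in>{j}. (\<lambda>_. g1 0) i x = cis \<theta> * (\<lambda>_. g2 0) i x"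
    proof (rule semi[OF g(1,2,3) _ g(5)])
      show "pathstart \<gamma>2 \<in> U" using g by simp
      show "open W1" "open W2" "pathfinish \<gamma>1 \<in> W1" using t by (auto simp: tuple_continuation_along_def pathfinish_def)
      show "pathfinish \<gamma>1 \<in> W2" unfolding g(5) using t by (auto simp: tuple_continuation_along_def pathfinish_def)
    qed (use t H_lt[OF j] in \<open>auto simp: tuple_continuation_along_def zero_enat_def[symmetric]\<close>)
    then show "\<exists>\<theta>. \<forall>\<^sub>F x in nhds (pathfinish \<gamma>1). \<forall>j. enat j < 1 \<longrightarrow> g1 j x = cis \<theta> * g2 j x"
      by (simp add: one_enat_def)
  qed
  \<comment> \<open>An arbitrary admissible resolution is selected at each point. Different
    selections differ by a unimodular factor, so the squared moduli \<open>k j q\<close> do not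
    depend on it and agree near q with those of any one resolution.\<close>
  define Gq where "Gq q = (SOME G. \<exists>S. admissible V S G \<and> q \<in> S)" for q
  have Gq: "\<exists>S. admissible V S (Gq q) \<and> q \<in> S" for q
  proof -
    have "\<exists>G S. admissible V S G \<and> q \<in> S" using ex_admissible[OF V] by blast
    then show ?thesis unfolding Gq_def by (rule someI_ex)
  qed
  define k where "k j q = (cmod (Gq q j q))\<^sup>2" for j q
  have k_eq: "k j x = (cmod (G j x))\<^sup>2" if G: "admissible V S G" "x \<in> S" for S G x j
  proof -
    obtain S' where S': "admissible V S' (Gq x)" "x \<in> S'" using Gq by blast
    obtain B \<kappa> r \<theta> where "x \<in> B" "\<And>y j. y \<in> B \<Longrightarrow> G j y = cis \<theta> * Gq x j y"
      using admissible_unique_at[OF V G(1) S'(1) G(2) S'(2) open_UNIV UNIV_I] by metis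
    then show ?thesis by (simp add: k_def norm_mult)
  qed
  have G_ge: "G j x = 0" if "admissible V S G" "x \<in> S" "\<not> enat j < N" for S G x j
    by (rule admissible_component_zero[OF V that(1,2)]) (simp add: H_ge[OF that(3)])
  have p3a: "mf_real_analytic_on A (k j) UNIV" for j
    unfolding mf_real_analytic_on_def
  proof (intro ballI)
    fix \<kappa> y assume \<kappa>: "\<kappa> \<in> A" and y: "y \<in> snd \<kappa> ` (fst \<kappa> \<inter> UNIV)"
    then obtain p where p: "p \<in> fst \<kappa>" "y = snd \<kappa> p" by auto
    obtain S G where G: "admissible V S G" "p \<in> S" using ex_admissible[OF V] by blast
    let ?T = "snd \<kappa> ` (fst \<kappa> \<inter> S)"
    have S: "open S" "mf_holomorphic_on A (G j) S" using G by (auto simp: admissible_def resolution_def)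
    have T: "open ?T" "y \<in> ?T" using open_chart_image[OF \<kappa> S(1)] p G by auto
    have "sv_holomorphic_on (G j \<circ> chart_inv \<kappa>) ?T" using S(2) \<kappa> by (auto simp: mf_holomorphic_on_def)
    then have "real_analytic_at (\<lambda>x. (cmod ((G j \<circ> chart_inv \<kappa>) x))\<^sup>2) y"
      using T by (rule real_analytic_at_cmod_power2)
    moreover have "\<forall>\<^sub>F x in nhds y. x \<in> ?T" using T by (rule eventually_nhds_in_open)
    then have "\<forall>\<^sub>F x in nhds y. (cmod ((G j \<circ> chart_inv \<kappa>) x))\<^sup>2 = (k j \<circ> chart_inv \<kappa>) x"
      by eventually_elim (use k_eq[OF G(1)] chart(5)[OF \<kappa>] in auto)
    ultimately show "real_analytic_at (k j \<circ> chart_inv \<kappa>) y" by (rule real_analytic_at_cong)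
  qed
  have p3b: "k j p = (cmod (h j p))\<^sup>2" if "enat j < N" "p \<in> U" for j p
    using k_eq[OF admissible_h[OF V] that(2)] H_lt[OF that(1)] by simp
  have p3c: "\<forall>\<^sub>F x in nhds (pathfinish \<gamma>). k j x = (cmod (g x))\<^sup>2"
    if j: "enat j < N" and g: "path \<gamma>" "pathstart \<gamma> \<in> U" "continuation_along A (h j) \<gamma> 1 W g" for j \<gamma> W g
  proof -
    obtain S F where f: "family V \<gamma> 1 S F" using fam_ex[OF g(1,2), of 1] by auto
    note a = family_admissible[OF f zero_le_one]
    have "\<forall>\<^sub>F x in nhds (\<gamma> 1). g x = F 1 j x"
      by (rule family_unique(4)[OF f g(1)]) (use g(3) H_lt[OF j] in simp)
    moreover have "\<forall>\<^sub>F x in nhds (\<gamma> 1). x \<in> S 1"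
      using a by (intro eventually_nhds_in_open) (auto simp: admissible_def resolution_def)
    ultimately show ?thesis
      unfolding pathfinish_def by eventually_elim (use k_eq[OF a(1)] in simp)
  qed
  have p3d: "(\<lambda>j. if enat j < N then k j q else 0) sums \<rho> q" for q
  proof -
    obtain S G where G: "admissible V S G" "q \<in> S" using ex_admissible[OF V] by blast
    have "(\<lambda>j. (cmod (G j q))\<^sup>2) sums \<rho> q" using G by (simp add: admissible_def resolution_def)
    moreover have "(cmod (G j q))\<^sup>2 = (if enat j < N then k j q else 0)" for j
      using k_eq[OF G] G_ge[OF G] by simp
    ultimately show ?thesis by simp
  qed
  have tup: "tuple N G x = (\<lambda>j. G j x)" if "admissible V S G" "x \<in> S" for S G x
    using G_ge[OF that] by (auto simp: tuple_def fun_eq_iff)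
  have nz: "tuple N G x \<in> cspace N - {\<lambda>_. 0}" if G: "admissible V S G" "x \<in> S" for S G x
  proof -
    have l: "l2 (\<lambda>j. G j x)" "l2sq (\<lambda>j. G j x) = \<rho> x" using resolution_l2[OF admissible_imp_resol[OF G(1)] G(2)] .
    have "(\<lambda>j. G j x) \<noteq> (\<lambda>_. 0)"
    proof
      assume "(\<lambda>j. G j x) = (\<lambda>_. 0)"
      then have "l2sq (\<lambda>j. G j x) = 0" by (simp add: l2sq_def)
      then show False using l(2) pos[of x] by simp
    qed
    then show ?thesis
      using l(1) G_ge[OF G] unfolding tup[OF G] by (auto simp: cspace_def l2_def not_less)
  qed
  \<comment> \<open>Every value of a continuation of the tuple is the value of an admissible
    resolution, so nonvanishing and uniqueness up to a unimodular factor, proved for the latter,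
    hold for all continuation values.\<close>
  have cv: "\<exists>S G. admissible V S G \<and> q \<in> S \<and> z = tuple N G q" if z: "z \<in> continuation_values A U N h q" for z q
  proof -
    obtain \<gamma> W g where g: "path \<gamma>" "pathstart \<gamma> \<in> U" "pathfinish \<gamma> = q"
      "tuple_continuation_along A N h \<gamma> 1 W g" "z = tuple N g q"
      using z unfolding continuation_values_def by blast
    obtain S F where f: "family V \<gamma> 1 S F" using fam_ex[OF g(1,2), of 1] by auto
    have "g j q = F 1 j q" if j: "enat j < N" for j
    proof -
      have "\<forall>\<^sub>F x in nhds (\<gamma> 1). g j x = F 1 j x"
        using g(4) j H_lt[OF j]
        by (intro family_unique(4)[OF f g(1)]) (auto simp: tuple_continuation_along_def)
      then show ?thesis using g(3) eventually_nhds_x_imp_x by (fastforce simp: pathfinish_def)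
    qed
    then have "z = tuple N (F 1) q" using g(5) by (auto simp: tuple_def fun_eq_iff)
    then show ?thesis using family_admissible[OF f zero_le_one] g(3) by (auto simp: pathfinish_def)
  qed
  have cv_ne: "continuation_values A U N h q \<noteq> {}" for q
  proof -
    obtain \<gamma> where \<gamma>: "path \<gamma>" "pathstart \<gamma> \<in> U" "pathfinish \<gamma> = q"
      using ex_path[OF U(3), of q] by metis
    then obtain W g where "tuple_continuation_along A N h \<gamma> 1 W g"
      using ext unfolding admits_extension_def by fastforce
    then show ?thesis using \<gamma> by (auto simp: continuation_values_def)
  qed
  have same: "proj_class N (tuple N G q) = proj_class N (tuple N G' q)"
    if G: "admissible V S G" "q \<in> S" "admissible V S' G'" "q \<in> S'" for S G S' G' q
  proof -
    obtain B \<kappa> r \<theta> where "q \<in> B" "\<And>x j. x \<in> B \<Longrightarrow> G j x = cis \<theta> * G' j x"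
      using admissible_unique_at[OF V G(1,3,2,4) open_UNIV UNIV_I] by metis
    then have "tuple N G q = (\<lambda>j. cis \<theta> * tuple N G' q j)"
      unfolding tup[OF G(1,2)] tup[OF G(3,4)] by auto
    then show ?thesis by (intro proj_class_scale[symmetric] nz[OF G(1,2)] nz[OF G(3,4)]) auto
  qed
  have wd: "bracket_well_defined A U N h"
    unfolding bracket_well_defined_def
  proof (intro allI conjI ballI subsetI cv_ne)
    fix q z assume "z \<in> continuation_values A U N h q"
    then obtain S G where "admissible V S G" "q \<in> S" "z = tuple N G q" using cv by blast
    then show "z \<in> cspace N - {\<lambda>_. 0}" using nz[of S G q] by simp
  next
    fix q z w assume "z \<in> continuation_values A U N h q" "w \<in> continuation_values A U N h q"
    then obtain S G S' G' where "admissible V S G" "q \<in> S" "z = tuple N G q"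
      "admissible V S' G'" "q \<in> S'" "w = tuple N G' q"
      using cv by meson
    then show "proj_class N z = proj_class N w" using same[of S G q S' G'] by simp
  qed
  have bracket: "bracket A U N h x = proj_class N (tuple N G x)" if G: "admissible V S G" "x \<in> S" for S G x
  proof -
    have "(SOME z. z \<in> continuation_values A U N h x) \<in> continuation_values A U N h x"
      using cv_ne by (simp add: some_in_eq)
    from cv[OF this] same[OF _ _ G] show ?thesis by (metis bracket_def)
  qed
  have iso: "isometric_immersion A \<omega> N (bracket A U N h)"
    unfolding isometric_immersion_def
  proof (intro conjI allI subsetI)
    fix c assume "c \<in> range (bracket A U N h)"
    then obtain x where x: "c = bracket A U N h x" by blast
    obtain S G where G: "admissible V S G" "x \<in> S" using ex_admissible[OF V] by blast
    show "c \<in> proj_space N"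
      unfolding x bracket[OF G] proj_class_def proj_space_def by (rule quotientI[OF nz[OF G]])
  next
    fix p
    obtain S G where G: "admissible V S G" "p \<in> S" using ex_admissible[OF V] by blast
    have S: "open S" "\<And>j. mf_holomorphic_on A (G j) S" using G by (auto simp: admissible_def resolution_def)
    obtain W0 where W0: "open W0" "p \<in> W0" "uniformly_convergent_on (W0 \<inter> S) (sq_partial_sum G)"
      using resolution_locally_uniform[OF admissible_imp_resol[OF G(1)]] G(2)
      unfolding locally_uniformly_convergent_on_def by blast
    define W where "W = W0 \<inter> S"
    have W: "open W" "p \<in> W" "W \<subseteq> S" using W0 S G by (auto simp: W_def)
    have sum: "(\<Sum>k. (cmod (tuple N G x k))\<^sup>2) = \<rho> x" if "x \<in> S" for x
      using resolution_l2(2)[OF admissible_imp_resol[OF G(1)] that] unfolding tup[OF G(1) that] l2sq_def .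
    show "\<exists>W f. open W \<and> p \<in> W \<and>
        (\<forall>k. enat k < N \<longrightarrow> mf_holomorphic_on A (f k) W) \<and>
        (\<forall>x\<in>W. \<exists>k. enat k < N \<and> f k x \<noteq> 0) \<and>
        (N = \<infinity> \<longrightarrow> uniformly_convergent_on W (sq_partial_sum f)) \<and>
        form2_is_i_ddbar_on A \<omega> (\<lambda>x. ln (\<Sum>k. (cmod (tuple N f x k))\<^sup>2)) W \<and>
        (\<forall>x\<in>W. bracket A U N h x = proj_class N (tuple N f x))"
    proof (intro exI[of _ W] exI[of _ G] conjI allI impI ballI)
      show "open W" "p \<in> W" by fact+
      show "mf_holomorphic_on A (G j) W" for j using S(2) W(3) by (rule hol_on_subset)
      show "\<exists>k. enat k < N \<and> G k x \<noteq> 0" if "x \<in> W" for x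
      proof (rule ccontr)
        assume "\<not> ?thesis"
        then have "tuple N G x = (\<lambda>_. 0)" by (auto simp: tuple_def)
        then show False using nz[OF G(1), of x] that W(3) by auto
      qed
      show "uniformly_convergent_on W (sq_partial_sum G)" using W0(3) by (simp add: W_def)
      show "bracket A U N h x = proj_class N (tuple N G x)" if "x \<in> W" for x
        using bracket[OF G(1)] that W(3) by blast
      \<comment> \<open>The sum of squares of an admissible resolution is \<rho> on its whole
        domain. The potential therefore has the same germs as ln \<rho> there, and the given formula
        for \<omega> transfers by locality.\<close>
      show "form2_is_i_ddbar_on A \<omega> (\<lambda>x. ln (\<Sum>k. (cmod (tuple N G x k))\<^sup>2)) W"
        unfolding form2_is_i_ddbar_on_def
      proof (intro ballI allI)
        fix \<kappa> x u v assume \<kappa>: "\<kappa> \<in> A" and x: "x \<in> fst \<kappa> \<inter> W"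
        let ?T = "snd \<kappa> ` (fst \<kappa> \<inter> W)"
        have "open ?T" "snd \<kappa> x \<in> ?T" using open_chart_image[OF \<kappa> W(1)] x by auto
        then have "\<forall>\<^sub>F y in nhds (snd \<kappa> x). y \<in> ?T" by (rule eventually_nhds_in_open)
        then have "\<forall>\<^sub>F y in nhds (snd \<kappa> x). ln (\<rho> (chart_inv \<kappa> y)) =
            ln (\<Sum>k. (cmod (tuple N G (chart_inv \<kappa> y) k))\<^sup>2)"
          by eventually_elim (use sum chart(5)[OF \<kappa>] W(3) in auto)
        from i_ddbar_cong[OF this, of u v] assms(5) \<kappa> x
        show "complex_of_real (\<omega> \<kappa> x u v) = i_ddbar (\<lambda>x. ln (\<Sum>k. (cmod (tuple N G x k))\<^sup>2)) \<kappa> x u v"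
          unfolding form2_is_i_ddbar_on_def by auto
      qed
    qed
  qed
  show ?thesis
    using p1 p2 p3a p3b p3c p3d wd iso by (intro conjI exI[of _ k] allI impI ballI) auto
qed

end
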